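(* Let $P_\epsilon$ be a local family of Poisson structures on $\mathbb{R}^3$ such that $P(0)=0$ and $j^1_0P\neq 0$, where $P=P_0$. Assume that $j^1_0P$ is not isomorphic to the linear Poisson structure $$\{x,y\}=0,\quad \{y,z\}=y,\quad \{z,x\}=-x.$$ Then $P_\epsilon$ is equivalent to a local family of the form $$\{x,y\}=z,\quad \{y,z\}=U_\epsilon(x,y,z),\quad \{z,x\}=V_\epsilon(x,y,z), \qquad ( * )$$ and there exists a family of formal changes of the coordinates $x,y,z$, centered at the point $x=y=z=0$ for all $\epsilon$, reducing $( * )$ to the form $$\{x,y\}=z,\quad \{y,z\}=\frac{\partial \hat f_\epsilon(x,y)}{\partial x}+z\frac{\partial \hat g_\epsilon(x,y)}{\partial x},\quad \{z,x\}=\frac{\partial \hat f_\epsilon(x,y)}{\partial y}+z\frac{\partial \hat g_\epsilon(x,y)}{\partial y},$$ where the formal series $\hat f_\epsilon$ and $\hat g_\epsilon$ satisfy the relations $$\hat f_\epsilon(0)=\hat g_\epsilon(0)=0,\qquad d\hat f_\epsilon\wedge d\hat g_\epsilon\equiv 0.$$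
   Context: All objects are of class $C^\infty$ and all families depend smoothly on the parameter $\epsilon$, which varies near $0\in\mathbb{R}^l$. A local family $P_\epsilon$ of Poisson structures on $\mathbb{R}^3$ is considered as a germ near the origin of $\mathbb{R}^3$ and $\epsilon=0$. A Poisson structure in coordinates $x,y,z$ is given by its brackets $\{x,y\},\{y,z\},\{z,x\}$, or equivalently by the bivector field $P=\{x,y\}\,\partial_x\wedge\partial_y+\{y,z\}\,\partial_y\wedge\partial_z+\{z,x\}\,\partial_z\wedge\partial_x$. Two local families $P_\epsilon$ and $\tilde P_\epsilon$ are called equivalent if there is a family of local diffeomorphisms $\phi_\epsilon$ (smooth in $\epsilon$) with $\phi_0(0)=0$ and $(\phi_\epsilon)_*P_\epsilon=\tilde P_\epsilon$ for all small $\epsilon$; it is not required that $\phi_\epsilon(0)=0$ for $\epsilon\ne0$. If $P(0)=0$, the 1-jet $j^1_0P$ is a linear Poisson structure (a Lie algebra); isomorphism means equivalence under linear changes of coordinates. A formal change of coordinates centered at $x=y=z=0$ is an invertible formal power series change of coordinates without constant terms, with coefficients depending smoothly on $\epsilon$; it acts on the Taylor series of the Poisson structure at $x=y=z=0$. The formal series $\hat f_\epsilon,\hat g_\epsilon$ are formal power series in $(x,y)$ with coefficients depending smoothly on $\epsilon$. *)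

theory Defs
  imports "HOL-Analysis.Analysis" "HOL-Computational_Algebra.Formal_Power_Series"
begin

section \<open>Smooth maps on open sets\<close>

primrec Ck_on :: "nat \<Rightarrow> 'a::euclidean_space set \<Rightarrow> ('a \<Rightarrow> 'b::real_normed_vector) \<Rightarrow> bool" where
  "Ck_on 0 S f \<longleftrightarrow> continuous_on S f"
| "Ck_on (Suc k) S f \<longleftrightarrow> (\<forall>x\<in>S. f differentiable (at x)) \<and>
     (\<forall>v. Ck_on k S (\<lambda>x. frechet_derivative f (at x) v))"

text \<open>Meant for open \<open>S\<close> only: the derivatives are taken in the whole space.\<close>

definition smooth_on :: "'a::euclidean_space set \<Rightarrow> ('a \<Rightarrow> 'b::real_normed_vector) \<Rightarrow> bool" where
  "smooth_on S f \<longleftrightarrow> (\<forall>k. Ck_on k S f)"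

definition partial :: "3 \<Rightarrow> (real^3 \<Rightarrow> real) \<Rightarrow> real^3 \<Rightarrow> real" where
  "partial i f p = frechet_derivative f (at p) (axis i 1)"


section \<open>Poisson structures on 3-space\<close>

text \<open>
  The coordinates are \<open>x = p $ 1\<close>, \<open>y = p $ 2\<close>, \<open>z = p $ 3\<close>. A bivector field \<open>P\<close> is given by
  the three functions \<open>P p $ 1 = {x,y}\<close>, \<open>P p $ 2 = {y,z}\<close>, \<open>P p $ 3 = {z,x}\<close>.
\<close>

type_synonym bivector_field = "real^3 \<Rightarrow> real^3"

definition bracket ::
  "bivector_field \<Rightarrow> (real^3 \<Rightarrow> real) \<Rightarrow> (real^3 \<Rightarrow> real) \<Rightarrow> real^3 \<Rightarrow> real" where
  "bracket P f g p =
     P p $ 1 * (partial 1 f p * partial 2 g p - partial 2 f p * partial 1 g p) +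
     P p $ 2 * (partial 2 f p * partial 3 g p - partial 3 f p * partial 2 g p) +
     P p $ 3 * (partial 3 f p * partial 1 g p - partial 1 f p * partial 3 g p)"

definition poisson_on :: "(real^3) set \<Rightarrow> bivector_field \<Rightarrow> bool" where
  "poisson_on S P \<longleftrightarrow> smooth_on S P \<and>
     (\<forall>f g h. smooth_on S f \<and> smooth_on S g \<and> smooth_on S h \<longrightarrow>
        (\<forall>p\<in>S. bracket P f (bracket P g h) p + bracket P g (bracket P h f) p
              + bracket P h (bracket P f g) p = 0))"

text \<open>
  The value of \<open>\<phi>\<^sub>* P\<close> at the point \<open>\<phi> p\<close>, i.e. the brackets of the components of \<open>\<phi>\<close> at \<open>p\<close>.
\<close>

definition pushforward_at :: "(real^3 \<Rightarrow> real^3) \<Rightarrow> bivector_field \<Rightarrow> real^3 \<Rightarrow> real^3" where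
  "pushforward_at \<phi> P p = vector
     [bracket P (\<lambda>q. \<phi> q $ 1) (\<lambda>q. \<phi> q $ 2) p,
      bracket P (\<lambda>q. \<phi> q $ 2) (\<lambda>q. \<phi> q $ 3) p,
      bracket P (\<lambda>q. \<phi> q $ 3) (\<lambda>q. \<phi> q $ 1) p]"

definition jet1 :: "bivector_field \<Rightarrow> bivector_field" where
  "jet1 P = (\<lambda>p. P 0 + frechet_derivative P (at 0) p)"

definition linear_isomorphic :: "bivector_field \<Rightarrow> bivector_field \<Rightarrow> bool" where
  "linear_isomorphic P Q \<longleftrightarrow>
     (\<exists>A. linear A \<and> bij A \<and> (\<forall>p. Q (A p) = pushforward_at A P p))"

definition exceptional_structure :: bivector_field where
  "exceptional_structure p = vector [0, p $ 2, - (p $ 1)]"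


section \<open>Local families and their equivalence\<close>

text \<open>
  Germs at \<open>(\<epsilon>, p) = (0, 0)\<close> are represented by total functions; only their values near
  \<open>(0, 0)\<close> matter in \<open>local_poisson_family\<close> and \<open>equivalent_families\<close>.
\<close>

definition local_poisson_family :: "(real^'l \<Rightarrow> bivector_field) \<Rightarrow> bool" where
  "local_poisson_family P \<longleftrightarrow>
     (\<exists>E S. open E \<and> 0 \<in> E \<and> open S \<and> 0 \<in> S \<and>
        smooth_on (E \<times> S) (\<lambda>(\<epsilon>, p). P \<epsilon> p) \<and> (\<forall>\<epsilon>\<in>E. poisson_on S (P \<epsilon>)))"

definition diffeo_onto_image :: "(real^3) set \<Rightarrow> (real^3 \<Rightarrow> real^3) \<Rightarrow> bool" where
  "diffeo_onto_image S \<phi> \<longleftrightarrow> smooth_on S \<phi> \<and> open (\<phi> ` S) \<and>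
     (\<exists>\<psi>. smooth_on (\<phi> ` S) \<psi> \<and> (\<forall>p\<in>S. \<psi> (\<phi> p) = p))"

definition equivalent_families ::
  "(real^'l \<Rightarrow> bivector_field) \<Rightarrow> (real^'l \<Rightarrow> bivector_field) \<Rightarrow> bool" where
  "equivalent_families P Q \<longleftrightarrow>
     (\<exists>E S \<phi>. open E \<and> 0 \<in> E \<and> open S \<and> 0 \<in> S \<and>
        smooth_on (E \<times> S) (\<lambda>(\<epsilon>, p). \<phi> \<epsilon> p) \<and> \<phi> 0 0 = 0 \<and>
        (\<forall>\<epsilon>\<in>E. diffeo_onto_image S (\<phi> \<epsilon>) \<and>
           (\<forall>p\<in>S. Q \<epsilon> (\<phi> \<epsilon> p) = pushforward_at (\<phi> \<epsilon>) (P \<epsilon>) p)))"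


section \<open>Formal power series in two and three variables\<close>

text \<open>
  Series in \<open>x, y\<close> and in \<open>x, y, z\<close> are nested univariate series; the outermost variable
  is \<open>x\<close>, the innermost one is \<open>y\<close> resp. \<open>z\<close>.
\<close>

type_synonym fps2 = "real fps fps"
type_synonym fps3 = "real fps fps fps"

definition coeff2 :: "fps2 \<Rightarrow> nat \<Rightarrow> nat \<Rightarrow> real" where
  "coeff2 f i j = fps_nth (fps_nth f i) j"

definition coeff3 :: "fps3 \<Rightarrow> nat \<Rightarrow> nat \<Rightarrow> nat \<Rightarrow> real" where
  "coeff3 F i j k = fps_nth (fps_nth (fps_nth F i) j) k"

definition series3 :: "(nat \<Rightarrow> nat \<Rightarrow> nat \<Rightarrow> real) \<Rightarrow> fps3" where
  "series3 c = Abs_fps (\<lambda>i. Abs_fps (\<lambda>j. Abs_fps (\<lambda>k. c i j k)))"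

definition X3 :: fps3 where "X3 = fps_X"
definition Y3 :: fps3 where "Y3 = fps_const fps_X"
definition Z3 :: fps3 where "Z3 = fps_const (fps_const fps_X)"

definition dx2 :: "fps2 \<Rightarrow> fps2" where "dx2 f = fps_deriv f"
definition dy2 :: "fps2 \<Rightarrow> fps2" where "dy2 f = Abs_fps (\<lambda>i. fps_deriv (fps_nth f i))"

definition dx3 :: "fps3 \<Rightarrow> fps3" where
  "dx3 F = fps_deriv F"
definition dy3 :: "fps3 \<Rightarrow> fps3" where
  "dy3 F = Abs_fps (\<lambda>i. fps_deriv (fps_nth F i))"
definition dz3 :: "fps3 \<Rightarrow> fps3" where
  "dz3 F = Abs_fps (\<lambda>i. Abs_fps (\<lambda>j. fps_deriv (fps_nth (fps_nth F i) j)))"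

definition lift23 :: "fps2 \<Rightarrow> fps3" where
  "lift23 f = Abs_fps (\<lambda>i. Abs_fps (\<lambda>j. fps_const (coeff2 f i j)))"

text \<open>
  Substitution \<open>F(\<Phi> $ 1, \<Phi> $ 2, \<Phi> $ 3)\<close>, meaningful if the \<open>\<Phi> $ m\<close> have no constant term:
  then the monomials of \<open>F\<close> with an exponent above \<open>a + b + c\<close> do not contribute to the
  coefficient of \<open>x^a y^b z^c\<close>, so that the finite sum is the full one.
\<close>

definition fsubst :: "fps3 \<Rightarrow> fps3^3 \<Rightarrow> fps3" where
  "fsubst F \<Phi> = series3 (\<lambda>a b c.
     \<Sum>i\<le>a+b+c. \<Sum>j\<le>a+b+c. \<Sum>k\<le>a+b+c.
       coeff3 F i j k * coeff3 ((\<Phi> $ 1)^i * (\<Phi> $ 2)^j * (\<Phi> $ 3)^k) a b c)"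

definition no_constant_term :: "fps3^3 \<Rightarrow> bool" where
  "no_constant_term \<Phi> \<longleftrightarrow> (\<forall>m. coeff3 (\<Phi> $ m) 0 0 0 = 0)"

definition fcompose :: "fps3^3 \<Rightarrow> fps3^3 \<Rightarrow> fps3^3" where
  "fcompose \<Phi> \<Psi> = (\<chi> m. fsubst (\<Phi> $ m) \<Psi>)"

definition formal_change :: "fps3^3 \<Rightarrow> bool" where
  "formal_change \<Phi> \<longleftrightarrow> no_constant_term \<Phi> \<and>
     (\<exists>\<Psi>. no_constant_term \<Psi> \<and>
        fcompose \<Phi> \<Psi> = vector [X3, Y3, Z3] \<and> fcompose \<Psi> \<Phi> = vector [X3, Y3, Z3])"

definition taylor :: "(real^3 \<Rightarrow> real) \<Rightarrow> fps3" where
  "taylor f = series3 (\<lambda>i j k.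
     ((partial 1 ^^ i) ((partial 2 ^^ j) ((partial 3 ^^ k) f))) 0 / (fact i * fact j * fact k))"

definition taylor_bivector :: "bivector_field \<Rightarrow> fps3^3" where
  "taylor_bivector P = (\<chi> m. taylor (\<lambda>p. P p $ m))"

text \<open>Formal bivector fields are encoded by \<open>({x,y}, {y,z}, {z,x})\<close> as in the smooth case.\<close>

definition formal_bracket :: "fps3^3 \<Rightarrow> fps3 \<Rightarrow> fps3 \<Rightarrow> fps3" where
  "formal_bracket B F G =
     B $ 1 * (dx3 F * dy3 G - dy3 F * dx3 G) +
     B $ 2 * (dy3 F * dz3 G - dz3 F * dy3 G) +
     B $ 3 * (dz3 F * dx3 G - dx3 F * dz3 G)"

text \<open>
  \<open>\<Phi>\<close> expresses the new coordinates as series in the old ones; \<open>N\<close> is \<open>B\<close> written in the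
  new coordinates.
\<close>

definition formal_reduces :: "fps3^3 \<Rightarrow> fps3^3 \<Rightarrow> fps3^3 \<Rightarrow> bool" where
  "formal_reduces \<Phi> B N \<longleftrightarrow>
     fsubst (N $ 1) \<Phi> = formal_bracket B (\<Phi> $ 1) (\<Phi> $ 2) \<and>
     fsubst (N $ 2) \<Phi> = formal_bracket B (\<Phi> $ 2) (\<Phi> $ 3) \<and>
     fsubst (N $ 3) \<Phi> = formal_bracket B (\<Phi> $ 3) (\<Phi> $ 1)"

definition formal_normal_form :: "fps2 \<Rightarrow> fps2 \<Rightarrow> fps3^3" where
  "formal_normal_form f g = vector
     [Z3,
      lift23 (dx2 f) + Z3 * lift23 (dx2 g),
      lift23 (dy2 f) + Z3 * lift23 (dy2 g)]"

definition smooth_coeffs2 :: "(real^'l) set \<Rightarrow> (real^'l \<Rightarrow> fps2) \<Rightarrow> bool" where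
  "smooth_coeffs2 E f \<longleftrightarrow> (\<forall>i j. smooth_on E (\<lambda>\<epsilon>. coeff2 (f \<epsilon>) i j))"

definition smooth_coeffs3 :: "(real^'l) set \<Rightarrow> (real^'l \<Rightarrow> fps3^3) \<Rightarrow> bool" where
  "smooth_coeffs3 E \<Phi> \<longleftrightarrow> (\<forall>m i j k. smooth_on E (\<lambda>\<epsilon>. coeff3 (\<Phi> \<epsilon> $ m) i j k))"

end

theory Submission
  imports Defs
begin

text \<open>
  A bivector field \<open>P\<close> on 3-space is the same thing as the vector field
  \<open>W = ({y,z}, {z,x}, {x,y})\<close>: then \<open>{f,g} = W \<bullet> (grad f \<times> grad g)\<close>, and the Jacobi
  identity says \<open>W \<bullet> curl W = 0\<close> (\<open>jacobiator_eq\<close>, \<open>poisson_on_iff_curl_defect\<close>).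

  Smooth part. Let \<open>W p = M p\<close> to first order at \<open>\<epsilon> = 0\<close>. If the quadratic form \<open>c \<bullet> M c\<close>
  vanishes identically, then \<open>M p = m \<times> p\<close>, and the 1-jet is zero (\<open>m = 0\<close>) or isomorphic to the
  exceptional structure. Both are excluded, so there is \<open>c\<close> with \<open>c \<bullet> M c \<noteq> 0\<close>. Writing
  \<open>c = a \<times> b\<close> with \<open>a\<close>, \<open>b\<close> orthogonal, the linear functions \<open>X = a \<bullet> p\<close>, \<open>Y = b \<bullet> p\<close> are
  constant along \<open>c\<close>, while their bracket \<open>Z\<^sub>\<epsilon> = {X,Y}\<^sub>\<epsilon> = W\<^sub>\<epsilon> \<bullet> c\<close> has a nonzero derivative along
  \<open>c\<close>. By the inverse function theorem for \<open>(\<epsilon>, p) \<mapsto> (\<epsilon>, X, Y, Z\<^sub>\<epsilon>)\<close>, the functions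
  \<open>X, Y, Z\<^sub>\<epsilon>\<close> are coordinates near the origin for all small \<open>\<epsilon>\<close>, and \<open>{X,Y} = Z\<close> in them
  (\<open>straightening\<close>).

  Formal part. Let \<open>{x,y} = z\<close>. Keep \<open>y\<close>, replace \<open>x\<close> by a series \<open>X = x + \<dots>\<close>; the third
  coordinate is then forced to be \<open>Z = {X,y}\<close>. Orders are measured in powers of the ideal
  \<open>I = (x, y)\<close>, with \<open>z\<close> of degree zero. In this grading \<open>z \<partial>x \<and> \<partial>y\<close> is the leading part of the
  structure even if \<open>{y,z}\<close> and \<open>{z,x}\<close> have constant terms, which they may have for
  \<open>\<epsilon> \<noteq> 0\<close>. Suppose that
  \<open>R = {y,Z} - (f\<^sub>x + Z g\<^sub>x)\<close> and \<open>S = {Z,X} - (f\<^sub>y + Z g\<^sub>y)\<close>, with \<open>f\<close>, \<open>g\<close> evaluated at \<open>(X, y)\<close>,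
  lie in \<open>I^m\<close>. The Jacobi identity for \<open>X, y, Z\<close> gives
  \<open>D(X,y) + z (R\<^sub>y - S\<^sub>x) \<in> I^m\<close> with \<open>D = f\<^sub>x g\<^sub>y - f\<^sub>y g\<^sub>x\<close> (\<open>residues_jacobi_relation\<close>). Since
  \<open>D(x,y)\<close> does not involve \<open>z\<close>, both summands vanish to that order; in particular the parts of
  degree \<open>m\<close> of \<open>R\<close> and \<open>S\<close> are \<open>F\<^sub>x\<close> and \<open>F\<^sub>y\<close> for some \<open>F\<close> (\<open>residues_curl_free\<close>,
  \<open>primitive3\<close>). Decompose \<open>F = F\<^sub>0(x,y) + z F\<^sub>1(x,y) + z\<^sup>2 H(x,y,z)\<close>. Adding \<open>F\<^sub>0\<close> to \<open>f\<close>,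
  \<open>F\<^sub>1\<close> to \<open>g\<close> and to \<open>X\<close> a series \<open>A\<close> with \<open>A\<^sub>x = H\<close> changes the pair \<open>(R, S)\<close> by
  \<open>-(F\<^sub>x, F\<^sub>y)\<close> modulo \<open>I^(m+1)\<close> (\<open>residue2_perturbation\<close>, \<open>residue3_perturbation\<close>), so the
  new residues lie in \<open>I^(m+1)\<close>. The corrections converge \<open>I\<close>-adically, and in the limit \<open>R = S = 0\<close>
  and hence \<open>D = 0\<close> (\<open>normal_form_limit\<close>, \<open>formal_normal_form\<close>).

  At each step the coefficients are finite sums of products of earlier ones with rational weights, so
  smoothness in \<open>\<epsilon>\<close> is preserved. The change of coordinates is invertible because substituting it
  differs from the identity by an operator that raises the \<open>I\<close>-adic order
  (\<open>near_identity_formal_change\<close>).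
\<close>

section \<open>The Jacobiator\<close>

text \<open>
  The value of \<open>{f,g}\<close> as a polynomial in the components of the bivector and the first partial
  derivatives, over an arbitrary commutative ring: the smooth and the formal bracket are both
  instances, so that the Jacobiator is computed only once.
\<close>

definition bracket3 :: "'a::comm_ring_1 \<Rightarrow> 'a \<Rightarrow> 'a \<Rightarrow> 'a \<Rightarrow> 'a \<Rightarrow> 'a \<Rightarrow> 'a \<Rightarrow> 'a \<Rightarrow> 'a \<Rightarrow> 'a" where
  "bracket3 p1 p2 p3 f1 f2 f3 g1 g2 g3 =
     p1 * (f1 * g2 - f2 * g1) + p2 * (f2 * g3 - f3 * g2) + p3 * (f3 * g1 - f1 * g3)"

text \<open>
  The derivative of that polynomial by the product rule; the primed arguments stand for the
  derivatives of the unprimed ones.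
\<close>

definition bracket3_deriv where
  "bracket3_deriv p1 p2 p3 p1' p2' p3' f1 f2 f3 f1' f2' f3' g1 g2 g3 g1' g2' g3' =
     bracket3 p1' p2' p3' f1 f2 f3 g1 g2 g3 + bracket3 p1 p2 p3 f1' f2' f3' g1 g2 g3
      + bracket3 p1 p2 p3 f1 f2 f3 g1' g2' g3'"

text \<open>
  All terms with second derivatives cancel, and the sum is minus \<open>W \<bullet> curl W\<close> times the
  determinant of the three gradients. Here \<open>pij\<close> is the derivative of \<open>pi\<close> in direction \<open>j\<close>, while
  the symmetric second derivatives of \<open>f\<close>, \<open>g\<close>, \<open>h\<close> are written with increasing indices.
\<close>

lemma jacobiator_eq:
  fixes p1 p2 p3 :: "'a::comm_ring_1"
  shows
  "bracket3 p1 p2 p3 f1 f2 f3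
     (bracket3_deriv p1 p2 p3 p11 p21 p31 g1 g2 g3 g11 g12 g13 h1 h2 h3 h11 h12 h13)
     (bracket3_deriv p1 p2 p3 p12 p22 p32 g1 g2 g3 g12 g22 g23 h1 h2 h3 h12 h22 h23)
     (bracket3_deriv p1 p2 p3 p13 p23 p33 g1 g2 g3 g13 g23 g33 h1 h2 h3 h13 h23 h33) +
   bracket3 p1 p2 p3 g1 g2 g3
     (bracket3_deriv p1 p2 p3 p11 p21 p31 h1 h2 h3 h11 h12 h13 f1 f2 f3 f11 f12 f13)
     (bracket3_deriv p1 p2 p3 p12 p22 p32 h1 h2 h3 h12 h22 h23 f1 f2 f3 f12 f22 f23)
     (bracket3_deriv p1 p2 p3 p13 p23 p33 h1 h2 h3 h13 h23 h33 f1 f2 f3 f13 f23 f33) +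
   bracket3 p1 p2 p3 h1 h2 h3
     (bracket3_deriv p1 p2 p3 p11 p21 p31 f1 f2 f3 f11 f12 f13 g1 g2 g3 g11 g12 g13)
     (bracket3_deriv p1 p2 p3 p12 p22 p32 f1 f2 f3 f12 f22 f23 g1 g2 g3 g12 g22 g23)
     (bracket3_deriv p1 p2 p3 p13 p23 p33 f1 f2 f3 f13 f23 f33 g1 g2 g3 g13 g23 g33) =
   - (p1 * (p31 - p22) + p2 * (p12 - p33) + p3 * (p23 - p11)) *
     bracket3 h3 h1 h2 f1 f2 f3 g1 g2 g3"
  unfolding bracket3_deriv_def bracket3_def by (simp add: algebra_simps)

section \<open>Calculus of smooth maps\<close>

lemma Ck_on_SucD: "Ck_on (Suc k) S f \<Longrightarrow> Ck_on k S f"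
proof (induction k arbitrary: f)
  case 0
  then show ?case
    by (auto intro!: continuous_at_imp_continuous_on differentiable_imp_continuous_within)
next
  case (Suc k)
  then show ?case by (metis Ck_on.simps(2))
qed

lemma frechet_derivative_cong:
  assumes "open S" "x \<in> S" "\<And>y. y \<in> S \<Longrightarrow> f y = g y"
  shows "frechet_derivative f (at x) = frechet_derivative g (at x)"
proof -
  have "(f has_derivative D) (at x) \<longleftrightarrow> (g has_derivative D) (at x)" for D
    using assms has_derivative_transform_within_open[of f D x UNIV S g]
      has_derivative_transform_within_open[of g D x UNIV S f] by auto
  then show ?thesis unfolding frechet_derivative_def by simp
qed

lemma differentiable_cong:
  assumes "open S" "x \<in> S" "\<And>y. y \<in> S \<Longrightarrow> f y = g y" "f differentiable (at x)"
  shows "g differentiable (at x)"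
  using assms has_derivative_transform_within_open[of f _ x UNIV S g]
  unfolding differentiable_def by blast

lemma Ck_on_cong:
  assumes "open S" "\<And>y. y \<in> S \<Longrightarrow> f y = g y" "Ck_on k S f"
  shows "Ck_on k S g"
  using assms(2,3)
proof (induction k arbitrary: f g)
  case 0
  then show ?case by (metis Ck_on.simps(1) continuous_on_cong)
next
  case (Suc k)
  have "Ck_on k S (\<lambda>x. frechet_derivative g (at x) v)" for v
  proof (rule Suc.IH)
    show "Ck_on k S (\<lambda>x. frechet_derivative f (at x) v)" using Suc.prems by simp
    show "frechet_derivative f (at x) v = frechet_derivative g (at x) v" if "x \<in> S" for x
      using frechet_derivative_cong[OF \<open>open S\<close> that, of f g] Suc.prems by simp
  qed
  then show ?case
    using Suc.prems differentiable_cong[OF \<open>open S\<close>, of _ f g] by simp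
qed

lemma Ck_on_subset: "Ck_on k S f \<Longrightarrow> T \<subseteq> S \<Longrightarrow> Ck_on k T f"
  by (induction k arbitrary: f) (auto intro: continuous_on_subset)

text \<open>
  The recursion defining \<open>Ck_on\<close> mentions the derivative chosen by \<open>frechet_derivative\<close>; this rule
  admits any explicit formula for it, and drives all closure properties by induction on \<open>k\<close>.
\<close>

lemma Ck_on_SucI:
  assumes "open S" "\<And>x. x \<in> S \<Longrightarrow> (f has_derivative D x) (at x)"
    "\<And>v. Ck_on k S (\<lambda>x. D x v)"
  shows "Ck_on (Suc k) S f"
proof -
  have "Ck_on k S (\<lambda>x. frechet_derivative f (at x) v)" for v
    by (rule Ck_on_cong[OF assms(1) _ assms(3)[of v]])
      (use assms(2) frechet_derivative_at in metis)
  then show ?thesis using assms(2) by (auto simp: differentiable_def)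
qed

lemma Ck_on_SucE:
  assumes "Ck_on (Suc k) S f" "x \<in> S"
  shows "(f has_derivative frechet_derivative f (at x)) (at x)"
  using assms frechet_derivative_works by auto

lemma Ck_on_const: "open S \<Longrightarrow> Ck_on k S (\<lambda>x. c)"
proof (induction k arbitrary: c)
  case (Suc k)
  show ?case by (rule Ck_on_SucI[OF Suc.prems has_derivative_const]) (rule Suc)+
qed simp

lemma Ck_on_linear_image:
  assumes "open S" "bounded_linear L" "Ck_on k S f"
  shows "Ck_on k S (\<lambda>x. L (f x))"
  using assms(3)
proof (induction k arbitrary: f)
  case 0
  then show ?case using bounded_linear.continuous_on[OF assms(2)] by simp
next
  case (Suc k)
  show ?case
    by (rule Ck_on_SucI[OF assms(1)], rule bounded_linear.has_derivative[OF assms(2)],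
        rule Ck_on_SucE[OF Suc.prems], assumption) (use Suc in auto)
qed

lemma Ck_on_add:
  assumes "open S" "Ck_on k S f" "Ck_on k S g"
  shows "Ck_on k S (\<lambda>x. f x + g x)"
  using assms(2,3)
proof (induction k arbitrary: f g)
  case 0
  then show ?case by (auto intro: continuous_intros)
next
  case (Suc k)
  show ?case
    by (rule Ck_on_SucI[OF assms(1)], rule has_derivative_add)
      (use Suc in \<open>auto intro: Ck_on_SucE\<close>)
qed

lemma Ck_on_diff:
  assumes "open S" "Ck_on k S f" "Ck_on k S g"
  shows "Ck_on k S (\<lambda>x. f x - g x)"
  using Ck_on_add[OF assms(1,2) Ck_on_linear_image[OF assms(1) bounded_linear_minus[OF bounded_linear_ident] assms(3)]]
  by simp

lemma Ck_on_bilinear: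
  assumes "open S" "bounded_bilinear h" "Ck_on k S f" "Ck_on k S g"
  shows "Ck_on k S (\<lambda>x. h (f x) (g x))"
  using assms(3,4)
proof (induction k arbitrary: f g)
  case 0
  then show ?case using bounded_bilinear.continuous_on[OF assms(2)] by simp
next
  case (Suc k)
  note lower = Suc.prems[THEN Ck_on_SucD]
  show ?case
  proof (rule Ck_on_SucI[OF assms(1)])
    show "((\<lambda>x. h (f x) (g x)) has_derivative
        (\<lambda>v. h (f x) (frechet_derivative g (at x) v) + h (frechet_derivative f (at x) v) (g x))) (at x)"
      if "x \<in> S" for x
      by (rule bounded_bilinear.FDERIV[OF assms(2)]) (use Suc.prems that in \<open>auto intro: Ck_on_SucE\<close>)
    show "Ck_on k S (\<lambda>x. h (f x) (frechet_derivative g (at x) v)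
        + h (frechet_derivative f (at x) v) (g x))" for v
      using Suc lower by (intro Ck_on_add assms) auto
  qed
qed

lemma Ck_on_sum:
  assumes "open S" "finite A" "\<And>a. a \<in> A \<Longrightarrow> Ck_on k S (f a)"
  shows "Ck_on k S (\<lambda>x. \<Sum>a\<in>A. f a x)"
  using assms(2,3) by (induction A) (auto intro: Ck_on_const Ck_on_add assms(1))

text \<open>
  Expanding the outer derivative in the basis writes the derivative of a composition as a sum of
  products, to which the induction hypothesis in \<open>Ck_on_compose\<close> applies.
\<close>

lemma linear_eq_sum_Basis:
  fixes L :: "'a::euclidean_space \<Rightarrow> 'b::real_normed_vector"
  assumes "linear L"
  shows "L w = (\<Sum>b\<in>Basis. (w \<bullet> b) *\<^sub>R L b)"
proof -
  have "L w = L (\<Sum>b\<in>Basis. (w \<bullet> b) *\<^sub>R b)" by (simp only: euclidean_representation)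
  also have "\<dots> = (\<Sum>b\<in>Basis. (w \<bullet> b) *\<^sub>R L b)"
    by (simp only: linear_sum[OF assms] linear_cmul[OF assms])
  finally show ?thesis .
qed

lemma Ck_on_compose:
  fixes g :: "'a::euclidean_space \<Rightarrow> 'b::euclidean_space"
  assumes "open S" "Ck_on k T f" "Ck_on k S g" "\<And>x. x \<in> S \<Longrightarrow> g x \<in> T"
  shows "Ck_on k S (\<lambda>x. f (g x))"
  using assms(2,3)
proof (induction k arbitrary: f)
  case 0
  then show ?case
    using continuous_on_compose2[of T f S g] assms(4) by auto
next
  case (Suc k)
  show ?case
  proof (rule Ck_on_SucI[OF assms(1)])
    show "((\<lambda>x. f (g x)) has_derivative (\<lambda>v. \<Sum>b\<in>Basis.
       (frechet_derivative g (at x) v \<bullet> b) *\<^sub>R frechet_derivative f (at (g x)) b)) (at x)"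
      if "x \<in> S" for x
    proof -
      have f: "(f has_derivative frechet_derivative f (at (g x))) (at (g x))"
        by (rule Ck_on_SucE[OF Suc.prems(1)]) (use assms(4) that in auto)
      have "((\<lambda>x. f (g x)) has_derivative
        (\<lambda>v. frechet_derivative f (at (g x)) (frechet_derivative g (at x) v))) (at x)"
        by (rule has_derivative_compose[OF Ck_on_SucE[OF Suc.prems(2) that] f])
      moreover have "linear (frechet_derivative f (at (g x)))"
        using f has_derivative_linear by blast
      then have "frechet_derivative f (at (g x)) w =
          (\<Sum>b\<in>Basis. (w \<bullet> b) *\<^sub>R frechet_derivative f (at (g x)) b)" for w
        by (rule linear_eq_sum_Basis)
      then have "(\<lambda>v. frechet_derivative f (at (g x)) (frechet_derivative g (at x) v)) =
        (\<lambda>v. \<Sum>b\<in>Basis. (frechet_derivative g (at x) v \<bullet> b) *\<^sub>R frechet_derivative f (at (g x)) b)"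
        by (intro ext)
      ultimately show ?thesis by (simp only:)
    qed
    show "Ck_on k S (\<lambda>x. \<Sum>b\<in>Basis. (frechet_derivative g (at x) v \<bullet> b) *\<^sub>R
            frechet_derivative f (at (g x)) b)" for v
    proof (intro Ck_on_sum Ck_on_bilinear[OF assms(1) bounded_bilinear_scaleR] assms(1) finite_Basis)
      show "Ck_on k S (\<lambda>x. frechet_derivative g (at x) v \<bullet> b)" for b
        by (rule Ck_on_linear_image[OF assms(1) bounded_linear_inner_left])
          (use Suc.prems in auto)
      show "Ck_on k S (\<lambda>x. frechet_derivative f (at (g x)) b)" for b
        using Suc.IH[of "\<lambda>y. frechet_derivative f (at y) b"] Suc.prems Ck_on_SucD by auto
    qed
  qed
qed

lemma Ck_on_inverse:
  fixes f :: "'a::euclidean_space \<Rightarrow> real"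
  assumes "open S" "Ck_on k S f" "\<And>x. x \<in> S \<Longrightarrow> f x \<noteq> 0"
  shows "Ck_on k S (\<lambda>x. inverse (f x))"
  using assms(2)
proof (induction k)
  case 0
  then show ?case using assms(3) by (auto intro: continuous_intros)
next
  case (Suc k)
  then have IH: "Ck_on k S (\<lambda>x. inverse (f x))" using Ck_on_SucD by blast
  show ?case
  proof (rule Ck_on_SucI[OF assms(1)])
    show "((\<lambda>x. inverse (f x)) has_derivative
      (\<lambda>v. - (inverse (f x) * frechet_derivative f (at x) v * inverse (f x)))) (at x)" if "x \<in> S" for x
      by (rule Deriv.has_derivative_inverse[OF assms(3)[OF that] Ck_on_SucE[OF Suc.prems that]])
    show "Ck_on k S (\<lambda>x. - (inverse (f x) * frechet_derivative f (at x) v * inverse (f x)))" for v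
      by (intro Ck_on_linear_image[OF assms(1) bounded_linear_minus[OF bounded_linear_ident]]
          Ck_on_bilinear[OF assms(1) bounded_bilinear_mult] IH) (use Suc.prems in auto)
  qed
qed

lemma smooth_on_cong:
  "open S \<Longrightarrow> (\<And>y. y \<in> S \<Longrightarrow> f y = g y) \<Longrightarrow> smooth_on S f \<Longrightarrow> smooth_on S g"
  unfolding smooth_on_def using Ck_on_cong by metis

lemma smooth_on_subset: "smooth_on S f \<Longrightarrow> T \<subseteq> S \<Longrightarrow> smooth_on T f"
  unfolding smooth_on_def using Ck_on_subset by blast

lemma smooth_on_const: "open S \<Longrightarrow> smooth_on S (\<lambda>x. c)"
  unfolding smooth_on_def using Ck_on_const by blast

lemma smooth_on_linear_image:
  "open S \<Longrightarrow> bounded_linear L \<Longrightarrow> smooth_on S f \<Longrightarrow> smooth_on S (\<lambda>x. L (f x))"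
  unfolding smooth_on_def using Ck_on_linear_image by blast

lemma smooth_on_add:
  "open S \<Longrightarrow> smooth_on S f \<Longrightarrow> smooth_on S g \<Longrightarrow> smooth_on S (\<lambda>x. f x + g x)"
  unfolding smooth_on_def using Ck_on_add by blast

lemma smooth_on_diff:
  "open S \<Longrightarrow> smooth_on S f \<Longrightarrow> smooth_on S g \<Longrightarrow> smooth_on S (\<lambda>x. f x - g x)"
  unfolding smooth_on_def using Ck_on_diff by blast

lemma smooth_on_bilinear:
  "open S \<Longrightarrow> bounded_bilinear h \<Longrightarrow> smooth_on S f \<Longrightarrow> smooth_on S g \<Longrightarrow> smooth_on S (\<lambda>x. h (f x) (g x))"
  unfolding smooth_on_def using Ck_on_bilinear by blast

lemma smooth_on_mult:
  fixes f g :: "_ \<Rightarrow> real"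
  shows "open S \<Longrightarrow> smooth_on S f \<Longrightarrow> smooth_on S g \<Longrightarrow> smooth_on S (\<lambda>x. f x * g x)"
  using smooth_on_bilinear[OF _ bounded_bilinear_mult] by blast

lemma smooth_on_sum:
  "open S \<Longrightarrow> finite A \<Longrightarrow> (\<And>a. a \<in> A \<Longrightarrow> smooth_on S (f a)) \<Longrightarrow> smooth_on S (\<lambda>x. \<Sum>a\<in>A. f a x)"
  unfolding smooth_on_def using Ck_on_sum[of S A _ f] by blast

lemma smooth_on_compose:
  fixes g :: "'a::euclidean_space \<Rightarrow> 'b::euclidean_space"
  shows "open S \<Longrightarrow> smooth_on T f \<Longrightarrow> smooth_on S g \<Longrightarrow> (\<And>x. x \<in> S \<Longrightarrow> g x \<in> T) \<Longrightarrow>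
    smooth_on S (\<lambda>x. f (g x))"
  unfolding smooth_on_def using Ck_on_compose[of S _ T f g] by blast

lemma Ck_on_linear:
  assumes "open S" "bounded_linear L"
  shows "Ck_on k S L"
proof (cases k)
  case 0
  then show ?thesis using linear_continuous_on[OF assms(2)] by simp
next
  case (Suc n)
  show ?thesis unfolding Suc
    by (rule Ck_on_SucI[OF assms(1) bounded_linear.has_derivative[OF assms(2) has_derivative_ident]])
      (rule Ck_on_const[OF assms(1)])
qed

lemma smooth_on_linear: "open S \<Longrightarrow> bounded_linear L \<Longrightarrow> smooth_on S L"
  unfolding smooth_on_def using Ck_on_linear by blast

lemma smooth_on_frechet_derivative:
  "smooth_on S f \<Longrightarrow> smooth_on S (\<lambda>x. frechet_derivative f (at x) v)"
  unfolding smooth_on_def using Ck_on.simps(2) by blast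

lemma smooth_on_has_derivative:
  "smooth_on S f \<Longrightarrow> x \<in> S \<Longrightarrow> (f has_derivative frechet_derivative f (at x)) (at x)"
  unfolding smooth_on_def using Ck_on_SucE by blast

lemma Ck_on_Pair:
  assumes "open S" "Ck_on k S f" "Ck_on k S g"
  shows "Ck_on k S (\<lambda>x. (f x, g x))"
proof -
  have "Ck_on k S (\<lambda>x. (f x, 0) + (0, g x))"
    by (intro Ck_on_add[OF assms(1)] Ck_on_linear_image[where L = "\<lambda>y. (y, 0)"]
        Ck_on_linear_image[where L = "\<lambda>y. (0, y)"] assms bounded_linear_intros)
  then show ?thesis by simp
qed

lemma smooth_on_Pair:
  "open S \<Longrightarrow> smooth_on S f \<Longrightarrow> smooth_on S g \<Longrightarrow> smooth_on S (\<lambda>x. (f x, g x))"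
  unfolding smooth_on_def using Ck_on_Pair by blast

lemma smooth_on_vec:
  fixes f :: "'a::euclidean_space \<Rightarrow> real^'n"
  assumes "open S" "\<And>i. smooth_on S (\<lambda>x. f x $ i)"
  shows "smooth_on S f"
proof -
  have "smooth_on S (\<lambda>x. \<Sum>i\<in>UNIV. f x $ i *\<^sub>R axis i 1)"
    by (intro smooth_on_sum smooth_on_bilinear[OF assms(1) bounded_bilinear_scaleR]
        smooth_on_const assms) auto
  moreover have "(\<lambda>x. \<Sum>i\<in>UNIV. f x $ i *\<^sub>R axis i 1) = f"
  proof (rule ext)
    show "(\<Sum>i\<in>UNIV. f x $ i *\<^sub>R axis i 1) = f x" for x
      using basis_expansion[of "f x"] by (simp add: scalar_mult_eq_scaleR)
  qed
  ultimately show ?thesis by (rule subst[rotated])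
qed

lemma smooth_on_component:
  "open S \<Longrightarrow> smooth_on S f \<Longrightarrow> smooth_on S (\<lambda>x. f x $ i)"
  using smooth_on_linear_image[OF _ bounded_linear_vec_nth] by blast

lemma smooth_on_line_derivative:
  assumes f: "smooth_on S f" and p: "p + t *\<^sub>R v \<in> S"
  shows "((\<lambda>t. f (p + t *\<^sub>R v)) has_derivative
    (\<lambda>h. h *\<^sub>R frechet_derivative f (at (p + t *\<^sub>R v)) v)) (at t)"
proof -
  note f' = smooth_on_has_derivative[OF f p]
  have "((\<lambda>t. p + t *\<^sub>R v) has_derivative (\<lambda>h. h *\<^sub>R v)) (at t)"
    by (auto intro!: derivative_eq_intros)
  from has_derivative_compose[OF this f'] show ?thesis
    by (simp add: linear_cmul[OF has_derivative_linear[OF f']])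
qed

text \<open>
  Two applications of the mean value theorem, first along \<open>v\<close> and then along \<open>w\<close>, express the
  second difference by a mixed derivative at a nearby point. The left-hand side of the equation is
  symmetric in \<open>v\<close> and \<open>w\<close>, which forces the mixed derivatives to agree in the limit.
\<close>

lemma second_difference:
  fixes f :: "'a::euclidean_space \<Rightarrow> real"
  assumes S: "ball x r \<subseteq> S" and f: "smooth_on S f" and s: "0 < s"
    and small: "s * (norm v + norm w) < r"
  obtains y where "norm (y - x) \<le> s * (norm v + norm w)"
    "f (x + s *\<^sub>R v + s *\<^sub>R w) - f (x + s *\<^sub>R v) - f (x + s *\<^sub>R w) + f x =
     s * s * frechet_derivative (\<lambda>y. frechet_derivative f (at y) v) (at y) w"
proof -
  have bnd: "norm (a *\<^sub>R v + b *\<^sub>R w) \<le> s * (norm v + norm w)" if "0 \<le> a" "a \<le> s" "0 \<le> b" "b \<le> s" for a b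
  proof -
    have "norm (a *\<^sub>R v + b *\<^sub>R w) \<le> a * norm v + b * norm w"
      using norm_triangle_ineq[of "a *\<^sub>R v" "b *\<^sub>R w"] that by simp
    also have "\<dots> \<le> s * norm v + s * norm w" using that by (intro add_mono mult_right_mono) auto
    finally show ?thesis by (simp add: algebra_simps)
  qed
  have inS: "x + a *\<^sub>R v + b *\<^sub>R w \<in> S" if "0 \<le> a" "a \<le> s" "0 \<le> b" "b \<le> s" for a b
  proof -
    have "norm (a *\<^sub>R v + b *\<^sub>R w) < r" using bnd[OF that] small by linarith
    then have "x + (a *\<^sub>R v + b *\<^sub>R w) \<in> ball x r"
      by (metis add_diff_cancel_left' dist_commute dist_norm mem_ball)
    then show ?thesis using S by (metis add.assoc subsetD)
  qed
  have inS': "x + s *\<^sub>R w + t *\<^sub>R v \<in> S" if "0 \<le> t" "t \<le> s" for t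
    using inS[of t s] that s by (simp add: algebra_simps)
  have inS0: "x + t *\<^sub>R v \<in> S" if "0 \<le> t" "t \<le> s" for t
    using inS[of t 0] that s by simp
  \<comment> \<open>The increment of \<open>f\<close> along \<open>w\<close>, followed along the segment in direction \<open>v\<close>.\<close>
  define A where "A t = f (x + s *\<^sub>R w + t *\<^sub>R v) - f (x + t *\<^sub>R v)" for t
  define g where "g = (\<lambda>y. frechet_derivative f (at y) v)"
  have g: "smooth_on S g" unfolding g_def by (rule smooth_on_frechet_derivative[OF f])
  have A: "(A has_derivative (\<lambda>h. h *\<^sub>R g (x + s *\<^sub>R w + t *\<^sub>R v) - h *\<^sub>R g (x + t *\<^sub>R v))) (at t)"
    if "0 \<le> t" "t \<le> s" for t
    unfolding A_def g_def
    by (intro has_derivative_diff smooth_on_line_derivative[OF f] inS' inS0 that)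
  have "continuous_on {0..s} A"
    by (rule has_derivative_continuous_on[OF has_derivative_at_withinI[OF A]]) auto
  from mvt[OF s this A] obtain t where t: "0 < t" "t < s" and At: "A s - A 0 =
      (s - 0) *\<^sub>R g (x + s *\<^sub>R w + t *\<^sub>R v) - (s - 0) *\<^sub>R g (x + t *\<^sub>R v)"
    by auto
  define B where "B u = g (x + t *\<^sub>R v + u *\<^sub>R w)" for u
  have B: "(B has_derivative (\<lambda>h. h *\<^sub>R frechet_derivative g (at (x + t *\<^sub>R v + u *\<^sub>R w)) w)) (at u)"
    if "0 \<le> u" "u \<le> s" for u
    unfolding B_def by (rule smooth_on_line_derivative[OF g]) (use inS t that in auto)
  have "continuous_on {0..s} B"
    by (rule has_derivative_continuous_on[OF has_derivative_at_withinI[OF B]]) auto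
  from mvt[OF s this B] obtain u where u: "0 < u" "u < s" and Bu: "B s - B 0 =
      (s - 0) *\<^sub>R frechet_derivative g (at (x + t *\<^sub>R v + u *\<^sub>R w)) w"
    by auto
  define y where "y = x + t *\<^sub>R v + u *\<^sub>R w"
  have "A s - A 0 = s * (B s - B 0)"
    using At by (simp add: B_def algebra_simps)
  also have "B s - B 0 = s * frechet_derivative g (at y) w"
    using Bu by (simp add: y_def)
  finally have "A s - A 0 = s * s * frechet_derivative g (at y) w" by simp
  moreover have "norm (y - x) \<le> s * (norm v + norm w)" using bnd[of t u] t u by (simp add: y_def)
  ultimately show ?thesis using that[of y] by (simp add: A_def g_def algebra_simps)
qed

lemma second_derivative_symmetric:
  fixes f :: "'a::euclidean_space \<Rightarrow> real"
  assumes "open S" "x \<in> S" and f: "smooth_on S f"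
  shows "frechet_derivative (\<lambda>y. frechet_derivative f (at y) v) (at x) w =
         frechet_derivative (\<lambda>y. frechet_derivative f (at y) w) (at x) v"
proof -
  define D where "D v w = (\<lambda>y. frechet_derivative (\<lambda>y. frechet_derivative f (at y) v) (at y) w)" for v w
  have cont: "isCont (D v w) x" for v w
  proof -
    have "smooth_on S (D v w)" unfolding D_def
      by (intro smooth_on_frechet_derivative[of S "\<lambda>y. frechet_derivative f (at y) v"]
         smooth_on_frechet_derivative f)
    then have "(D v w has_derivative frechet_derivative (D v w) (at x)) (at x)"
      using smooth_on_has_derivative assms(2) by blast
    then show ?thesis using has_derivative_continuous by blast
  qed
  obtain r where r: "0 < r" "ball x r \<subseteq> S" using assms(1,2) open_contains_ball by blast
  have "D v w x = D w v x"
  proof (rule ccontr)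
    define e where "e = \<bar>D v w x - D w v x\<bar> / 2"
    assume "D v w x \<noteq> D w v x"
    then have e: "e > 0" by (simp add: e_def)
    obtain d1 where d1: "d1 > 0" "\<And>y. norm (y - x) < d1 \<Longrightarrow> \<bar>D v w y - D v w x\<bar> < e"
      using cont[of v w, unfolded continuous_at_eps_delta, rule_format, OF e] by (auto simp: dist_norm)
    obtain d2 where d2: "d2 > 0" "\<And>y. norm (y - x) < d2 \<Longrightarrow> \<bar>D w v y - D w v x\<bar> < e"
      using cont[of w v, unfolded continuous_at_eps_delta, rule_format, OF e] by (auto simp: dist_norm)
    define m where "m = min r (min d1 d2)"
    \<comment> \<open>Small enough for all second-difference points to lie in the balls of radii \<open>r\<close>, \<open>d1\<close>, \<open>d2\<close>.\<close>
    define s where "s = m / (2 * (norm v + norm w + 1))"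
    have m: "m > 0" using r d1 d2 by (simp add: m_def)
    have nn: "norm v + norm w + 1 > 0" by (simp add: add_nonneg_pos)
    have s: "s > 0" using m nn by (simp add: s_def)
    have "s * (norm v + norm w) \<le> s * (norm v + norm w + 1)" using s by simp
    also have "\<dots> = m / 2" using nn by (simp add: s_def field_simps)
    also have "\<dots> < m" using m by simp
    finally have sm: "s * (norm v + norm w) < m" .
    obtain y where y: "norm (y - x) \<le> s * (norm v + norm w)"
      "f (x + s *\<^sub>R v + s *\<^sub>R w) - f (x + s *\<^sub>R v) - f (x + s *\<^sub>R w) + f x = s * s * D v w y"
      using second_difference[OF r(2) f s, of v w] sm unfolding D_def m_def by auto
    obtain y' where y': "norm (y' - x) \<le> s * (norm w + norm v)"
      "f (x + s *\<^sub>R w + s *\<^sub>R v) - f (x + s *\<^sub>R w) - f (x + s *\<^sub>R v) + f x = s * s * D w v y'"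
      using second_difference[OF r(2) f s, of w v] sm unfolding D_def m_def by (auto simp: add.commute)
    have "s * s * D v w y = s * s * D w v y'" using y(2) y'(2) by (simp add: algebra_simps)
    then have eq: "D v w y = D w v y'" using s by simp
    have "\<bar>D v w y - D v w x\<bar> < e" using d1(2)[of y] y(1) sm by (simp add: m_def)
    moreover have "\<bar>D w v y' - D w v x\<bar> < e" using d2(2)[of y'] y'(1) sm by (simp add: m_def add.commute)
    ultimately show False using eq unfolding e_def by (simp add: abs_if split: if_splits)
  qed
  then show ?thesis by (simp add: D_def)
qed

section \<open>Power series in three variables\<close>

text \<open>
  Orders of vanishing such as \<open>1\<close> and \<open>m + 1\<close> occur in rules used by unification, and must not be
  rewritten to \<open>Suc 0\<close>.
\<close>

declare One_nat_def [simp del]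

lemma fps3_eqI: "(\<And>i j k. coeff3 F i j k = coeff3 G i j k) \<Longrightarrow> F = G"
  by (simp add: coeff3_def fps_eq_iff)

lemma coeff3_series3 [simp]: "coeff3 (series3 c) i j k = c i j k"
  by (simp add: coeff3_def series3_def)

lemma coeff3_simps [simp]:
  "coeff3 0 i j k = 0"
  "coeff3 (F + G) i j k = coeff3 F i j k + coeff3 G i j k"
  "coeff3 (F - G) i j k = coeff3 F i j k - coeff3 G i j k"
  "coeff3 (- F) i j k = - coeff3 F i j k"
  by (simp_all add: coeff3_def)

lemma coeff3_sum: "coeff3 (\<Sum>a\<in>A. F a) i j k = (\<Sum>a\<in>A. coeff3 (F a) i j k)"
  by (simp add: coeff3_def fps_sum_nth)

lemma coeff3_mult:
  "coeff3 (F * G) a b c =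
     (\<Sum>i\<le>a. \<Sum>j\<le>b. \<Sum>k\<le>c. coeff3 F i j k * coeff3 G (a - i) (b - j) (c - k))"
  by (simp add: coeff3_def fps_mult_nth fps_sum_nth atLeast0AtMost)

definition const3 :: "real \<Rightarrow> fps3" where
  "const3 r = fps_const (fps_const (fps_const r))"

lemma coeff3_const_mult [simp]: "coeff3 (const3 r * F) i j k = r * coeff3 F i j k"
  by (simp add: coeff3_def const3_def)

lemma const3_left_commute: "F * (const3 r * G) = const3 r * (F * G)"
  by (rule mult.left_commute)

lemma fps_nth_of_nat_mult: "fps_nth (of_nat n * f) i = of_nat n * fps_nth f i"
  by (simp flip: fps_of_nat)

lemma coeff3_dx3 [simp]: "coeff3 (dx3 F) i j k = real (Suc i) * coeff3 F (Suc i) j k"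
  by (simp only: coeff3_def dx3_def fps_deriv_nth fps_nth_of_nat_mult Suc_eq_plus1)

lemma coeff3_dy3 [simp]: "coeff3 (dy3 F) i j k = real (Suc j) * coeff3 F i (Suc j) k"
  by (simp only: coeff3_def dy3_def fps_nth_Abs_fps fps_deriv_nth fps_nth_of_nat_mult Suc_eq_plus1)

lemma coeff3_dz3 [simp]: "coeff3 (dz3 F) i j k = real (Suc k) * coeff3 F i j (Suc k)"
  by (simp only: coeff3_def dz3_def fps_nth_Abs_fps fps_deriv_nth fps_nth_of_nat_mult Suc_eq_plus1)

lemma coeff3_lift23 [simp]: "coeff3 (lift23 f) i j k = (if k = 0 then coeff2 f i j else 0)"
  by (simp add: coeff3_def lift23_def)

definition mon3 :: "nat \<Rightarrow> nat \<Rightarrow> nat \<Rightarrow> fps3" where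
  "mon3 i j k = X3 ^ i * Y3 ^ j * Z3 ^ k"

lemma coeff3_mon3: "coeff3 (mon3 i j k) a b c = (if a = i \<and> b = j \<and> c = k then 1 else 0)"
proof -
  have eq: "mon3 i j k = fps_X ^ i * fps_const (fps_X ^ j * fps_const (fps_X ^ k))"
    by (simp add: mon3_def X3_def Y3_def Z3_def fps_const_power mult.assoc)
  show ?thesis
    unfolding eq coeff3_def by (auto simp: fps_X_power_mult_nth)
qed

lemma mon3_mult: "mon3 i j k * mon3 i' j' k' = mon3 (i + i') (j + j') (k + k')"
  by (simp add: mon3_def power_add mult_ac)

lemma X3_mon: "X3 = mon3 1 0 0" and Y3_mon: "Y3 = mon3 0 1 0" and Z3_mon: "Z3 = mon3 0 0 1"
  and one_mon: "1 = mon3 0 0 0"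
  by (simp_all add: mon3_def)

lemma coeff3_Z3_mult: "coeff3 (Z3 * F) i j k = (if k = 0 then 0 else coeff3 F i j (k - 1))"
  by (simp add: Z3_def coeff3_def)

text \<open>
  Membership in the \<open>n\<close>-th step of a monomial filtration in which \<open>x\<close> and \<open>y\<close> have weight one and
  \<open>z\<close> has weight \<open>w\<close>. Two weights matter: \<open>w = 1\<close> gives the order at the origin, for which
  substitution and derivations are continuous; \<open>w = 0\<close> gives the powers of the ideal \<open>(x, y)\<close>, which
  organize the normal form.
\<close>

definition vanishes :: "nat \<Rightarrow> nat \<Rightarrow> fps3 \<Rightarrow> bool" where
  "vanishes w n F \<longleftrightarrow> (\<forall>i j k. i + j + w * k < n \<longrightarrow> coeff3 F i j k = 0)"

lemma vanishesD: "vanishes w n F \<Longrightarrow> i + j + w * k < n \<Longrightarrow> coeff3 F i j k = 0"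
  by (simp add: vanishes_def)

lemma vanishes_mono: "vanishes w n F \<Longrightarrow> m \<le> n \<Longrightarrow> vanishes w m F"
  by (auto simp: vanishes_def)

lemma vanishes_0 [simp]: "vanishes w n 0"
  and vanishes_zero_order [simp]: "vanishes w 0 F"
  by (simp_all add: vanishes_def)

lemma vanishes_add: "vanishes w n F \<Longrightarrow> vanishes w n G \<Longrightarrow> vanishes w n (F + G)"
  and vanishes_diff: "vanishes w n F \<Longrightarrow> vanishes w n G \<Longrightarrow> vanishes w n (F - G)"
  and vanishes_minus: "vanishes w n F \<Longrightarrow> vanishes w n (- F)"
  by (auto simp: vanishes_def)

lemma vanishes_mult:
  assumes "vanishes w m F" "vanishes w n G" shows "vanishes w (m + n) (F * G)"
  unfolding vanishes_def
proof (intro allI impI)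
  fix a b c assume less: "a + b + w * c < m + n"
  have "coeff3 F i j k * coeff3 G (a - i) (b - j) (c - k) = 0"
    if "i \<le> a" "j \<le> b" "k \<le> c" for i j k
  proof (cases "i + j + w * k < m")
    case True
    then show ?thesis using vanishesD[OF assms(1)] by simp
  next
    case False
    have "w * c = w * k + w * (c - k)" using that(3) by (metis add_mult_distrib2 le_add_diff_inverse)
    then have "(a - i) + (b - j) + w * (c - k) < n" using False less that by linarith
    then show ?thesis using vanishesD[OF assms(2)] by simp
  qed
  then show "coeff3 (F * G) a b c = 0" unfolding coeff3_mult by (intro sum.neutral ballI) auto
qed

lemma vanishes_mult_left: "vanishes w n G \<Longrightarrow> vanishes w n (F * G)"
  using vanishes_mult[of w 0 F n G] by simp

lemma vanishes_mult_right: "vanishes w n F \<Longrightarrow> vanishes w n (F * G)"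
  using vanishes_mult[of w n F 0 G] by simp

lemma vanishes_power: "vanishes w n F \<Longrightarrow> vanishes w (i * n) (F ^ i)"
  by (induction i) (auto intro: vanishes_mult)

lemma vanishes_dx3: "vanishes w (Suc n) F \<Longrightarrow> vanishes w n (dx3 F)"
  and vanishes_dy3: "vanishes w (Suc n) F \<Longrightarrow> vanishes w n (dy3 F)"
  and vanishes_dz3: "vanishes w (n + w) F \<Longrightarrow> vanishes w n (dz3 F)"
  unfolding vanishes_def by (auto simp del: of_nat_Suc)

lemma vanishes_all: "(\<And>n. vanishes w n F) \<Longrightarrow> F = 0"
proof (rule fps3_eqI)
  fix i j k assume "\<And>n. vanishes w n F"
  then have "vanishes w (Suc (i + j + w * k)) F" .
  then show "coeff3 F i j k = coeff3 0 i j k" using vanishesD by simp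
qed

lemma vanishes_mon3: "n \<le> i + j + w * k \<Longrightarrow> vanishes w n (mon3 i j k)"
  unfolding vanishes_def by (auto simp: coeff3_mon3)

lemma fps3_truncate:
  fixes F :: fps3
  obtains R where "vanishes 1 n R"
    "F = (\<Sum>(i,j,k)\<in>{..<n}\<times>{..<n}\<times>{..<n}. const3 (coeff3 F i j k) * mon3 i j k) + R"
proof -
  let ?P = "\<Sum>(i,j,k)\<in>{..<n}\<times>{..<n}\<times>{..<n}. const3 (coeff3 F i j k) * mon3 i j k"
  have "coeff3 ?P a b c = coeff3 F a b c" if "a + b + c < n" for a b c
  proof -
    have "coeff3 ?P a b c = (\<Sum>t\<in>{..<n}\<times>{..<n}\<times>{..<n}. if t = (a, b, c) then coeff3 F a b c else 0)"
      unfolding coeff3_sum by (rule sum.cong) (auto simp: coeff3_mon3 split: if_splits)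
    also have "\<dots> = coeff3 F a b c" using that by simp
    finally show ?thesis .
  qed
  then have "vanishes 1 n (F - ?P)" by (simp add: vanishes_def)
  then show ?thesis using that[of "F - ?P"] by simp
qed

text \<open>
  A continuous linear map is determined by its values on monomials, because a series is a polynomial up
  to terms of arbitrarily high order. The shift \<open>d\<close> allows for derivations, which lower the order.
  The algebraic laws of substitution are obtained from this principle.
\<close>

lemma linear_vanishes_on_monomials:
  fixes T :: "fps3 \<Rightarrow> fps3"
  assumes add: "\<And>F G. T (F + G) = T F + T G"
    and scale: "\<And>r F. T (const3 r * F) = const3 r * T F"
    and ord: "\<And>n F. vanishes 1 (n + d) F \<Longrightarrow> vanishes 1 n (T F)"
    and mon: "\<And>i j k. T (mon3 i j k) = 0"
  shows "T F = 0"
proof (rule vanishes_all)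
  fix n
  have T0: "T 0 = 0" using add[of 0 0] by simp
  define P where
    "P = (\<Sum>(i,j,k)\<in>{..<n+d}\<times>{..<n+d}\<times>{..<n+d}. const3 (coeff3 F i j k) * mon3 i j k)"
  obtain R where R: "vanishes 1 (n + d) R" and F: "F = P + R"
    unfolding P_def by (rule fps3_truncate)
  have "T (\<Sum>t\<in>A. G t) = (\<Sum>t\<in>A. T (G t))" if "finite A" for A and G :: "nat \<times> nat \<times> nat \<Rightarrow> fps3"
    using that by (induction A) (auto simp: T0 add)
  then have "T P = 0"
    by (simp add: P_def scale mon split_beta)
  then have "T F = T R" using add[of P R] by (simp add: F)
  then show "vanishes 1 n (T F)" using ord[OF R] by simp
qed

section \<open>Substitution\<close>

definition pow3 :: "fps3^3 \<Rightarrow> nat \<Rightarrow> nat \<Rightarrow> nat \<Rightarrow> fps3" where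
  "pow3 \<Phi> i j k = (\<Phi> $ 1) ^ i * (\<Phi> $ 2) ^ j * (\<Phi> $ 3) ^ k"

lemma no_constant_term_vanishes: "no_constant_term \<Phi> \<longleftrightarrow> (\<forall>m. vanishes 1 1 (\<Phi> $ m))"
  by (auto simp: no_constant_term_def vanishes_def)

lemma vanishes_pow3:
  assumes "no_constant_term \<Phi>" shows "vanishes 1 (i + j + k) (pow3 \<Phi> i j k)"
  using assms vanishes_power[of 1 1] unfolding pow3_def no_constant_term_vanishes
  by (metis vanishes_mult mult.right_neutral)

text \<open>
  Without constant terms, monomials of degree above \<open>a + b + c\<close> do not contribute; any larger box
  of exponents gives the same sum, so that a common bound can be used for several coefficients.
\<close>

lemma coeff3_fsubst:
  assumes "no_constant_term \<Phi>" "a + b + c \<le> N"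
  shows "coeff3 (fsubst F \<Phi>) a b c =
    (\<Sum>i\<le>N. \<Sum>j\<le>N. \<Sum>k\<le>N. coeff3 F i j k * coeff3 (pow3 \<Phi> i j k) a b c)"
proof -
  let ?n = "a + b + c"
  define t where "t i j k = coeff3 F i j k * coeff3 (pow3 \<Phi> i j k) a b c" for i j k
  have z: "t i j k = 0" if "?n < i + j + k" for i j k
    using vanishesD[OF vanishes_pow3[OF assms(1), of i j k], of a b c] that by (simp add: t_def)
  have k: "(\<Sum>k\<le>N. t i j k) = (\<Sum>k\<le>?n. t i j k)" for i j
    using assms(2) by (intro sum.mono_neutral_right) (auto intro: z)
  have j: "(\<Sum>j\<le>N. \<Sum>k\<le>N. t i j k) = (\<Sum>j\<le>?n. \<Sum>k\<le>?n. t i j k)" for i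
    unfolding k using assms(2) by (intro sum.mono_neutral_right) (auto intro!: z sum.neutral)
  have "(\<Sum>i\<le>N. \<Sum>j\<le>N. \<Sum>k\<le>N. t i j k) = (\<Sum>i\<le>?n. \<Sum>j\<le>?n. \<Sum>k\<le>?n. t i j k)"
    unfolding j using assms(2) by (intro sum.mono_neutral_right) (auto intro!: z sum.neutral)
  then show ?thesis by (simp add: fsubst_def t_def pow3_def)
qed

lemma fsubst_add: "fsubst (F + G) \<Phi> = fsubst F \<Phi> + fsubst G \<Phi>"
  by (rule fps3_eqI) (simp add: fsubst_def distrib_right sum.distrib)

lemma fsubst_scale: "fsubst (const3 r * F) \<Phi> = const3 r * fsubst F \<Phi>"
  by (rule fps3_eqI) (simp add: fsubst_def mult.assoc sum_distrib_left)

lemma fsubst_0: "fsubst 0 \<Phi> = 0"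
  by (rule fps3_eqI) (simp add: fsubst_def)

lemma fsubst_minus: "fsubst (- F) \<Phi> = - fsubst F \<Phi>"
  using fsubst_add[of F "-F" \<Phi>] by (simp add: fsubst_0 add_eq_0_iff)

lemma fsubst_diff: "fsubst (F - G) \<Phi> = fsubst F \<Phi> - fsubst G \<Phi>"
  using fsubst_add[of F "-G" \<Phi>] by (simp add: fsubst_minus)

lemma fsubst_mon3:
  assumes "no_constant_term \<Phi>" shows "fsubst (mon3 i j k) \<Phi> = pow3 \<Phi> i j k"
proof (rule fps3_eqI)
  fix a b c
  \<comment> \<open>A box containing both the exponents of the monomial and those required for the coefficient.\<close>
  define N where "N = a + b + c + i + j + k"
  have "coeff3 (fsubst (mon3 i j k) \<Phi>) a b c =
    (\<Sum>i'\<le>N. \<Sum>j'\<le>N. \<Sum>k'\<le>N. coeff3 (mon3 i j k) i' j' k' * coeff3 (pow3 \<Phi> i' j' k') a b c)"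
    by (rule coeff3_fsubst[OF assms]) (simp add: N_def)
  also have "\<dots> = (\<Sum>i'\<le>N. \<Sum>j'\<le>N. \<Sum>k'\<le>N. if k' = k then if j' = j then
       if i' = i then coeff3 (pow3 \<Phi> i j k) a b c else 0 else 0 else 0)"
    by (intro sum.cong refl) (auto simp: coeff3_mon3)
  also have "\<dots> = coeff3 (pow3 \<Phi> i j k) a b c" by (simp add: N_def)
  finally show "coeff3 (fsubst (mon3 i j k) \<Phi>) a b c = coeff3 (pow3 \<Phi> i j k) a b c" .
qed

lemma fsubst_vars:
  assumes "no_constant_term \<Phi>"
  shows "fsubst X3 \<Phi> = \<Phi> $ 1" "fsubst Y3 \<Phi> = \<Phi> $ 2" "fsubst Z3 \<Phi> = \<Phi> $ 3" "fsubst 1 \<Phi> = 1"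
  unfolding X3_mon Y3_mon Z3_mon one_mon fsubst_mon3[OF assms] 
  by (simp_all add: pow3_def mon3_def)

lemma vanishes_fsubst:
  assumes "no_constant_term \<Phi>" "vanishes 1 n F" shows "vanishes 1 n (fsubst F \<Phi>)"
  unfolding vanishes_def
proof (intro allI impI)
  fix a b c assume less: "a + b + 1 * c < n"
  have "coeff3 F i j k * coeff3 (pow3 \<Phi> i j k) a b c = 0" for i j k
  proof (cases "i + j + k < n")
    case True
    then show ?thesis using vanishesD[OF assms(2), of i j k] by simp
  next
    case False
    then show ?thesis using vanishesD[OF vanishes_pow3[OF assms(1), of i j k], of a b c] less by simp
  qed
  then show "coeff3 (fsubst F \<Phi>) a b c = 0"
    unfolding coeff3_fsubst[OF assms(1) order_refl] by (intro sum.neutral ballI) auto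
qed

text \<open>
  By linearity in each factor and continuity, the law only has to be checked on pairs of monomials.
\<close>

lemma fsubst_mult:
  assumes "no_constant_term \<Phi>"
  shows "fsubst (F * G) \<Phi> = fsubst F \<Phi> * fsubst G \<Phi>"
proof -
  have mon: "fsubst (F * mon3 i j k) \<Phi> - fsubst F \<Phi> * fsubst (mon3 i j k) \<Phi> = 0" for F i j k
  proof (rule linear_vanishes_on_monomials[where F = F and d = 0])
    fix n F assume "vanishes 1 (n + 0) F"
    then have "vanishes 1 n F" by simp
    then show "vanishes 1 n (fsubst (F * mon3 i j k) \<Phi> - fsubst F \<Phi> * fsubst (mon3 i j k) \<Phi>)"
      by (intro vanishes_diff vanishes_fsubst[OF assms] vanishes_mult_right) 
  next
    show "fsubst (mon3 i' j' k' * mon3 i j k) \<Phi> - fsubst (mon3 i' j' k') \<Phi> * fsubst (mon3 i j k) \<Phi> = 0"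
      for i' j' k'
      by (simp add: mon3_mult fsubst_mon3[OF assms] pow3_def power_add mult_ac)
    show "fsubst (const3 r * F * mon3 i j k) \<Phi> - fsubst (const3 r * F) \<Phi> * fsubst (mon3 i j k) \<Phi> =
      const3 r * (fsubst (F * mon3 i j k) \<Phi> - fsubst F \<Phi> * fsubst (mon3 i j k) \<Phi>)" for r F
      by (simp only: mult.assoc fsubst_scale right_diff_distrib)
  qed (simp add: fsubst_add distrib_right)
  have "fsubst (F * G) \<Phi> - fsubst F \<Phi> * fsubst G \<Phi> = 0"
  proof (rule linear_vanishes_on_monomials[where F = G and d = 0])
    fix n G assume "vanishes 1 (n + 0) G"
    then have "vanishes 1 n G" by simp
    then show "vanishes 1 n (fsubst (F * G) \<Phi> - fsubst F \<Phi> * fsubst G \<Phi>)"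
      by (intro vanishes_diff vanishes_fsubst[OF assms] vanishes_mult_left) 
  next
    show "fsubst (F * (const3 r * G)) \<Phi> - fsubst F \<Phi> * fsubst (const3 r * G) \<Phi> =
      const3 r * (fsubst (F * G) \<Phi> - fsubst F \<Phi> * fsubst G \<Phi>)" for r G
      by (simp only: const3_left_commute fsubst_scale right_diff_distrib)
  qed (simp_all add: mon fsubst_add distrib_left)
  then show ?thesis by simp
qed

lemma fsubst_power:
  assumes "no_constant_term \<Phi>"
  shows "fsubst (F ^ n) \<Phi> = fsubst F \<Phi> ^ n"
  by (induction n) (simp_all add: fsubst_vars[OF assms] fsubst_mult[OF assms])

lemma no_constant_term_fcompose:
  "no_constant_term \<Phi> \<Longrightarrow> no_constant_term \<Psi> \<Longrightarrow> no_constant_term (fcompose \<Phi> \<Psi>)"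
  by (simp add: no_constant_term_vanishes fcompose_def vanishes_fsubst)

lemma fsubst_fsubst:
  assumes "no_constant_term \<Phi>" "no_constant_term \<Psi>"
  shows "fsubst (fsubst F \<Phi>) \<Psi> = fsubst F (fcompose \<Phi> \<Psi>)"
proof -
  note comp = no_constant_term_fcompose[OF assms]
  have "fsubst (fsubst F \<Phi>) \<Psi> - fsubst F (fcompose \<Phi> \<Psi>) = 0"
  proof (rule linear_vanishes_on_monomials[where F = F and d = 0])
    show "fsubst (fsubst (mon3 i j k) \<Phi>) \<Psi> - fsubst (mon3 i j k) (fcompose \<Phi> \<Psi>) = 0" for i j k
      unfolding fsubst_mon3[OF assms(1)] fsubst_mon3[OF comp]
      by (simp add: pow3_def fsubst_mult[OF assms(2)] fsubst_power[OF assms(2)] fcompose_def)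
  qed (auto simp: fsubst_add fsubst_scale right_diff_distrib
      intro!: vanishes_diff vanishes_fsubst assms comp)
  then show ?thesis by simp
qed

lemma fsubst_id: "fsubst F (vector [X3, Y3, Z3]) = F"
proof -
  have n: "no_constant_term (vector [X3, Y3, Z3])"
    by (simp add: no_constant_term_def forall_3 X3_mon Y3_mon Z3_mon coeff3_mon3)
  have "fsubst F (vector [X3, Y3, Z3]) - F = 0"
  proof (rule linear_vanishes_on_monomials[where F = F and d = 0])
    show "fsubst (mon3 i j k) (vector [X3, Y3, Z3]) - mon3 i j k = 0" for i j k
      unfolding fsubst_mon3[OF n] by (simp add: pow3_def mon3_def)
  qed (auto simp: fsubst_add fsubst_scale right_diff_distrib intro!: vanishes_diff vanishes_fsubst n)
  then show ?thesis by simp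
qed

section \<open>Derivations\<close>

text \<open>
  Linear derivations lowering the order by at most one, i.e. continuous vector fields; these are the
  maps for which the chain rule holds.
\<close>

definition derivation3 :: "(fps3 \<Rightarrow> fps3) \<Rightarrow> bool" where
  "derivation3 D \<longleftrightarrow> (\<forall>F G. D (F + G) = D F + D G) \<and> (\<forall>F G. D (F * G) = D F * G + F * D G) \<and>
     (\<forall>r F. D (const3 r * F) = const3 r * D F) \<and>
     (\<forall>n F. vanishes 1 (Suc n) F \<longrightarrow> vanishes 1 n (D F))"

lemma fps_mult_map_deriv:
  fixes F G :: "'a::comm_ring_1 fps fps"
  shows "Abs_fps (\<lambda>i. fps_deriv (fps_nth (F * G) i)) =
    Abs_fps (\<lambda>i. fps_deriv (fps_nth F i)) * G + F * Abs_fps (\<lambda>i. fps_deriv (fps_nth G i))"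
  by (rule fps_ext) (simp add: fps_mult_nth fps_deriv_sum sum.distrib)

lemma derivation3_dx3: "derivation3 dx3"
  unfolding derivation3_def
  by (intro conjI allI impI vanishes_dx3)
     (simp add: dx3_def, simp add: dx3_def, rule fps3_eqI, simp, assumption)

lemma derivation3_dy3: "derivation3 dy3"
  unfolding derivation3_def
  by (intro conjI allI impI vanishes_dy3)
     (rule fps3_eqI, simp add: algebra_simps, simp only: dy3_def fps_mult_map_deriv, rule fps3_eqI, simp, assumption)

lemma derivation3_dz3: "derivation3 dz3"
proof -
  have mult: "dz3 (F * G) = dz3 F * G + F * dz3 G" for F G
  proof (rule fps_ext)
    define d :: "real fps fps \<Rightarrow> real fps fps" where "d f = Abs_fps (\<lambda>i. fps_deriv (fps_nth f i))" for f
    have d: "d (f * g) = d f * g + f * d g" for f g unfolding d_def by (rule fps_mult_map_deriv)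
    have a: "d (f + g) = d f + d g" for f g unfolding d_def by (simp add: fps_eq_iff distrib_left)
    have d0: "d 0 = 0" by (simp add: d_def fps_eq_iff)
    have s: "d (\<Sum>i\<in>A. f i) = (\<Sum>i\<in>A. d (f i))" if "finite A" for f and A :: "nat set"
      using that by (induction A) (auto simp: a d0)
    fix n
    have dz: "fps_nth (dz3 F) i = d (fps_nth F i)" for F i by (simp add: dz3_def d_def)
    show "fps_nth (dz3 (F * G)) n = fps_nth (dz3 F * G + F * dz3 G) n"
      by (simp add: dz fps_mult_nth s d sum.distrib)
  qed
  show ?thesis
    unfolding derivation3_def
    by (intro conjI allI impI vanishes_dz3 mult)
      (rule fps3_eqI, simp add: algebra_simps, rule fps3_eqI, simp, simp add: Suc_eq_plus1)
qed

lemma derivation3_add: "derivation3 D \<Longrightarrow> derivation3 D' \<Longrightarrow> derivation3 (\<lambda>F. D F + D' F)"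
  unfolding derivation3_def by (auto simp: algebra_simps intro: vanishes_add)

lemma derivation3D:
  assumes "derivation3 D"
  shows "D (F + G) = D F + D G" "D (F * G) = D F * G + F * D G" "D (const3 r * F) = const3 r * D F"
    "vanishes 1 (Suc n) F \<Longrightarrow> vanishes 1 n (D F)" "D 0 = 0" "D 1 = 0" "D (- F) = - D F"
    "D (F - G) = D F - D G"
proof -
  show add: "D (F + G) = D F + D G" for F G using assms by (simp add: derivation3_def)
  show mult: "D (F * G) = D F * G + F * D G" for F G using assms by (simp add: derivation3_def)
  show "D (const3 r * F) = const3 r * D F" using assms unfolding derivation3_def by blast
  show "vanishes 1 (Suc n) F \<Longrightarrow> vanishes 1 n (D F)" using assms by (simp add: derivation3_def)
  show 0: "D 0 = 0" using add[of 0 0] by simp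
  show "D 1 = 0" using mult[of 1 1] by simp
  show m: "D (- F) = - D F" for F using add[of F "- F"] 0 by (simp add: add_eq_0_iff)
  show "D (F - G) = D F - D G" using add[of F "- G"] m by simp
qed

lemma derivation3_scale:
  assumes "derivation3 D" shows "derivation3 (\<lambda>F. A * D F)"
  unfolding derivation3_def
proof (intro conjI allI impI vanishes_mult_left)
  show "A * D (F + G) = A * D F + A * D G" for F G by (simp add: derivation3D[OF assms] algebra_simps)
  show "A * D (F * G) = A * D F * G + F * (A * D G)" for F G
    by (simp add: derivation3D[OF assms] algebra_simps)
  show "A * D (const3 r * F) = const3 r * (A * D F)" for r F
    by (simp only: derivation3D(3)[OF assms] const3_left_commute)
qed (rule derivation3D(4)[OF assms])

lemmas dx3_simps = derivation3D[OF derivation3_dx3]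
lemmas dy3_simps = derivation3D[OF derivation3_dy3]
lemmas dz3_simps = derivation3D[OF derivation3_dz3]

lemma d3_vars [simp]:
  "dx3 X3 = 1" "dy3 X3 = 0" "dz3 X3 = 0"
  "dx3 Y3 = 0" "dy3 Y3 = 1" "dz3 Y3 = 0"
  "dx3 Z3 = 0" "dy3 Z3 = 0" "dz3 Z3 = 1"
  by (rule fps3_eqI, auto simp: X3_mon Y3_mon Z3_mon one_mon coeff3_mon3)+

lemma d3_commute:
  "dy3 (dx3 F) = dx3 (dy3 F)" "dz3 (dx3 F) = dx3 (dz3 F)" "dz3 (dy3 F) = dy3 (dz3 F)"
  by (rule fps3_eqI, simp)+

text \<open>
  The chain rule. Both sides are derivations in \<open>F\<close> along the substitution, so it passes from the
  coordinates to products and thus to monomials, and then to all series by continuity.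
\<close>

lemma derivation3_fsubst:
  assumes D: "derivation3 D" and n: "no_constant_term \<Phi>"
  shows "D (fsubst F \<Phi>) = fsubst (dx3 F) \<Phi> * D (\<Phi> $ 1) + fsubst (dy3 F) \<Phi> * D (\<Phi> $ 2)
     + fsubst (dz3 F) \<Phi> * D (\<Phi> $ 3)"
proof -
  define chain where "chain F \<longleftrightarrow> D (fsubst F \<Phi>) = fsubst (dx3 F) \<Phi> * D (\<Phi> $ 1)
     + fsubst (dy3 F) \<Phi> * D (\<Phi> $ 2) + fsubst (dz3 F) \<Phi> * D (\<Phi> $ 3)" for F
  note simps = fsubst_add fsubst_scale fsubst_mult[OF n] fsubst_vars[OF n] fsubst_0
    dx3_simps dy3_simps dz3_simps derivation3D[OF D]
  have vars: "chain X3" "chain Y3" "chain Z3" "chain 1" by (simp_all add: chain_def simps)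
  have mult: "chain (F * G)" if "chain F" "chain G" for F G
    using that unfolding chain_def by (simp add: simps algebra_simps)
  have power: "chain (F ^ i)" if "chain F" for F i
    by (induction i) (simp_all add: vars mult that)
  have mon: "chain (mon3 i j k)" for i j k unfolding mon3_def by (intro mult power vars)
  have "D (fsubst F \<Phi>) - (fsubst (dx3 F) \<Phi> * D (\<Phi> $ 1) + fsubst (dy3 F) \<Phi> * D (\<Phi> $ 2)
     + fsubst (dz3 F) \<Phi> * D (\<Phi> $ 3)) = 0"
  proof (rule linear_vanishes_on_monomials[where F = F and d = 1])
    fix m F assume "vanishes 1 (m + 1) F"
    then have F: "vanishes 1 (Suc m) F" by (simp add: Suc_eq_plus1)
    then show "vanishes 1 m (D (fsubst F \<Phi>) - (fsubst (dx3 F) \<Phi> * D (\<Phi> $ 1)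
       + fsubst (dy3 F) \<Phi> * D (\<Phi> $ 2) + fsubst (dz3 F) \<Phi> * D (\<Phi> $ 3)))"
      by (intro vanishes_diff vanishes_add vanishes_mult_right derivation3D(4)[OF D]
          vanishes_fsubst[OF n] vanishes_dx3 vanishes_dy3 vanishes_dz3) (auto simp: Suc_eq_plus1)
  next
    fix r F
    show "D (fsubst (const3 r * F) \<Phi>) - (fsubst (dx3 (const3 r * F)) \<Phi> * D (\<Phi> $ 1)
       + fsubst (dy3 (const3 r * F)) \<Phi> * D (\<Phi> $ 2) + fsubst (dz3 (const3 r * F)) \<Phi> * D (\<Phi> $ 3)) =
      const3 r * (D (fsubst F \<Phi>) - (fsubst (dx3 F) \<Phi> * D (\<Phi> $ 1)
       + fsubst (dy3 F) \<Phi> * D (\<Phi> $ 2) + fsubst (dz3 F) \<Phi> * D (\<Phi> $ 3)))"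
      by (simp only: fsubst_scale derivation3D(3)[OF D] dx3_simps(3) dy3_simps(3) dz3_simps(3))
        (simp only: algebra_simps)
    show "D (fsubst (mon3 i j k) \<Phi>) - (fsubst (dx3 (mon3 i j k)) \<Phi> * D (\<Phi> $ 1)
       + fsubst (dy3 (mon3 i j k)) \<Phi> * D (\<Phi> $ 2) + fsubst (dz3 (mon3 i j k)) \<Phi> * D (\<Phi> $ 3)) = 0" for i j k
      using mon[of i j k] by (simp add: chain_def)
  qed (simp add: fsubst_add derivation3D(1)[OF D] dx3_simps(1) dy3_simps(1) dz3_simps(1) algebra_simps)
  then show ?thesis by simp
qed

section \<open>The formal Poisson bracket\<close>

lemma formal_bracket_eq_bracket3:
  "formal_bracket B F G = bracket3 (B $ 1) (B $ 2) (B $ 3) (dx3 F) (dy3 F) (dz3 F) (dx3 G) (dy3 G) (dz3 G)"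
  by (simp add: formal_bracket_def bracket3_def)

lemma derivation3_formal_bracket_eq:
  assumes D: "derivation3 D"
    and comm: "\<And>F. D (dx3 F) = dx3 (D F)" "\<And>F. D (dy3 F) = dy3 (D F)" "\<And>F. D (dz3 F) = dz3 (D F)"
  shows "D (formal_bracket B F G) = bracket3_deriv (B $ 1) (B $ 2) (B $ 3) (D (B $ 1)) (D (B $ 2)) (D (B $ 3))
     (dx3 F) (dy3 F) (dz3 F) (dx3 (D F)) (dy3 (D F)) (dz3 (D F))
     (dx3 G) (dy3 G) (dz3 G) (dx3 (D G)) (dy3 (D G)) (dz3 (D G))"
  by (simp add: formal_bracket_def bracket3_deriv_def bracket3_def derivation3D[OF D] comm algebra_simps)

text \<open>
  The formal counterpart of \<open>W \<bullet> curl W = 0\<close>.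
\<close>

definition formal_jacobi :: "fps3^3 \<Rightarrow> bool" where
  "formal_jacobi B \<longleftrightarrow> B $ 1 * (dx3 (B $ 3) - dy3 (B $ 2)) + B $ 2 * (dy3 (B $ 1) - dz3 (B $ 3))
     + B $ 3 * (dz3 (B $ 2) - dx3 (B $ 1)) = 0"

lemma formal_jacobi_identity:
  assumes "formal_jacobi B"
  shows "formal_bracket B F (formal_bracket B G H) + formal_bracket B G (formal_bracket B H F)
     + formal_bracket B H (formal_bracket B F G) = 0"
proof -
  have x: "dx3 (formal_bracket B F G) =
     bracket3_deriv (B $ 1) (B $ 2) (B $ 3) (dx3 (B $ 1)) (dx3 (B $ 2)) (dx3 (B $ 3))
     (dx3 F) (dy3 F) (dz3 F) (dx3 (dx3 F)) (dx3 (dy3 F)) (dx3 (dz3 F))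
     (dx3 G) (dy3 G) (dz3 G) (dx3 (dx3 G)) (dx3 (dy3 G)) (dx3 (dz3 G))" for F G
    by (subst derivation3_formal_bracket_eq[OF derivation3_dx3]) (simp_all add: d3_commute)
  have y: "dy3 (formal_bracket B F G) =
     bracket3_deriv (B $ 1) (B $ 2) (B $ 3) (dy3 (B $ 1)) (dy3 (B $ 2)) (dy3 (B $ 3))
     (dx3 F) (dy3 F) (dz3 F) (dx3 (dy3 F)) (dy3 (dy3 F)) (dy3 (dz3 F))
     (dx3 G) (dy3 G) (dz3 G) (dx3 (dy3 G)) (dy3 (dy3 G)) (dy3 (dz3 G))" for F G
    by (subst derivation3_formal_bracket_eq[OF derivation3_dy3]) (simp_all add: d3_commute)
  have z: "dz3 (formal_bracket B F G) =
     bracket3_deriv (B $ 1) (B $ 2) (B $ 3) (dz3 (B $ 1)) (dz3 (B $ 2)) (dz3 (B $ 3))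
     (dx3 F) (dy3 F) (dz3 F) (dx3 (dz3 F)) (dy3 (dz3 F)) (dz3 (dz3 F))
     (dx3 G) (dy3 G) (dz3 G) (dx3 (dz3 G)) (dy3 (dz3 G)) (dz3 (dz3 G))" for F G
    by (subst derivation3_formal_bracket_eq[OF derivation3_dz3]) (simp_all add: d3_commute)
  have J: "- (B $ 1 * (dx3 (B $ 3) - dy3 (B $ 2)) + B $ 2 * (dy3 (B $ 1) - dz3 (B $ 3))
     + B $ 3 * (dz3 (B $ 2) - dx3 (B $ 1))) = 0"
    using assms by (simp add: formal_jacobi_def)
  show ?thesis
    unfolding formal_bracket_eq_bracket3[of B F "formal_bracket B G H"]
      formal_bracket_eq_bracket3[of B G "formal_bracket B H F"]
      formal_bracket_eq_bracket3[of B H "formal_bracket B F G"] x y z jacobiator_eq J by simp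
qed

lemma derivation3_formal_bracket: "derivation3 (formal_bracket B F)"
proof -
  have eq: "formal_bracket B F = (\<lambda>G. (B $ 3 * dz3 F - B $ 1 * dy3 F) * dx3 G +
     ((B $ 1 * dx3 F - B $ 2 * dz3 F) * dy3 G + (B $ 2 * dy3 F - B $ 3 * dx3 F) * dz3 G))"
    by (rule ext) (simp add: formal_bracket_def algebra_simps)
  show ?thesis unfolding eq
    by (intro derivation3_add derivation3_scale derivation3_dx3 derivation3_dy3 derivation3_dz3)
qed

lemmas formal_bracket_simps = derivation3D[OF derivation3_formal_bracket]

lemma formal_bracket_swap: "formal_bracket B G F = - formal_bracket B F G"
  by (simp add: formal_bracket_def algebra_simps)

lemma formal_bracket_self [simp]: "formal_bracket B F F = 0"
  by (simp add: formal_bracket_def algebra_simps)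

section \<open>Coordinate changes close to the identity\<close>

lemma vanishes_cong_mult:
  assumes "vanishes w n (a' - a)" "vanishes w n (b' - b)" shows "vanishes w n (a' * b' - a * b)"
proof -
  have "a' * b' - a * b = a' * (b' - b) + (a' - a) * b" by (simp add: algebra_simps)
  then show ?thesis using assms by (simp add: vanishes_add vanishes_mult_left vanishes_mult_right)
qed

lemma vanishes_cong_power:
  "vanishes w n (a' - a) \<Longrightarrow> vanishes w n (a' ^ i - a ^ i)"
  by (induction i) (auto intro: vanishes_cong_mult)

lemma vanishes_vars: "vanishes 0 1 X3" "vanishes 0 1 Y3"
  unfolding X3_mon Y3_mon by (intro vanishes_mon3, simp)+

lemma vanishes_fsubst_cong:
  assumes "no_constant_term \<Phi>" "no_constant_term \<Phi>'" "\<And>m. vanishes 0 n (\<Phi>' $ m - \<Phi> $ m)"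
  shows "vanishes 0 n (fsubst F \<Phi>' - fsubst F \<Phi>)"
  unfolding vanishes_def
proof (intro allI impI)
  fix a b c assume "a + b + 0 * c < n"
  then have pow: "coeff3 (pow3 \<Phi>' i j k) a b c = coeff3 (pow3 \<Phi> i j k) a b c" for i j k
    using vanishesD[of 0 n "pow3 \<Phi>' i j k - pow3 \<Phi> i j k" a b c] assms(3)
    by (simp add: pow3_def vanishes_cong_mult vanishes_cong_power)
  show "coeff3 (fsubst F \<Phi>' - fsubst F \<Phi>) a b c = 0"
    by (simp add: coeff3_fsubst[OF assms(1) order_refl] coeff3_fsubst[OF assms(2) order_refl] pow)
qed

text \<open>
  The asymmetric orders are those that arise when \<open>y\<close> is kept, \<open>X = x + O((x,y)\<^sup>2)\<close> and
  \<open>Z = {X,y} = z + O((x,y))\<close>. They suffice for substitution to act as the identity on the graded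
  ring of the \<open>(x,y)\<close>-adic filtration (\<open>near_identity_fsubst\<close>), although the linear part need not
  be the identity.
\<close>

definition near_identity :: "fps3^3 \<Rightarrow> bool" where
  "near_identity \<Phi> \<longleftrightarrow> vanishes 0 2 (\<Phi> $ 1 - X3) \<and> \<Phi> $ 2 = Y3 \<and> vanishes 0 1 (\<Phi> $ 3 - Z3)"

lemma near_identity_no_constant_term:
  assumes "near_identity \<Phi>" shows "no_constant_term \<Phi>"
proof -
  have "coeff3 (\<Phi> $ 1 - X3) 0 0 0 = 0" "coeff3 (\<Phi> $ 3 - Z3) 0 0 0 = 0"
    using assms vanishesD[of 0 2 "\<Phi> $ 1 - X3" 0 0 0] vanishesD[of 0 1 "\<Phi> $ 3 - Z3" 0 0 0]
    by (simp_all add: near_identity_def)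
  then show ?thesis
    using assms by (simp add: no_constant_term_def forall_3 near_identity_def X3_mon Y3_mon Z3_mon coeff3_mon3)
qed

lemma near_identity_pow3:
  assumes "near_identity \<Phi>" shows "vanishes 0 (i + j + 1) (pow3 \<Phi> i j k - mon3 i j k)"
proof -
  have \<Phi>: "vanishes 0 2 (\<Phi> $ 1 - X3)" "\<Phi> $ 2 = Y3" "vanishes 0 1 (\<Phi> $ 3 - Z3)"
    using assms by (auto simp: near_identity_def)
  have "vanishes 0 1 (\<Phi> $ 1)"
    using vanishes_add[OF vanishes_mono[OF \<Phi>(1), of 1] vanishes_vars(1)] by simp
  note X = vanishes_power[OF this]
  have Xd: "vanishes 0 (Suc i) ((\<Phi> $ 1) ^ i - X3 ^ i)" for i
  proof (induction i)
    case (Suc i)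
    have "(\<Phi> $ 1) ^ Suc i - X3 ^ Suc i = (\<Phi> $ 1) ^ i * (\<Phi> $ 1 - X3) + ((\<Phi> $ 1) ^ i - X3 ^ i) * X3"
      by (simp add: algebra_simps)
    moreover have "vanishes 0 (Suc (Suc i)) ((\<Phi> $ 1) ^ i * (\<Phi> $ 1 - X3))"
      using vanishes_mult[OF X[of i] \<Phi>(1)] by simp
    moreover have "vanishes 0 (Suc (Suc i)) (((\<Phi> $ 1) ^ i - X3 ^ i) * X3)"
      using vanishes_mult[OF Suc vanishes_vars(1)] by (simp add: One_nat_def)
    ultimately show ?case by (simp add: vanishes_add)
  qed simp
  have Y: "vanishes 0 j (Y3 ^ j)" using vanishes_power[OF vanishes_vars(2), of j] by simp
  have Xi: "vanishes 0 i (X3 ^ i)" using vanishes_power[OF vanishes_vars(1), of i] by simp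
  have "pow3 \<Phi> i j k - mon3 i j k =
     ((\<Phi> $ 1) ^ i - X3 ^ i) * Y3 ^ j * (\<Phi> $ 3) ^ k + X3 ^ i * Y3 ^ j * ((\<Phi> $ 3) ^ k - Z3 ^ k)"
    by (simp add: pow3_def mon3_def \<Phi> algebra_simps)
  moreover have "vanishes 0 (i + j + 1) (((\<Phi> $ 1) ^ i - X3 ^ i) * Y3 ^ j)"
    using vanishes_mult[OF Xd[of i] Y] by (simp only: Suc_eq_plus1 add.commute add.left_commute)
  then have "vanishes 0 (i + j + 1) (((\<Phi> $ 1) ^ i - X3 ^ i) * Y3 ^ j * (\<Phi> $ 3) ^ k)"
    by (rule vanishes_mult_right)
  moreover have "vanishes 0 (i + j + 1) (X3 ^ i * Y3 ^ j * ((\<Phi> $ 3) ^ k - Z3 ^ k))"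
    by (intro vanishes_mult Xi Y vanishes_cong_power \<Phi>)
  ultimately show ?thesis by (simp add: vanishes_add)
qed

lemma near_identity_fsubst:
  assumes \<Phi>: "near_identity \<Phi>" and F: "vanishes 0 n F"
  shows "vanishes 0 (Suc n) (fsubst F \<Phi> - F)"
  unfolding vanishes_def
proof (intro allI impI)
  fix a b c assume less: "a + b + 0 * c < Suc n"
  define N where "N = a + b + c"
  note no = near_identity_no_constant_term[OF \<Phi>]
  have id: "near_identity (vector [X3, Y3, Z3])" by (simp add: near_identity_def)
  \<comment> \<open>Either the coefficient of \<open>F\<close> is zero, or the two monomials agree up to order \<open>n\<close>.\<close>
  have pow: "coeff3 F i j k * coeff3 (pow3 \<Phi> i j k) a b c = coeff3 F i j k * coeff3 (mon3 i j k) a b c" for i j k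
  proof (cases "i + j < n")
    case True
    then show ?thesis using vanishesD[OF F, of i j k] by simp
  next
    case False
    then show ?thesis using vanishesD[OF near_identity_pow3[OF \<Phi>, of i j k], of a b c] less by simp
  qed
  have "coeff3 (fsubst F \<Phi>) a b c =
    (\<Sum>i\<le>N. \<Sum>j\<le>N. \<Sum>k\<le>N. coeff3 F i j k * coeff3 (mon3 i j k) a b c)"
    by (simp add: coeff3_fsubst[OF no order_refl] pow N_def)
  also have "\<dots> = coeff3 (fsubst F (vector [X3, Y3, Z3])) a b c"
    by (simp add: coeff3_fsubst[OF near_identity_no_constant_term[OF id] order_refl] N_def pow3_def mon3_def)
  also have "\<dots> = coeff3 F a b c" by (simp only: fsubst_id)
  finally show "coeff3 (fsubst F \<Phi> - F) a b c = 0" by simp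
qed

lemma near_identity_reflects_vanishing:
  assumes \<Phi>: "near_identity \<Phi>" and F: "vanishes 0 n (fsubst F \<Phi>)"
  shows "vanishes 0 n F"
proof -
  have "m \<le> n \<Longrightarrow> vanishes 0 m F" for m
  proof (induction m)
    case (Suc m)
    then have "vanishes 0 (Suc m) (fsubst F \<Phi> - F)" using near_identity_fsubst[OF \<Phi>, of m F] by simp
    from vanishes_diff[OF vanishes_mono[OF F Suc.prems] this] show ?case by simp
  qed simp
  then show ?thesis by simp
qed

lemma near_identity_inj:
  assumes "near_identity \<Phi>" "fsubst F \<Phi> = fsubst G \<Phi>" shows "F = G"
proof -
  have "fsubst (F - G) \<Phi> = 0" using assms(2) by (simp add: fsubst_diff)
  then have "F - G = 0" using near_identity_reflects_vanishing[OF assms(1), of _ "F - G"]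
    by (intro vanishes_all) simp
  then show ?thesis by simp
qed

text \<open>
  Neumann series: the operator \<open>N = id - substitution\<close> raises the order by one, so \<open>\<Sum>t. N^t F\<close>
  converges and is a preimage of \<open>F\<close>. The sum is truncated coefficientwise.
\<close>

lemma near_identity_surj:
  assumes \<Phi>: "near_identity \<Phi>"
  obtains G where "fsubst G \<Phi> = F"
proof -
  define N where "N H = H - fsubst H \<Phi>" for H
  have N: "N ((N ^^ t) F) = (N ^^ t) F - fsubst ((N ^^ t) F) \<Phi>" for t
    by (rule N_def)
  define S where "S m = (\<Sum>t<m. (N ^^ t) F)" for m
  have Npow: "vanishes 0 t ((N ^^ t) F)" for t
  proof (induction t)
    case (Suc t)
    show ?case using vanishes_minus[OF near_identity_fsubst[OF \<Phi> Suc]] by (simp add: N)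
  qed simp
  have fS: "fsubst (S m) \<Phi> = F - (N ^^ m) F" for m
    by (induction m) (simp_all add: S_def fsubst_0 fsubst_add N)
  have step: "vanishes 0 m (S n - S m)" if "m \<le> n" for m n
    using that
  proof (induction n rule: dec_induct)
    case (step n)
    have "S (Suc n) - S m = (S n - S m) + (N ^^ n) F" by (simp add: S_def)
    then show ?case using step vanishes_add vanishes_mono[OF Npow] by metis
  qed simp
  define G where "G = series3 (\<lambda>i j k. coeff3 (S (Suc (i + j))) i j k)"
  have GS: "vanishes 0 m (G - S m)" for m
    unfolding vanishes_def
  proof (intro allI impI)
    fix i j k assume less: "i + j + 0 * k < m"
    then have "vanishes 0 (Suc (i + j)) (S m - S (Suc (i + j)))" by (intro step) simp
    from vanishesD[OF this, of i j k] show "coeff3 (G - S m) i j k = 0" by (simp add: G_def)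
  qed
  have "fsubst G \<Phi> - F = 0"
  proof (rule vanishes_all)
    fix m
    have "fsubst G \<Phi> - F = fsubst (G - S m) \<Phi> - (N ^^ m) F"
      by (simp add: fsubst_diff fS)
    moreover have "vanishes 0 m (fsubst (G - S m) \<Phi>)"
      using vanishes_add[OF vanishes_mono[OF near_identity_fsubst[OF \<Phi> GS]] GS, of m m] by simp
    ultimately show "vanishes 0 m (fsubst G \<Phi> - F)" using Npow vanishes_diff by metis
  qed
  then show ?thesis using that by simp
qed

text \<open>
  Preimages of the three coordinates form a left inverse \<open>\<Psi>\<close>. It is also a right inverse since
  substitution of \<open>\<Phi>\<close> is injective and associative: \<open>\<Phi> \<circ> \<Psi> \<circ> \<Phi> = \<Phi>\<close>.
\<close>

lemma near_identity_formal_change: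
  assumes \<Phi>: "near_identity \<Phi>" shows "formal_change \<Phi>"
proof -
  note no = near_identity_no_constant_term[OF \<Phi>]
  let ?I = "vector [X3, Y3, Z3] :: fps3^3"
  have "\<exists>G. fsubst G \<Phi> = ?I $ m" for m using near_identity_surj[OF \<Phi>] by metis
  then obtain g where g: "\<And>m. fsubst (g m) \<Phi> = ?I $ m" by metis
  define \<Psi> where "\<Psi> = (\<chi> m. g m)"
  have left: "fcompose \<Psi> \<Phi> = ?I" by (simp add: vec_eq_iff fcompose_def \<Psi>_def g)
  have I0: "coeff3 (?I $ m) 0 0 0 = 0" for m
    using exhaust_3[of m] by (auto simp: X3_mon Y3_mon Z3_mon coeff3_mon3)
  have \<Psi>: "no_constant_term \<Psi>"
    unfolding no_constant_term_def
  proof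
    fix m
    have "vanishes 0 1 (fsubst (g m) \<Phi> - g m)" using near_identity_fsubst[OF \<Phi>, of 0 "g m"]
      by (simp add: One_nat_def)
    from vanishesD[OF this, of 0 0 0] show "coeff3 (\<Psi> $ m) 0 0 0 = 0" 
      by (simp add: g I0 \<Psi>_def)
  qed
  have "fcompose \<Phi> \<Psi> = ?I"
  proof (subst vec_eq_iff, intro allI)
    fix m
    have "fsubst (fsubst (\<Phi> $ m) \<Psi>) \<Phi> = fsubst (\<Phi> $ m) ?I"
      by (simp only: fsubst_fsubst[OF \<Psi> no] left)
    also have "\<dots> = \<Phi> $ m" by (rule fsubst_id)
    also have "\<dots> = fsubst (?I $ m) \<Phi>"
      using exhaust_3[of m] by (auto simp: fsubst_vars[OF no])
    finally show "fcompose \<Phi> \<Psi> $ m = ?I $ m"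
      using near_identity_inj[OF \<Phi>] by (simp add: fcompose_def)
  qed
  then show ?thesis using left \<Psi> no by (auto simp: formal_change_def)
qed

section \<open>Residues of the normal form\<close>

text \<open>
  Once \<open>X\<close> and \<open>y\<close> are chosen as the first two coordinates, the relation \<open>{x,y} = z\<close> leaves no choice
  for the third one.
\<close>

definition third_coordinate :: "fps3^3 \<Rightarrow> fps3 \<Rightarrow> fps3" where
  "third_coordinate B X = formal_bracket B X Y3"

definition chart :: "fps3^3 \<Rightarrow> fps3 \<Rightarrow> fps3^3" where
  "chart B X = vector [X, Y3, third_coordinate B X]"

text \<open>
  The failure of the brackets \<open>{y,Z}\<close> and \<open>{Z,X}\<close> to have the normal form determined by \<open>F\<close> and \<open>G\<close>,
  which stand for \<open>f\<close> and \<open>g\<close> as series in three variables that do not involve \<open>z\<close>.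
\<close>

definition residue2 :: "fps3^3 \<Rightarrow> fps3 \<Rightarrow> fps3 \<Rightarrow> fps3 \<Rightarrow> fps3" where
  "residue2 B X F G = formal_bracket B Y3 (third_coordinate B X) -
     (fsubst (dx3 F) (chart B X) + third_coordinate B X * fsubst (dx3 G) (chart B X))"

definition residue3 :: "fps3^3 \<Rightarrow> fps3 \<Rightarrow> fps3 \<Rightarrow> fps3 \<Rightarrow> fps3" where
  "residue3 B X F G = formal_bracket B (third_coordinate B X) X -
     (fsubst (dy3 F) (chart B X) + third_coordinate B X * fsubst (dy3 G) (chart B X))"

lemma third_coordinate_eq: "B $ 1 = Z3 \<Longrightarrow> third_coordinate B X = Z3 * dx3 X - B $ 2 * dz3 X"
  by (simp add: third_coordinate_def formal_bracket_def)

lemma third_coordinate_add: "third_coordinate B (X + A) = third_coordinate B X + third_coordinate B A"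
  by (simp add: third_coordinate_def formal_bracket_def dx3_simps dy3_simps dz3_simps algebra_simps)

lemma formal_bracket_Y3: "B $ 1 = Z3 \<Longrightarrow> formal_bracket B Y3 F = B $ 2 * dz3 F - Z3 * dx3 F"
  by (simp add: formal_bracket_def)

lemma vanishes_dz3_adic: "vanishes 0 n F \<Longrightarrow> vanishes 0 n (dz3 F)"
  using vanishes_dz3[of 0 n F] by simp

lemma vanishes_dx3_adic: "vanishes 0 (n + 1) F \<Longrightarrow> vanishes 0 n (dx3 F)"
  and vanishes_dy3_adic: "vanishes 0 (n + 1) F \<Longrightarrow> vanishes 0 n (dy3 F)"
  using vanishes_dx3 vanishes_dy3 by (simp_all flip: Suc_eq_plus1)

lemma vanishes_formal_bracket:
  assumes "vanishes 0 (n + 1) F" shows "vanishes 0 n (formal_bracket B G F)"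
proof -
  have "vanishes 0 n (dz3 F)" by (rule vanishes_mono[OF vanishes_dz3_adic[OF assms]]) simp
  then show ?thesis unfolding formal_bracket_def
    by (intro vanishes_add vanishes_diff vanishes_mult_left vanishes_dx3_adic[OF assms]
        vanishes_dy3_adic[OF assms])
qed

lemma chart_near_identity:
  assumes B: "B $ 1 = Z3" and X: "vanishes 0 2 (X - X3)" shows "near_identity (chart B X)"
proof -
  have "third_coordinate B X - Z3 = Z3 * dx3 (X - X3) - B $ 2 * dz3 (X - X3)"
    by (simp add: third_coordinate_eq[OF B] dx3_simps dz3_simps algebra_simps)
  moreover have "vanishes 0 1 (dx3 (X - X3))" using vanishes_dx3_adic[of 1 "X - X3"] X by simp
  moreover have "vanishes 0 1 (dz3 (X - X3))" using vanishes_mono[OF vanishes_dz3_adic[OF X]] by simp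
  ultimately show ?thesis using X
    by (simp add: near_identity_def chart_def vanishes_diff vanishes_mult_left)
qed

text \<open>
  To leading order in \<open>(x,y)\<close>, bracketing with \<open>X\<close> is bracketing with \<open>x\<close> for the structure
  \<open>z \<partial>x \<and> \<partial>y\<close>.
\<close>

lemma formal_bracket_near_X:
  assumes B: "B $ 1 = Z3" and X: "vanishes 0 2 (X - X3)" and t: "vanishes 0 n t"
  shows "vanishes 0 n (formal_bracket B t X + Z3 * dy3 t)"
proof (cases n)
  case (Suc k)
  have d: "vanishes 0 k (dx3 t)" "vanishes 0 k (dy3 t)" "vanishes 0 n (dz3 t)"
    using t vanishes_dx3 vanishes_dy3 vanishes_dz3_adic by (simp_all add: Suc)
  have x: "vanishes 0 1 (dx3 (X - X3))" "vanishes 0 1 (dy3 (X - X3))" "vanishes 0 1 (dz3 (X - X3))"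
    using vanishes_dx3_adic[of 1 "X - X3"] vanishes_dy3_adic[of 1 "X - X3"] X
      vanishes_mono[OF vanishes_dz3_adic[OF X]] by simp_all
  have n: "n = k + 1" using Suc by simp
  have "formal_bracket B t X + Z3 * dy3 t =
     Z3 * (dx3 t * dy3 (X - X3) - dy3 t * dx3 (X - X3)) + B $ 2 * (dy3 t * dz3 (X - X3) - dz3 t * dy3 X) +
     B $ 3 * (dz3 t * dx3 X - dx3 t * dz3 (X - X3))"
    by (simp add: formal_bracket_def B dx3_simps dy3_simps dz3_simps algebra_simps)
  also have "vanishes 0 n \<dots>"
    using vanishes_mult[OF d(1) x(2)] vanishes_mult[OF d(2) x(1)] vanishes_mult[OF d(2) x(3)]
      vanishes_mult[OF d(1) x(3)] vanishes_mult_right[OF d(3)]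
    by (intro vanishes_add vanishes_mult_left[OF vanishes_diff]) (simp_all add: n)
  finally show ?thesis .
qed simp

text \<open>
  The effect on the residues of corrections of the sizes that occur at stage \<open>m\<close>. The correction \<open>A\<close>
  of \<open>X\<close> changes \<open>Z\<close> by \<open>z A\<^sub>x\<close> to leading order, hence \<open>{y,Z}\<close> by \<open>-z\<^sup>2 A\<^sub>x\<^sub>x\<close> and \<open>{Z,X}\<close> by
  \<open>-z\<^sup>2 A\<^sub>x\<^sub>y\<close>.
\<close>

context
  fixes B :: "fps3^3" and X A F G F' G' :: fps3 and m :: nat
  assumes B: "B $ 1 = Z3" and X: "vanishes 0 2 (X - X3)" and A: "vanishes 0 (m + 2) A"
    and F': "vanishes 0 (m + 1) F'" and G': "vanishes 0 (m + 1) G'"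
begin

lemma perturbed_X: "vanishes 0 2 (X + A - X3)"
  using vanishes_add[OF X vanishes_mono[OF A, of 2]] by (simp add: algebra_simps)

lemma third_coordinate_perturbation: "vanishes 0 (m + 1) (third_coordinate B A)"
  unfolding third_coordinate_eq[OF B]
  using vanishes_dx3_adic[of "m + 1" A] vanishes_mono[OF vanishes_dz3_adic[OF A], of "m + 1"] A
  by (auto intro!: vanishes_diff vanishes_mult_left simp: add.assoc)

lemma chart_perturbation: "vanishes 0 (m + 1) (fsubst H (chart B (X + A)) - fsubst H (chart B X))"
proof (rule vanishes_fsubst_cong)
  show "vanishes 0 (m + 1) (chart B (X + A) $ i - chart B X $ i)" for i
    using exhaust_3[of i] third_coordinate_perturbation vanishes_mono[OF A]
    by (auto simp: chart_def third_coordinate_add)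
qed (intro near_identity_no_constant_term chart_near_identity B X perturbed_X)+

lemma normal_form_perturbation:
  assumes H: "vanishes 0 m H'" and K: "vanishes 0 m K'"
  shows "vanishes 0 (m + 1) (fsubst (H + H') (chart B (X + A))
     + third_coordinate B (X + A) * fsubst (K + K') (chart B (X + A))
     - (fsubst H (chart B X) + third_coordinate B X * fsubst K (chart B X) + H' + Z3 * K'))"
proof -
  let ?\<Phi> = "chart B (X + A)"
  note near = chart_near_identity[OF B perturbed_X]
  note near_H = near_identity_fsubst[OF near H] and near_K = near_identity_fsubst[OF near K]
  have Z: "vanishes 0 1 (third_coordinate B (X + A) - Z3)"
    using near by (simp add: near_identity_def chart_def)
  have "fsubst (H + H') ?\<Phi> + third_coordinate B (X + A) * fsubst (K + K') ?\<Phi>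
     - (fsubst H (chart B X) + third_coordinate B X * fsubst K (chart B X) + H' + Z3 * K') =
     (fsubst H ?\<Phi> - fsubst H (chart B X)) + (fsubst H' ?\<Phi> - H')
     + (third_coordinate B (X + A) * fsubst K ?\<Phi> - third_coordinate B X * fsubst K (chart B X))
     + third_coordinate B (X + A) * (fsubst K' ?\<Phi> - K')
     + (third_coordinate B (X + A) - Z3) * K'"
    by (simp add: fsubst_add algebra_simps)
  also have "vanishes 0 (m + 1) \<dots>"
  proof (intro vanishes_add)
    show "vanishes 0 (m + 1) (third_coordinate B (X + A) * fsubst K ?\<Phi> - third_coordinate B X * fsubst K (chart B X))"
      by (intro vanishes_cong_mult chart_perturbation)
        (simp add: third_coordinate_add third_coordinate_perturbation)
    show "vanishes 0 (m + 1) ((third_coordinate B (X + A) - Z3) * K')"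
      using vanishes_mult[OF Z K] by (simp add: add.commute)
    show "vanishes 0 (m + 1) (third_coordinate B (X + A) * (fsubst K' ?\<Phi> - K'))"
      using near_K by (intro vanishes_mult_left) (simp add: Suc_eq_plus1)
    show "vanishes 0 (m + 1) (fsubst H' ?\<Phi> - H')" using near_H by (simp add: Suc_eq_plus1)
  qed (rule chart_perturbation)
  finally show ?thesis .
qed

lemma residue2_perturbation:
  "vanishes 0 (m + 1) (residue2 B (X + A) (F + F') (G + G') -
     (residue2 B X F G - (dx3 F' + Z3 * dx3 G' + Z3 * Z3 * dx3 (dx3 A))))"
proof -
  have A2: "vanishes 0 (m + 2) (B $ 2 * dz3 A)" by (intro vanishes_mult_left vanishes_dz3_adic A)
  have Zeq: "third_coordinate B A = Z3 * dx3 A - B $ 2 * dz3 A" by (rule third_coordinate_eq[OF B])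
  define N where "N = fsubst (dx3 F + dx3 F') (chart B (X + A))
     + third_coordinate B (X + A) * fsubst (dx3 G + dx3 G') (chart B (X + A))
     - (fsubst (dx3 F) (chart B X) + third_coordinate B X * fsubst (dx3 G) (chart B X) + dx3 F' + Z3 * dx3 G')"
  have N: "vanishes 0 (m + 1) N" unfolding N_def
    by (intro normal_form_perturbation vanishes_dx3_adic F' G')
  have E: "formal_bracket B Y3 (third_coordinate B A) + Z3 * Z3 * dx3 (dx3 A) =
     B $ 2 * dz3 (third_coordinate B A) + Z3 * dx3 (B $ 2 * dz3 A)"
    by (simp add: formal_bracket_Y3[OF B] Zeq dx3_simps algebra_simps)
  have "residue2 B (X + A) (F + F') (G + G') -
     (residue2 B X F G - (dx3 F' + Z3 * dx3 G' + Z3 * Z3 * dx3 (dx3 A))) =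
     (formal_bracket B Y3 (third_coordinate B A) + Z3 * Z3 * dx3 (dx3 A)) - N"
    by (simp add: residue2_def N_def third_coordinate_add formal_bracket_simps dx3_simps algebra_simps)
  also have "\<dots> = B $ 2 * dz3 (third_coordinate B A) + Z3 * dx3 (B $ 2 * dz3 A) - N"
    by (simp only: E)
  also have "vanishes 0 (m + 1) \<dots>"
    using A by (intro vanishes_diff vanishes_add N vanishes_mult_left[OF vanishes_dz3_adic]
        third_coordinate_perturbation vanishes_mult_left[OF vanishes_dx3_adic]) (simp add: add.assoc)
  finally show ?thesis .
qed

lemma residue3_perturbation:
  "vanishes 0 (m + 1) (residue3 B (X + A) (F + F') (G + G') -
     (residue3 B X F G - (dy3 F' + Z3 * dy3 G' + Z3 * Z3 * dy3 (dx3 A))))"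
proof -
  have A2: "vanishes 0 (m + 2) (B $ 2 * dz3 A)" by (intro vanishes_mult_left vanishes_dz3_adic A)
  have Zeq: "third_coordinate B A = Z3 * dx3 A - B $ 2 * dz3 A" by (rule third_coordinate_eq[OF B])
  define N where "N = fsubst (dy3 F + dy3 F') (chart B (X + A))
     + third_coordinate B (X + A) * fsubst (dy3 G + dy3 G') (chart B (X + A))
     - (fsubst (dy3 F) (chart B X) + third_coordinate B X * fsubst (dy3 G) (chart B X) + dy3 F' + Z3 * dy3 G')"
  have N: "vanishes 0 (m + 1) N" unfolding N_def
    by (intro normal_form_perturbation vanishes_dy3_adic F' G')
  define E where "E = formal_bracket B (third_coordinate B A) X + Z3 * dy3 (third_coordinate B A)"
  have E: "vanishes 0 (m + 1) E" unfolding E_def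
    by (rule formal_bracket_near_X[OF B X third_coordinate_perturbation])
  have dyZ: "dy3 (third_coordinate B A) = Z3 * dy3 (dx3 A) - dy3 (B $ 2 * dz3 A)"
    by (simp add: Zeq dy3_simps)
  have "formal_bracket B (third_coordinate B X + third_coordinate B A) (X + A) =
      formal_bracket B (third_coordinate B X) X + formal_bracket B (third_coordinate B A) X
     + formal_bracket B (third_coordinate B (X + A)) A"
    by (simp add: third_coordinate_add formal_bracket_def dx3_simps dy3_simps dz3_simps algebra_simps)
  then have "residue3 B (X + A) (F + F') (G + G') -
     (residue3 B X F G - (dy3 F' + Z3 * dy3 G' + Z3 * Z3 * dy3 (dx3 A))) =
     E + Z3 * dy3 (B $ 2 * dz3 A) + formal_bracket B (third_coordinate B (X + A)) A - N"
    unfolding E_def dyZ N_def residue3_def third_coordinate_add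
    by (simp add: dy3_simps(1) algebra_simps)
  also have "vanishes 0 (m + 1) \<dots>"
    using A A2 by (intro vanishes_diff vanishes_add N E vanishes_formal_bracket
        vanishes_mult_left[OF vanishes_dy3_adic]) (simp_all add: add.assoc)
  finally show ?thesis .
qed

end

text \<open>
  The Jacobi identity of \<open>X, y, Z\<close> reads \<open>{X,{y,Z}} + {y,{Z,X}} = 0\<close> because \<open>{Z,{X,y}} = {Z,Z} = 0\<close>.
  Inserting the normal form plus residues, the second derivatives of \<open>f\<close> and \<open>g\<close> cancel and
  \<open>f\<^sub>x g\<^sub>y - f\<^sub>y g\<^sub>x\<close> remains, up to terms linear in the residues, the leading ones being
  \<open>{X,R}\<close> and \<open>{y,S}\<close>.
\<close>

lemma residues_jacobi_relation:
  assumes B: "B $ 1 = Z3" and J: "formal_jacobi B" and X: "vanishes 0 2 (X - X3)"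
    and F: "dz3 F = 0" and G: "dz3 G = 0"
    and R2: "vanishes 0 m (residue2 B X F G)" and R3: "vanishes 0 m (residue3 B X F G)"
  shows "vanishes 0 m (fsubst (dx3 F * dy3 G - dy3 F * dx3 G) (chart B X)
     + Z3 * (dy3 (residue2 B X F G) - dx3 (residue3 B X F G)))"
proof -
  let ?\<Phi> = "chart B X" and ?Z = "third_coordinate B X" and ?br = "formal_bracket B"
  define S2 where "S2 = residue2 B X F G"
  define S3 where "S3 = residue3 B X F G"
  note no = near_identity_no_constant_term[OF chart_near_identity[OF B X]]
  have \<Phi>: "?\<Phi> $ 1 = X" "?\<Phi> $ 2 = Y3" "?\<Phi> $ 3 = ?Z" by (simp_all add: chart_def)
  have XY: "?br X Y3 = ?Z" "?br Y3 X = - ?Z"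
    using formal_bracket_swap[of B Y3 X] by (simp_all add: third_coordinate_def)
  have dz: "dz3 (dx3 F) = 0" "dz3 (dy3 F) = 0" "dz3 (dx3 G) = 0" "dz3 (dy3 G) = 0"
    by (simp_all add: d3_commute F G dx3_simps dy3_simps)
  have E2: "?br Y3 ?Z = fsubst (dx3 F) ?\<Phi> + ?Z * fsubst (dx3 G) ?\<Phi> + S2"
    and E3: "?br ?Z X = fsubst (dy3 F) ?\<Phi> + ?Z * fsubst (dy3 G) ?\<Phi> + S3"
    by (simp_all add: S2_def S3_def residue2_def residue3_def)
  have XZ: "?br X ?Z = - ?br ?Z X" by (rule formal_bracket_swap)
  have dX: "?br X (fsubst H ?\<Phi>) = fsubst (dy3 H) ?\<Phi> * ?Z"
    and dY: "?br Y3 (fsubst H ?\<Phi>) = - fsubst (dx3 H) ?\<Phi> * ?Z" if "dz3 H = 0" for H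
    using derivation3_fsubst[OF derivation3_formal_bracket no, of B X H]
      derivation3_fsubst[OF derivation3_formal_bracket no, of B Y3 H] that
    by (simp_all add: \<Phi> XY fsubst_0)
  have j2: "?br X (?br Y3 ?Z) = fsubst (dy3 (dx3 F)) ?\<Phi> * ?Z + ?br X ?Z * fsubst (dx3 G) ?\<Phi>
     + ?Z * (fsubst (dy3 (dx3 G)) ?\<Phi> * ?Z) + ?br X S2"
    unfolding E2 by (simp add: formal_bracket_simps dX dz)
  have j3: "?br Y3 (?br ?Z X) = - fsubst (dx3 (dy3 F)) ?\<Phi> * ?Z + ?br Y3 ?Z * fsubst (dy3 G) ?\<Phi>
     - ?Z * (fsubst (dx3 (dy3 G)) ?\<Phi> * ?Z) + ?br Y3 S3"
    unfolding E3 by (simp add: formal_bracket_simps dY dz)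
  have "?br Y3 ?Z * fsubst (dy3 G) ?\<Phi> - ?br ?Z X * fsubst (dx3 G) ?\<Phi> + ?br X S2 + ?br Y3 S3
      = ?br X (?br Y3 ?Z) + ?br Y3 (?br ?Z X)"
    unfolding j2 j3 XZ d3_commute by (simp add: algebra_simps)
  also have "\<dots> = 0"
    using formal_jacobi_identity[OF J, of X Y3 ?Z] by (simp add: XY)
  finally have "?br Y3 ?Z * fsubst (dy3 G) ?\<Phi> - ?br ?Z X * fsubst (dx3 G) ?\<Phi> + ?br X S2 + ?br Y3 S3 = 0" .
  then have "fsubst (dx3 F * dy3 G - dy3 F * dx3 G) ?\<Phi> = 
      - (S2 * fsubst (dy3 G) ?\<Phi> - S3 * fsubst (dx3 G) ?\<Phi> + ?br X S2 + ?br Y3 S3)"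
    unfolding E2 E3 fsubst_diff fsubst_mult[OF no] by (simp add: algebra_simps add_eq_0_iff2)
  then have "fsubst (dx3 F * dy3 G - dy3 F * dx3 G) ?\<Phi> + Z3 * (dy3 S2 - dx3 S3) =
      (?br S2 X + Z3 * dy3 S2) - B $ 2 * dz3 S3 - S2 * fsubst (dy3 G) ?\<Phi> + S3 * fsubst (dx3 G) ?\<Phi>"
    using formal_bracket_swap[of B S2 X] by (simp add: formal_bracket_Y3[OF B] algebra_simps)
  also have "vanishes 0 m \<dots>"
    using R2 R3 unfolding S2_def[symmetric] S3_def[symmetric]
    by (intro vanishes_add vanishes_diff vanishes_mult_left[OF vanishes_dz3_adic] vanishes_mult_right
        formal_bracket_near_X[OF B X])
  finally show ?thesis by (simp add: S2_def S3_def)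
qed

text \<open>
  In the relation \<open>D(X,y) + z (R\<^sub>y - S\<^sub>x) \<in> I^m\<close> the second summand lies in \<open>I^(m-1)\<close>, hence so
  does \<open>D\<close>, and \<open>D(X,y)\<close> may be replaced by \<open>D(x,y)\<close>. Now the first summand is free of \<open>z\<close> and the
  second one is divisible by \<open>z\<close>, so they cannot cancel.
\<close>

lemma residues_curl_free:
  assumes B: "B $ 1 = Z3" and J: "formal_jacobi B" and X: "vanishes 0 2 (X - X3)"
    and F: "dz3 F = 0" and G: "dz3 G = 0"
    and R2: "vanishes 0 m (residue2 B X F G)" and R3: "vanishes 0 m (residue3 B X F G)"
  shows "vanishes 0 m (dy3 (residue2 B X F G) - dx3 (residue3 B X F G))"
proof (cases m)
  case (Suc n)
  define T where "T = dy3 (residue2 B X F G) - dx3 (residue3 B X F G)"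
  define D where "D = dx3 F * dy3 G - dy3 F * dx3 G"
  note near = chart_near_identity[OF B X]
  have sum: "vanishes 0 m (fsubst D (chart B X) + Z3 * T)"
    unfolding D_def T_def by (rule residues_jacobi_relation[OF assms])
  have T: "vanishes 0 n T"
    using R2 R3 unfolding T_def Suc by (intro vanishes_diff vanishes_dx3 vanishes_dy3)
  have "vanishes 0 n (fsubst D (chart B X))"
    using vanishes_diff[OF vanishes_mono[OF sum, of n] vanishes_mult_left[OF T, of Z3]] by (simp add: Suc)
  from near_identity_fsubst[OF near near_identity_reflects_vanishing[OF near this]]
  have "vanishes 0 m (D + Z3 * T)"
    using vanishes_diff[OF sum, of "fsubst D (chart B X) - D"] by (simp add: Suc add.commute)
  note c = vanishesD[OF this]
  have dzD: "dz3 D = 0"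
    by (simp add: D_def dz3_simps d3_commute F G dx3_simps dy3_simps)
  \<comment> \<open>\<open>D\<close> has no terms with \<open>z\<close>, so \<open>z^(k+1)\<close> in \<open>D + z T\<close> sees only \<open>T\<close>.\<close>
  have "coeff3 T i j k = 0" if "i + j < m" for i j k
  proof -
    have "real (Suc k) * coeff3 D i j (Suc k) = 0" using arg_cong[OF dzD, of "\<lambda>F. coeff3 F i j k"] by simp
    then have "coeff3 D i j (Suc k) = 0" by (simp del: of_nat_Suc)
    then show ?thesis using c[of i j "Suc k"] that by (simp add: coeff3_Z3_mult)
  qed
  then show ?thesis unfolding T_def[symmetric] vanishes_def by simp
qed simp

section \<open>Construction of the normalizing series\<close>

text \<open>
  The homogeneous part of degree \<open>m + 1\<close> of a common primitive: where \<open>x\<close> occurs, the coefficient is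
  obtained by integrating \<open>R\<close> in \<open>x\<close>, and the powers of \<open>y\<close> alone come from integrating \<open>S\<close>.
\<close>

definition primitive3 :: "nat \<Rightarrow> fps3 \<Rightarrow> fps3 \<Rightarrow> fps3" where
  "primitive3 m R S = series3 (\<lambda>i j k. if i + j = Suc m then
     if i = 0 then coeff3 S 0 (j - 1) k / real j else coeff3 R (i - 1) j k / real i else 0)"

definition z_coefficient :: "nat \<Rightarrow> fps3 \<Rightarrow> fps3" where
  "z_coefficient n P = series3 (\<lambda>i j k. if k = 0 then coeff3 P i j n else 0)"

text \<open>
  The primitive in \<open>x\<close>, without constant of integration, of the quotient of \<open>P\<close> by \<open>z\<^sup>2\<close>.
\<close>

definition x_integral_z2 :: "fps3 \<Rightarrow> fps3" where
  "x_integral_z2 P = series3 (\<lambda>i j k. if i = 0 then 0 else coeff3 P (i - 1) j (k + 2) / real i)"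

lemma primitive3:
  assumes R: "vanishes 0 m R" and S: "vanishes 0 m S" and closed: "vanishes 0 m (dy3 R - dx3 S)"
  shows "vanishes 0 (m + 1) (primitive3 m R S)"
    and "vanishes 0 (m + 1) (dx3 (primitive3 m R S) - R)"
    and "vanishes 0 (m + 1) (dy3 (primitive3 m R S) - S)"
proof -
  show "vanishes 0 (m + 1) (primitive3 m R S)" by (simp add: vanishes_def primitive3_def)
  show "vanishes 0 (m + 1) (dx3 (primitive3 m R S) - R)"
    unfolding vanishes_def
  proof (intro allI impI)
    fix i j k assume "i + j + 0 * k < m + 1"
    then consider "i + j = m" | "i + j < m" by linarith
    then show "coeff3 (dx3 (primitive3 m R S) - R) i j k = 0"
      using vanishesD[OF R, of i j k] by cases (auto simp: primitive3_def simp del: of_nat_Suc)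
  qed
  show "vanishes 0 (m + 1) (dy3 (primitive3 m R S) - S)"
    unfolding vanishes_def
  proof (intro allI impI)
    fix i j k assume "i + j + 0 * k < m + 1"
    then consider "i + j < m" | "i = 0" "j = m" | n where "i = Suc n" "n + j < m" "i + j = m"
      by (cases i) force+
    then show "coeff3 (dy3 (primitive3 m R S) - S) i j k = 0"
    proof cases
      case 1
      then show ?thesis using vanishesD[OF S, of i j k] by (simp add: primitive3_def)
    next
      case 2
      then show ?thesis by (simp add: primitive3_def del: of_nat_Suc)
    next
      case 3
      have "real (Suc j) * coeff3 R n (Suc j) k = real (Suc n) * coeff3 S (Suc n) j k"
        using vanishesD[OF closed, of n j k] 3 by simp
      then show ?thesis using 3 by (simp add: primitive3_def field_simps del: of_nat_Suc)
    qed
  qed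
qed

lemma dz3_z_coefficient [simp]: "dz3 (z_coefficient n P) = 0"
  by (rule fps3_eqI) (simp add: z_coefficient_def)

lemma vanishes_z_coefficient: "vanishes 0 m P \<Longrightarrow> vanishes 0 m (z_coefficient n P)"
  by (simp add: vanishes_def z_coefficient_def)

lemma vanishes_x_integral_z2: "vanishes 0 (m + 1) P \<Longrightarrow> vanishes 0 (m + 2) (x_integral_z2 P)"
  by (auto simp: vanishes_def x_integral_z2_def)

lemma z_decomposition:
  "P = z_coefficient 0 P + Z3 * z_coefficient 1 P + Z3 * Z3 * dx3 (x_integral_z2 P)"
proof (rule fps3_eqI)
  fix i j k :: nat
  have k: "Suc (Suc (k - 2)) = k" if "0 < k" "k \<noteq> 1" using that by simp
  show "coeff3 P i j k = coeff3 (z_coefficient 0 P + Z3 * z_coefficient 1 P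
      + Z3 * Z3 * dx3 (x_integral_z2 P)) i j k"
    unfolding mult.assoc coeff3_simps coeff3_Z3_mult
    by (cases "k = 0"; cases "k = 1")
      (auto simp: z_coefficient_def x_integral_z2_def k simp del: of_nat_Suc)
qed

text \<open>
  The successive approximations of \<open>(X, f, g)\<close>. They are given by explicit formulas, not by a choice of
  solutions, so that smooth dependence on parameters can be read off.
\<close>

primrec normal_form_seq :: "fps3^3 \<Rightarrow> nat \<Rightarrow> fps3 \<times> fps3 \<times> fps3" where
  "normal_form_seq B 0 = (X3, 0, 0)"
| "normal_form_seq B (Suc m) = (case normal_form_seq B m of (X, F, G) \<Rightarrow>
     let P = primitive3 m (residue2 B X F G) (residue3 B X F G)
     in (X + x_integral_z2 P, F + z_coefficient 0 P, G + z_coefficient 1 P))"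

definition "seq_X B m = fst (normal_form_seq B m)"
definition "seq_F B m = fst (snd (normal_form_seq B m))"
definition "seq_G B m = snd (snd (normal_form_seq B m))"
definition "seq_P B m = primitive3 m (residue2 B (seq_X B m) (seq_F B m) (seq_G B m))
   (residue3 B (seq_X B m) (seq_F B m) (seq_G B m))"

lemma seq_0: "seq_X B 0 = X3" "seq_F B 0 = 0" "seq_G B 0 = 0"
  by (simp_all add: seq_X_def seq_F_def seq_G_def)

lemma seq_Suc:
  "seq_X B (Suc m) = seq_X B m + x_integral_z2 (seq_P B m)"
  "seq_F B (Suc m) = seq_F B m + z_coefficient 0 (seq_P B m)"
  "seq_G B (Suc m) = seq_G B m + z_coefficient 1 (seq_P B m)"
  by (simp_all add: seq_X_def seq_F_def seq_G_def seq_P_def split_beta Let_def)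

lemma normal_form_seq_invariant:
  assumes B: "B $ 1 = Z3" and J: "formal_jacobi B"
  shows "vanishes 0 2 (seq_X B m - X3) \<and> dz3 (seq_F B m) = 0 \<and> dz3 (seq_G B m) = 0 \<and>
     vanishes 0 m (residue2 B (seq_X B m) (seq_F B m) (seq_G B m)) \<and>
     vanishes 0 m (residue3 B (seq_X B m) (seq_F B m) (seq_G B m))"
proof (induction m)
  case 0
  show ?case by (simp add: seq_0 dz3_simps)
next
  case (Suc m)
  let ?X = "seq_X B m" and ?F = "seq_F B m" and ?G = "seq_G B m" and ?P = "seq_P B m"
  define R where "R = residue2 B ?X ?F ?G"
  define S where "S = residue3 B ?X ?F ?G"
  have X: "vanishes 0 2 (?X - X3)" and F: "dz3 ?F = 0" and G: "dz3 ?G = 0"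
    and R: "vanishes 0 m R" and S: "vanishes 0 m S" using Suc by (auto simp: R_def S_def)
  have "vanishes 0 m (dy3 R - dx3 S)" using R S unfolding R_def S_def
    by (rule residues_curl_free[OF B J X F G])
  note P = primitive3[OF R S this]
  have P_eq: "?P = primitive3 m R S" by (simp add: seq_P_def R_def S_def)
  note A = vanishes_x_integral_z2[OF P(1), folded P_eq]
  note FG = vanishes_z_coefficient[OF P(1), folded P_eq]
  let ?A = "x_integral_z2 ?P" and ?F' = "z_coefficient 0 ?P" and ?G' = "z_coefficient 1 ?P"
  have dx: "dx3 ?P = dx3 ?F' + Z3 * dx3 ?G' + Z3 * Z3 * dx3 (dx3 ?A)"
    by (subst z_decomposition[of ?P]) (simp add: dx3_simps)
  have dy: "dy3 ?P = dy3 ?F' + Z3 * dy3 ?G' + Z3 * Z3 * dy3 (dx3 ?A)"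
    by (subst z_decomposition[of ?P]) (simp add: dy3_simps)
  have "vanishes 0 (m + 1) (residue2 B (seq_X B (Suc m)) (seq_F B (Suc m)) (seq_G B (Suc m)) - (R - dx3 ?P))"
    unfolding seq_Suc dx R_def by (rule residue2_perturbation[OF B X A FG FG])
  from vanishes_diff[OF this P(2)[folded P_eq]]
  have 1: "vanishes 0 (Suc m) (residue2 B (seq_X B (Suc m)) (seq_F B (Suc m)) (seq_G B (Suc m)))"
    by (simp add: One_nat_def)
  have "vanishes 0 (m + 1) (residue3 B (seq_X B (Suc m)) (seq_F B (Suc m)) (seq_G B (Suc m)) - (S - dy3 ?P))"
    unfolding seq_Suc dy S_def by (rule residue3_perturbation[OF B X A FG FG])
  from vanishes_diff[OF this P(3)[folded P_eq]]
  have 2: "vanishes 0 (Suc m) (residue3 B (seq_X B (Suc m)) (seq_F B (Suc m)) (seq_G B (Suc m)))"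
    by (simp add: One_nat_def)
  have 3: "vanishes 0 2 (seq_X B (Suc m) - X3)"
    unfolding seq_Suc by (rule perturbed_X[OF B X A FG FG])
  show ?case using 1 2 3 by (simp add: seq_Suc dz3_simps F G)
qed

lemma vanishes_seq_P: "vanishes 0 (m + 1) (seq_P B m)"
  by (simp add: vanishes_def seq_P_def primitive3_def)

text \<open>
  Meant for sequences whose \<open>m\<close>-th step is a correction of order above \<open>m\<close>: there the coefficients of
  \<open>(x,y)\<close>-degree \<open>n\<close> are stationary from the \<open>n\<close>-th term on.
\<close>

definition adic_limit :: "(nat \<Rightarrow> fps3) \<Rightarrow> fps3" where
  "adic_limit S = series3 (\<lambda>i j k. coeff3 (S (i + j)) i j k)"

lemma adic_limit:
  assumes "\<And>m. vanishes 0 (m + d) (S (Suc m) - S m)" "0 < d"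
  shows "vanishes 0 (m + d) (adic_limit S - S m)"
proof -
  have le: "vanishes 0 (m + d) (S n - S m)" if "m \<le> n" for m n
    using that
  proof (induction n rule: dec_induct)
    case (step n)
    have "vanishes 0 (m + d) (S (Suc n) - S n)" using vanishes_mono[OF assms(1)[of n]] step by simp
    from vanishes_add[OF this step.IH] show ?case by simp
  qed simp
  show ?thesis unfolding vanishes_def
  proof (intro allI impI)
    fix i j k assume less: "i + j + 0 * k < m + d"
    show "coeff3 (adic_limit S - S m) i j k = 0"
    proof (cases "m \<le> i + j")
      case True
      from vanishesD[OF le[OF this], of i j k] less show ?thesis by (simp add: adic_limit_def)
    next
      case False
      from vanishesD[OF le[of "i + j" m], of i j k] less assms(2) False show ?thesis
        by (simp add: adic_limit_def)
    qed
  qed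
qed

definition "limit_X B = adic_limit (seq_X B)"
definition "limit_F B = adic_limit (seq_F B)"
definition "limit_G B = adic_limit (seq_G B)"

text \<open>
  The limit differs from the \<open>m\<close>-th approximation by corrections of the sizes allowed at stage \<open>m\<close>,
  so the perturbation lemmas bound its residues by those of the approximation, for every \<open>m\<close>.
\<close>

lemma normal_form_limit:
  assumes B: "B $ 1 = Z3" and J: "formal_jacobi B"
  shows "vanishes 0 2 (limit_X B - X3)" "dz3 (limit_F B) = 0" "dz3 (limit_G B) = 0"
    "vanishes 0 1 (limit_F B)" "vanishes 0 1 (limit_G B)"
    "residue2 B (limit_X B) (limit_F B) (limit_G B) = 0"
    "residue3 B (limit_X B) (limit_F B) (limit_G B) = 0"
proof -
  note P = vanishes_seq_P
  note inv = normal_form_seq_invariant[OF assms]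
  have X: "vanishes 0 (m + 2) (limit_X B - seq_X B m)" for m
    unfolding limit_X_def by (rule adic_limit) (simp_all only: seq_Suc add_diff_cancel_left' vanishes_x_integral_z2 P zero_less_numeral)
  have F: "vanishes 0 (m + 1) (limit_F B - seq_F B m)" for m
    unfolding limit_F_def by (rule adic_limit) (simp_all add: seq_Suc vanishes_z_coefficient P)
  have G: "vanishes 0 (m + 1) (limit_G B - seq_G B m)" for m
    unfolding limit_G_def by (rule adic_limit) (simp_all add: seq_Suc vanishes_z_coefficient P)
  show X2: "vanishes 0 2 (limit_X B - X3)" using X[of 0] by (simp only: seq_0 add_0)
  show "vanishes 0 1 (limit_F B)" "vanishes 0 1 (limit_G B)" using F[of 0] G[of 0] by (simp_all add: seq_0)
  have z: "coeff3 (limit_F B) i j (Suc k) = 0" "coeff3 (limit_G B) i j (Suc k) = 0" for i j k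
  proof -
    have "real (Suc k) * coeff3 (seq_F B (i + j)) i j (Suc k) = 0"
      "real (Suc k) * coeff3 (seq_G B (i + j)) i j (Suc k) = 0"
      using inv[of "i + j"] coeff3_dz3[of "seq_F B (i + j)" i j k] coeff3_dz3[of "seq_G B (i + j)" i j k]
      by simp_all
    then show "coeff3 (limit_F B) i j (Suc k) = 0" "coeff3 (limit_G B) i j (Suc k) = 0"
      by (simp_all add: limit_F_def limit_G_def adic_limit_def del: of_nat_Suc)
  qed
  show "dz3 (limit_F B) = 0" "dz3 (limit_G B) = 0" by (rule fps3_eqI, simp add: z)+
  show "residue2 B (limit_X B) (limit_F B) (limit_G B) = 0"
  proof (rule vanishes_all)
    fix m
    let ?A = "limit_X B - seq_X B m" and ?F = "limit_F B - seq_F B m" and ?G = "limit_G B - seq_G B m"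
    have small: "vanishes 0 m (dx3 ?F + Z3 * dx3 ?G + Z3 * Z3 * dx3 (dx3 ?A))"
      using X[of m] F[of m] G[of m]
      by (intro vanishes_add vanishes_mult_left vanishes_dx3_adic) (simp_all add: add.assoc)
    have "vanishes 0 (m + 1) (residue2 B (limit_X B) (limit_F B) (limit_G B) -
       (residue2 B (seq_X B m) (seq_F B m) (seq_G B m) - (dx3 ?F + Z3 * dx3 ?G + Z3 * Z3 * dx3 (dx3 ?A))))"
      using residue2_perturbation[OF B _ X[of m] F[of m] G[of m], where X = "seq_X B m" and F = "seq_F B m" and G = "seq_G B m"] inv[of m] by simp
    then have "vanishes 0 m (residue2 B (limit_X B) (limit_F B) (limit_G B) -
       (residue2 B (seq_X B m) (seq_F B m) (seq_G B m) - (dx3 ?F + Z3 * dx3 ?G + Z3 * Z3 * dx3 (dx3 ?A))))"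
      by (rule vanishes_mono) simp
    from vanishes_add[OF this vanishes_diff[OF _ small, of "residue2 B (seq_X B m) (seq_F B m) (seq_G B m)"]]
    show "vanishes 0 m (residue2 B (limit_X B) (limit_F B) (limit_G B))" using inv[of m] by simp
  qed
  show "residue3 B (limit_X B) (limit_F B) (limit_G B) = 0"
  proof (rule vanishes_all)
    fix m
    let ?A = "limit_X B - seq_X B m" and ?F = "limit_F B - seq_F B m" and ?G = "limit_G B - seq_G B m"
    have small: "vanishes 0 m (dy3 ?F + Z3 * dy3 ?G + Z3 * Z3 * dy3 (dx3 ?A))"
      using X[of m] F[of m] G[of m]
      by (intro vanishes_add vanishes_mult_left vanishes_dx3_adic vanishes_dy3_adic) (simp_all add: add.assoc)
    have "vanishes 0 (m + 1) (residue3 B (limit_X B) (limit_F B) (limit_G B) -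
       (residue3 B (seq_X B m) (seq_F B m) (seq_G B m) - (dy3 ?F + Z3 * dy3 ?G + Z3 * Z3 * dy3 (dx3 ?A))))"
      using residue3_perturbation[OF B _ X[of m] F[of m] G[of m], where X = "seq_X B m" and F = "seq_F B m" and G = "seq_G B m"] inv[of m] by simp
    then have "vanishes 0 m (residue3 B (limit_X B) (limit_F B) (limit_G B) -
       (residue3 B (seq_X B m) (seq_F B m) (seq_G B m) - (dy3 ?F + Z3 * dy3 ?G + Z3 * Z3 * dy3 (dx3 ?A))))"
      by (rule vanishes_mono) simp
    from vanishes_add[OF this vanishes_diff[OF _ small, of "residue3 B (seq_X B m) (seq_F B m) (seq_G B m)"]]
    show "vanishes 0 m (residue3 B (limit_X B) (limit_F B) (limit_G B))" using inv[of m] by simp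
  qed
qed

definition restrict32 :: "fps3 \<Rightarrow> fps2" where
  "restrict32 F = Abs_fps (\<lambda>i. Abs_fps (\<lambda>j. coeff3 F i j 0))"

lemma coeff2_restrict32 [simp]: "coeff2 (restrict32 F) i j = coeff3 F i j 0"
  by (simp add: coeff2_def restrict32_def)

lemma fps2_eqI: "(\<And>i j. coeff2 f i j = coeff2 g i j) \<Longrightarrow> f = g"
  by (simp add: coeff2_def fps_eq_iff)

lemma coeff2_dx2 [simp]: "coeff2 (dx2 f) i j = real (Suc i) * coeff2 f (Suc i) j"
  by (simp only: coeff2_def dx2_def fps_deriv_nth fps_nth_of_nat_mult Suc_eq_plus1)

lemma coeff2_dy2 [simp]: "coeff2 (dy2 f) i j = real (Suc j) * coeff2 f i (Suc j)"
  by (simp only: coeff2_def dy2_def fps_nth_Abs_fps fps_deriv_nth fps_nth_of_nat_mult Suc_eq_plus1)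

lemma coeff2_mult: "coeff2 (f * g) a b = (\<Sum>i\<le>a. \<Sum>j\<le>b. coeff2 f i j * coeff2 g (a - i) (b - j))"
  by (simp add: coeff2_def fps_mult_nth fps_sum_nth atLeast0AtMost)

lemma restrict32_ring:
  "restrict32 (F * G) = restrict32 F * restrict32 G"
  "restrict32 (F - G) = restrict32 F - restrict32 G"
  "restrict32 (dx3 F) = dx2 (restrict32 F)" "restrict32 (dy3 F) = dy2 (restrict32 F)"
  "restrict32 0 = 0"
proof -
  show "restrict32 (F * G) = restrict32 F * restrict32 G"
    by (rule fps2_eqI) (simp add: coeff2_mult coeff3_mult)
  show "restrict32 (F - G) = restrict32 F - restrict32 G"
    by (rule fps2_eqI) (simp add: coeff2_def restrict32_def)
  show "restrict32 (dx3 F) = dx2 (restrict32 F)" "restrict32 (dy3 F) = dy2 (restrict32 F)"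
    by (rule fps2_eqI, simp)+
  show "restrict32 0 = 0" by (rule fps2_eqI) (simp add: coeff2_def restrict32_def)
qed

lemma lift23_dx2: "lift23 (dx2 f) = dx3 (lift23 f)" and lift23_dy2: "lift23 (dy2 f) = dy3 (lift23 f)"
  by (rule fps3_eqI, simp)+

lemma lift23_restrict32: assumes "dz3 F = 0" shows "lift23 (restrict32 F) = F"
proof (rule fps3_eqI)
  fix i j k
  have "coeff3 F i j (Suc n) = 0" for n
    using coeff3_dz3[of F i j n] by (simp add: assms del: of_nat_Suc)
  then show "coeff3 (lift23 (restrict32 F)) i j k = coeff3 F i j k" by (cases k) simp_all
qed

theorem formal_normal_form:
  assumes B: "B $ 1 = Z3" and J: "formal_jacobi B"
  defines "\<Phi> \<equiv> chart B (limit_X B)" and "f \<equiv> restrict32 (limit_F B)" and "g \<equiv> restrict32 (limit_G B)"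
  shows "formal_change \<Phi>" "formal_reduces \<Phi> B (formal_normal_form f g)"
    "coeff2 f 0 0 = 0" "coeff2 g 0 0 = 0" "dx2 f * dy2 g - dy2 f * dx2 g = 0"
proof -
  note lim = normal_form_limit[OF B J]
  have near: "near_identity \<Phi>" unfolding \<Phi>_def by (rule chart_near_identity[OF B lim(1)])
  note no = near_identity_no_constant_term[OF near]
  show "formal_change \<Phi>" by (rule near_identity_formal_change[OF near])
  show "coeff2 f 0 0 = 0" "coeff2 g 0 0 = 0"
    using vanishesD[OF lim(4), of 0 0 0] vanishesD[OF lim(5), of 0 0 0] by (simp_all add: f_def g_def)
  have \<Phi>: "\<Phi> $ 1 = limit_X B" "\<Phi> $ 2 = Y3" "\<Phi> $ 3 = third_coordinate B (limit_X B)"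
    by (simp_all add: \<Phi>_def chart_def)
  have lift: "lift23 f = limit_F B" "lift23 g = limit_G B"
    by (simp_all add: f_def g_def lift23_restrict32 lim)
  show "formal_reduces \<Phi> B (formal_normal_form f g)"
    using lim(6,7) unfolding residue2_def residue3_def \<Phi>_def[symmetric] \<Phi>(3)[symmetric]
    by (simp add: formal_reduces_def formal_normal_form_def fsubst_vars[OF no] fsubst_add fsubst_mult[OF no]
        lift23_dx2 lift23_dy2 lift \<Phi>(1,2) third_coordinate_def[symmetric] \<Phi>(3))
  let ?D = "dx3 (limit_F B) * dy3 (limit_G B) - dy3 (limit_F B) * dx3 (limit_G B)"
  have "fsubst ?D \<Phi> = fsubst 0 \<Phi>"
    using residues_jacobi_relation[OF B J lim(1,2,3)] vanishes_all[of 0 "fsubst ?D \<Phi>"]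
    by (simp add: lim(6,7) dx3_simps dy3_simps fsubst_0 \<Phi>_def)
  then have "?D = 0" by (rule near_identity_inj[OF near])
  from arg_cong[OF this, of restrict32]
  show "dx2 f * dy2 g - dy2 f * dx2 g = 0" by (simp add: restrict32_ring f_def g_def)
qed

section \<open>Smooth dependence on the parameter\<close>

text \<open>
  All operations of the construction compute each coefficient from finitely many coefficients of their
  arguments by sums and products, and so preserve this property.
\<close>

definition smooth3 :: "(real^'l) set \<Rightarrow> (real^'l \<Rightarrow> fps3) \<Rightarrow> bool" where
  "smooth3 E F \<longleftrightarrow> (\<forall>i j k. smooth_on E (\<lambda>\<epsilon>. coeff3 (F \<epsilon>) i j k))"

context
  fixes E :: "(real^'l) set" assumes E: "open E"
begin

lemma smooth3_const: "smooth3 E (\<lambda>\<epsilon>. F)"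
  by (simp add: smooth3_def smooth_on_const[OF E])

lemma smooth3_add: "smooth3 E F \<Longrightarrow> smooth3 E G \<Longrightarrow> smooth3 E (\<lambda>\<epsilon>. F \<epsilon> + G \<epsilon>)"
  and smooth3_diff: "smooth3 E F \<Longrightarrow> smooth3 E G \<Longrightarrow> smooth3 E (\<lambda>\<epsilon>. F \<epsilon> - G \<epsilon>)"
  by (simp_all add: smooth3_def smooth_on_add[OF E] smooth_on_diff[OF E])

lemma smooth3_mult: "smooth3 E F \<Longrightarrow> smooth3 E G \<Longrightarrow> smooth3 E (\<lambda>\<epsilon>. F \<epsilon> * G \<epsilon>)"
  unfolding smooth3_def coeff3_mult
  by (intro allI smooth_on_sum[OF E] smooth_on_mult[OF E]) auto

lemma smooth3_power: "smooth3 E F \<Longrightarrow> smooth3 E (\<lambda>\<epsilon>. F \<epsilon> ^ n)"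
  by (induction n) (simp_all add: smooth3_const smooth3_mult)

lemma smooth3_d3:
  assumes "smooth3 E F"
  shows "smooth3 E (\<lambda>\<epsilon>. dx3 (F \<epsilon>))" "smooth3 E (\<lambda>\<epsilon>. dy3 (F \<epsilon>))" "smooth3 E (\<lambda>\<epsilon>. dz3 (F \<epsilon>))"
  using assms by (simp_all add: smooth3_def smooth_on_mult[OF E] smooth_on_const[OF E])

lemma smooth3_formal_bracket:
  assumes "\<And>i. smooth3 E (\<lambda>\<epsilon>. B \<epsilon> $ i)" "smooth3 E F" "smooth3 E G"
  shows "smooth3 E (\<lambda>\<epsilon>. formal_bracket (B \<epsilon>) (F \<epsilon>) (G \<epsilon>))"
  unfolding formal_bracket_def
  by (intro smooth3_add smooth3_mult smooth3_diff smooth3_d3 assms)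

lemma smooth3_fsubst:
  assumes "\<And>i. smooth3 E (\<lambda>\<epsilon>. \<Phi> \<epsilon> $ i)" "smooth3 E F"
  shows "smooth3 E (\<lambda>\<epsilon>. fsubst (F \<epsilon>) (\<Phi> \<epsilon>))"
proof -
  have "smooth3 E (\<lambda>\<epsilon>. (\<Phi> \<epsilon> $ 1) ^ i * (\<Phi> \<epsilon> $ 2) ^ j * (\<Phi> \<epsilon> $ 3) ^ k)" for i j k
    by (intro smooth3_mult smooth3_power assms)
  then show ?thesis using assms(2)
    unfolding smooth3_def fsubst_def coeff3_series3
    by (intro allI smooth_on_sum[OF E] smooth_on_mult[OF E]) auto
qed

lemma smooth3_chart:
  assumes "\<And>i. smooth3 E (\<lambda>\<epsilon>. B \<epsilon> $ i)" "smooth3 E X"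
  shows "smooth3 E (\<lambda>\<epsilon>. third_coordinate (B \<epsilon>) (X \<epsilon>))" "smooth3 E (\<lambda>\<epsilon>. chart (B \<epsilon>) (X \<epsilon>) $ i)"
proof -
  show Z: "smooth3 E (\<lambda>\<epsilon>. third_coordinate (B \<epsilon>) (X \<epsilon>))"
    unfolding third_coordinate_def by (intro smooth3_formal_bracket assms smooth3_const)
  show "smooth3 E (\<lambda>\<epsilon>. chart (B \<epsilon>) (X \<epsilon>) $ i)"
    using exhaust_3[of i] Z assms(2) by (auto simp: chart_def smooth3_const)
qed

lemma smooth3_residues:
  assumes "\<And>i. smooth3 E (\<lambda>\<epsilon>. B \<epsilon> $ i)" "smooth3 E X" "smooth3 E F" "smooth3 E G"
  shows "smooth3 E (\<lambda>\<epsilon>. residue2 (B \<epsilon>) (X \<epsilon>) (F \<epsilon>) (G \<epsilon>))" "smooth3 E (\<lambda>\<epsilon>. residue3 (B \<epsilon>) (X \<epsilon>) (F \<epsilon>) (G \<epsilon>))"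
  unfolding residue2_def residue3_def
  by (intro smooth3_add smooth3_diff smooth3_mult smooth3_formal_bracket smooth3_fsubst smooth3_chart
      smooth3_d3 smooth3_const assms)+

lemma smooth_on_divide_const:
  "smooth_on E (\<lambda>\<epsilon>. h \<epsilon>) \<Longrightarrow> smooth_on E (\<lambda>\<epsilon>. h \<epsilon> / c)" for h :: "real^'l \<Rightarrow> real"
  using smooth_on_mult[OF E _ smooth_on_const[OF E], of h "inverse c"] by (simp add: divide_inverse)

lemma smooth3_increments:
  assumes "smooth3 E R" "smooth3 E S"
  shows "smooth3 E (\<lambda>\<epsilon>. primitive3 m (R \<epsilon>) (S \<epsilon>))" "smooth3 E (\<lambda>\<epsilon>. x_integral_z2 (R \<epsilon>))"
    "smooth3 E (\<lambda>\<epsilon>. z_coefficient n (R \<epsilon>))"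
proof -
  have R: "smooth_on E (\<lambda>\<epsilon>. coeff3 (R \<epsilon>) i j k)" and S: "smooth_on E (\<lambda>\<epsilon>. coeff3 (S \<epsilon>) i j k)" for i j k
    using assms by (simp_all add: smooth3_def)
  have cond: "smooth_on E (\<lambda>\<epsilon>. if b then h \<epsilon> else h' \<epsilon>)" if "smooth_on E h" "smooth_on E h'"
    for b and h h' :: "real^'l \<Rightarrow> real" using that by (cases b) simp_all
  show "smooth3 E (\<lambda>\<epsilon>. primitive3 m (R \<epsilon>) (S \<epsilon>))" "smooth3 E (\<lambda>\<epsilon>. x_integral_z2 (R \<epsilon>))"
    "smooth3 E (\<lambda>\<epsilon>. z_coefficient n (R \<epsilon>))"
    unfolding smooth3_def primitive3_def x_integral_z2_def z_coefficient_def coeff3_series3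
    by (intro allI cond smooth_on_divide_const R S smooth_on_const[OF E])+
qed

lemma smooth3_seq:
  assumes "\<And>i. smooth3 E (\<lambda>\<epsilon>. B \<epsilon> $ i)"
  shows "smooth3 E (\<lambda>\<epsilon>. seq_X (B \<epsilon>) m) \<and> smooth3 E (\<lambda>\<epsilon>. seq_F (B \<epsilon>) m) \<and> smooth3 E (\<lambda>\<epsilon>. seq_G (B \<epsilon>) m)"
proof (induction m)
  case 0
  show ?case by (simp add: seq_0 smooth3_const)
next
  case (Suc m)
  then have "smooth3 E (\<lambda>\<epsilon>. seq_P (B \<epsilon>) m)"
    unfolding seq_P_def by (intro smooth3_increments smooth3_residues assms) auto
  then show ?case using Suc by (auto simp: seq_Suc intro: smooth3_add smooth3_increments)
qed

lemma smooth3_limit: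
  assumes "\<And>i. smooth3 E (\<lambda>\<epsilon>. B \<epsilon> $ i)"
  shows "smooth3 E (\<lambda>\<epsilon>. limit_X (B \<epsilon>))" "smooth3 E (\<lambda>\<epsilon>. limit_F (B \<epsilon>))" "smooth3 E (\<lambda>\<epsilon>. limit_G (B \<epsilon>))"
  using smooth3_seq[OF assms] by (auto simp: smooth3_def limit_X_def limit_F_def limit_G_def adic_limit_def)

end

section \<open>Partial derivatives\<close>

lemma partial_eqI: "(f has_derivative D) (at p) \<Longrightarrow> partial i f p = D (axis i 1)"
  unfolding partial_def using frechet_derivative_at by metis

lemma partial_cong:
  assumes "open S" "p \<in> S" "\<And>q. q \<in> S \<Longrightarrow> f q = g q" shows "partial i f p = partial i g p"
  using frechet_derivative_cong[OF assms] by (simp add: partial_def)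

lemma smooth_on_partial: "smooth_on S f \<Longrightarrow> smooth_on S (partial i f)"
  using smooth_on_frechet_derivative[of S f "axis i 1"] by (simp add: partial_def[abs_def])

lemma partial_add:
  assumes "smooth_on S f" "smooth_on S g" "p \<in> S"
  shows "partial i (\<lambda>q. f q + g q) p = partial i f p + partial i g p"
  unfolding partial_def[of _ f] partial_def[of _ g]
  by (rule partial_eqI, rule has_derivative_add) (use assms smooth_on_has_derivative in auto)

lemma partial_diff:
  assumes "smooth_on S f" "smooth_on S g" "p \<in> S"
  shows "partial i (\<lambda>q. f q - g q) p = partial i f p - partial i g p"
  unfolding partial_def[of _ f] partial_def[of _ g]
  by (rule partial_eqI, rule has_derivative_diff) (use assms smooth_on_has_derivative in auto)

lemma partial_mult:
  assumes "smooth_on S f" "smooth_on S g" "p \<in> S"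
  shows "partial i (\<lambda>q. f q * g q) p = f p * partial i g p + partial i f p * g p"
  unfolding partial_def[of _ f] partial_def[of _ g]
  by (rule partial_eqI, rule has_derivative_mult) (use assms smooth_on_has_derivative in auto)

lemma partial_const [simp]: "partial i (\<lambda>q. c) p = 0"
  using partial_eqI[OF has_derivative_const] by simp

lemma partial_inner [simp]: "partial i (\<lambda>q. a \<bullet> q) p = a $ i"
proof -
  have "((\<lambda>q. a \<bullet> q) has_derivative (\<lambda>q. a \<bullet> q)) (at p)"
    by (rule bounded_linear_imp_has_derivative) (rule bounded_linear_inner_right)
  from partial_eqI[OF this] show ?thesis by (simp add: inner_axis)
qed

lemma partial_coordinate [simp]: "partial i (\<lambda>q. q $ j) p = (if i = j then 1 else 0)"
  using partial_eqI[OF bounded_linear_imp_has_derivative[OF bounded_linear_vec_nth[of j]], of i p]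
  by (simp add: axis_def)

lemma smooth_on_coordinate: "open S \<Longrightarrow> smooth_on S (\<lambda>q::real^3. q $ j)"
  by (rule smooth_on_linear[OF _ bounded_linear_vec_nth])

lemma partial_commute:
  assumes "open S" "p \<in> S" "smooth_on S f"
  shows "partial i (partial j f) p = partial j (partial i f) p"
  using second_derivative_symmetric[OF assms] by (simp add: partial_def[abs_def])

lemma partial_compose:
  fixes \<phi> :: "real^3 \<Rightarrow> real^3"
  assumes "smooth_on S \<phi>" "p \<in> S" "smooth_on T f" "\<phi> p \<in> T" "open S"
  shows "partial i (\<lambda>q. f (\<phi> q)) p =
    partial 1 f (\<phi> p) * partial i (\<lambda>q. \<phi> q $ 1) p + partial 2 f (\<phi> p) * partial i (\<lambda>q. \<phi> q $ 2) p
    + partial 3 f (\<phi> p) * partial i (\<lambda>q. \<phi> q $ 3) p"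
proof -
  let ?D = "frechet_derivative \<phi> (at p)" and ?L = "frechet_derivative f (at (\<phi> p))"
  note \<phi>' = smooth_on_has_derivative[OF assms(1,2)]
  note f' = smooth_on_has_derivative[OF assms(3,4)]
  have comp: "partial i (\<lambda>q. \<phi> q $ j) p = ?D (axis i 1) $ j" for j
    by (rule partial_eqI) (rule bounded_linear.has_derivative[OF bounded_linear_vec_nth \<phi>'])
  have lin: "?L w = partial 1 f (\<phi> p) * w $ 1 + partial 2 f (\<phi> p) * w $ 2 + partial 3 f (\<phi> p) * w $ 3" for w
  proof -
    have w: "w = w $ 1 *\<^sub>R axis 1 1 + w $ 2 *\<^sub>R axis 2 1 + w $ 3 *\<^sub>R axis 3 1"
      by (simp add: vec_eq_iff forall_3 axis_def)
    have "?L w = ?L (w $ 1 *\<^sub>R axis 1 1 + w $ 2 *\<^sub>R axis 2 1 + w $ 3 *\<^sub>R axis 3 1)"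
      using w by (rule arg_cong)
    also have "\<dots> = w $ 1 *\<^sub>R ?L (axis 1 1) + w $ 2 *\<^sub>R ?L (axis 2 1) + w $ 3 *\<^sub>R ?L (axis 3 1)"
      using has_derivative_linear[OF f'] by (simp only: linear_add linear_cmul)
    finally show ?thesis by (simp add: partial_def)
  qed
  have "partial i (\<lambda>q. f (\<phi> q)) p = ?L (?D (axis i 1))"
    by (rule partial_eqI) (rule has_derivative_compose[OF \<phi>' f'])
  then show ?thesis by (simp add: lin comp)
qed

section \<open>Poisson brackets\<close>

lemma bracket_eq_bracket3:
  "bracket P f g p = bracket3 (P p $ 1) (P p $ 2) (P p $ 3) (partial 1 f p) (partial 2 f p) (partial 3 f p)
    (partial 1 g p) (partial 2 g p) (partial 3 g p)"
  by (simp add: bracket_def bracket3_def)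

lemma bracket_cong:
  assumes "open S" "p \<in> S" "\<And>q. q \<in> S \<Longrightarrow> f q = f' q" "\<And>q. q \<in> S \<Longrightarrow> g q = g' q"
  shows "bracket P f g p = bracket P f' g' p"
  using partial_cong[OF assms(1,2), of f f'] partial_cong[OF assms(1,2), of g g'] assms(3,4)
  by (simp add: bracket_def)

lemma smooth_on_bracket:
  assumes "open S" "smooth_on S P" "smooth_on S f" "smooth_on S g"
  shows "smooth_on S (bracket P f g)"
  unfolding bracket_def[abs_def]
  by (intro smooth_on_add smooth_on_diff smooth_on_mult smooth_on_partial smooth_on_component assms)

lemma partial_bracket:
  assumes S: "open S" "p \<in> S" and sm: "smooth_on S P" "smooth_on S f" "smooth_on S g"
  shows "partial i (bracket P f g) p = bracket3_deriv (P p $ 1) (P p $ 2) (P p $ 3)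
     (partial i (\<lambda>q. P q $ 1) p) (partial i (\<lambda>q. P q $ 2) p) (partial i (\<lambda>q. P q $ 3) p)
     (partial 1 f p) (partial 2 f p) (partial 3 f p)
     (partial i (partial 1 f) p) (partial i (partial 2 f) p) (partial i (partial 3 f) p)
     (partial 1 g p) (partial 2 g p) (partial 3 g p)
     (partial i (partial 1 g) p) (partial i (partial 2 g) p) (partial i (partial 3 g) p)"
proof -
  have m: "partial i (\<lambda>q. u q * (v q * w q - v' q * w' q)) p =
     u p * ((v p * partial i w p + partial i v p * w p) - (v' p * partial i w' p + partial i v' p * w' p))
     + partial i u p * (v p * w p - v' p * w' p)"
    if "smooth_on S u" "smooth_on S v" "smooth_on S w" "smooth_on S v'" "smooth_on S w'" for u v w v' w'
    by (simp add: that S partial_mult[of S] partial_diff[of S] smooth_on_mult smooth_on_diff)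
  have add: "partial i (\<lambda>q. u q + v q + w q) p = partial i u p + partial i v p + partial i w p"
    if "smooth_on S u" "smooth_on S v" "smooth_on S w" for u v w
    by (simp add: that S partial_add[of S] smooth_on_add)
  define t where "t j a b = (\<lambda>q. P q $ j * (partial a f q * partial b g q - partial b f q * partial a g q))" for j a b
  have t: "partial i (t j a b) p =
     P p $ j * ((partial a f p * partial i (partial b g) p + partial i (partial a f) p * partial b g p)
     - (partial b f p * partial i (partial a g) p + partial i (partial b f) p * partial a g p))
     + partial i (\<lambda>q. P q $ j) p * (partial a f p * partial b g p - partial b f p * partial a g p)" for j a b
    unfolding t_def by (rule m) (intro smooth_on_partial smooth_on_component S sm)+
  have sm_t: "smooth_on S (t j a b)" for j a b unfolding t_def
    by (intro smooth_on_mult smooth_on_diff smooth_on_partial smooth_on_component S sm)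
  have "bracket P f g = (\<lambda>q. t 1 1 2 q + t 2 2 3 q + t 3 3 1 q)"
    by (simp add: fun_eq_iff bracket_def t_def)
  then have "partial i (bracket P f g) p = partial i (t 1 1 2) p + partial i (t 2 2 3) p + partial i (t 3 3 1) p"
    by (simp add: add sm_t)
  then show ?thesis unfolding t by (simp add: bracket3_deriv_def bracket3_def algebra_simps)
qed

text \<open>
  The function \<open>W \<bullet> curl W\<close>.
\<close>

definition curl_defect :: "bivector_field \<Rightarrow> real^3 \<Rightarrow> real" where
  "curl_defect P p = P p $ 1 * (partial 1 (\<lambda>q. P q $ 3) p - partial 2 (\<lambda>q. P q $ 2) p)
     + P p $ 2 * (partial 2 (\<lambda>q. P q $ 1) p - partial 3 (\<lambda>q. P q $ 3) p)
     + P p $ 3 * (partial 3 (\<lambda>q. P q $ 2) p - partial 1 (\<lambda>q. P q $ 1) p)"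

lemma jacobi_from_curl_defect:
  assumes S: "open S" "p \<in> S" and P: "smooth_on S P"
    and sm: "smooth_on S f" "smooth_on S g" "smooth_on S h" and 0: "curl_defect P p = 0"
  shows "bracket P f (bracket P g h) p + bracket P g (bracket P h f) p + bracket P h (bracket P f g) p = 0"
proof -
  have c: "partial 2 (partial 1 k) p = partial 1 (partial 2 k) p"
    "partial 3 (partial 1 k) p = partial 1 (partial 3 k) p"
    "partial 3 (partial 2 k) p = partial 2 (partial 3 k) p" if "smooth_on S k" for k
    using partial_commute[OF S that] by auto
  note c = c[OF sm(1)] c[OF sm(2)] c[OF sm(3)]
  note pb = partial_bracket[OF S P]
  have 0: "- (P p $ 1 * (partial 1 (\<lambda>q. P q $ 3) p - partial 2 (\<lambda>q. P q $ 2) p)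
     + P p $ 2 * (partial 2 (\<lambda>q. P q $ 1) p - partial 3 (\<lambda>q. P q $ 3) p)
     + P p $ 3 * (partial 3 (\<lambda>q. P q $ 2) p - partial 1 (\<lambda>q. P q $ 1) p)) = 0"
    using 0 by (simp add: curl_defect_def)
  show ?thesis
    unfolding bracket_eq_bracket3[of P f "bracket P g h"] bracket_eq_bracket3[of P g "bracket P h f"]
      bracket_eq_bracket3[of P h "bracket P f g"] pb[OF sm(1,2)] pb[OF sm(2,3)] pb[OF sm(3,1)] c jacobiator_eq 0
    by simp
qed

text \<open>
  The Jacobi identity for the three coordinate functions alone already gives \<open>W \<bullet> curl W = 0\<close>. This
  pointwise criterion makes it possible to test with functions that are smooth only on a smaller set.
\<close>

lemma poisson_on_iff_curl_defect:
  assumes S: "open S"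
  shows "poisson_on S P \<longleftrightarrow> smooth_on S P \<and> (\<forall>p\<in>S. curl_defect P p = 0)"
proof
  assume P: "poisson_on S P"
  have "curl_defect P p = 0" if "p \<in> S" for p
  proof -
    let ?c = "\<lambda>j q. q $ j :: real"
    have "bracket P (?c 1) (bracket P (?c 2) (?c 3)) p + bracket P (?c 2) (bracket P (?c 3) (?c 1)) p
       + bracket P (?c 3) (bracket P (?c 1) (?c 2)) p = 0"
      using P smooth_on_coordinate[OF S] that by (simp add: poisson_on_def)
    moreover have "bracket P (?c 2) (?c 3) = (\<lambda>q. P q $ 2)" "bracket P (?c 3) (?c 1) = (\<lambda>q. P q $ 3)"
      "bracket P (?c 1) (?c 2) = (\<lambda>q. P q $ 1)"
      by (simp_all add: bracket_def fun_eq_iff)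
    ultimately show ?thesis by (simp add: bracket_def curl_defect_def algebra_simps)
  qed
  then show "smooth_on S P \<and> (\<forall>p\<in>S. curl_defect P p = 0)" using P by (simp add: poisson_on_def)
next
  assume "smooth_on S P \<and> (\<forall>p\<in>S. curl_defect P p = 0)"
  then show "poisson_on S P" unfolding poisson_on_def using jacobi_from_curl_defect[OF S] by blast
qed

lemma bracket_pushforward:
  assumes S: "open S" "p \<in> S" and \<phi>: "smooth_on S \<phi>" and T: "\<phi> p \<in> T"
    and fg: "smooth_on T f" "smooth_on T g" and Q: "Q (\<phi> p) = pushforward_at \<phi> P p"
  shows "bracket Q f g (\<phi> p) = bracket P (\<lambda>q. f (\<phi> q)) (\<lambda>q. g (\<phi> q)) p"
  unfolding bracket_def[of Q] bracket_def[of P] Q pushforward_at_def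
    partial_compose[OF \<phi> S(2) fg(1) T S(1)] partial_compose[OF \<phi> S(2) fg(2) T S(1)]
  by (simp add: bracket_def algebra_simps)

section \<open>Taylor series\<close>

lemma smooth_on_partial_power: "smooth_on S f \<Longrightarrow> smooth_on S ((partial i ^^ n) f)"
  by (induction n) (auto intro: smooth_on_partial)

lemma partial_power_cong:
  assumes "open S" "p \<in> S" "\<And>q. q \<in> S \<Longrightarrow> f q = g q"
  shows "(partial i ^^ n) f p = (partial i ^^ n) g p"
  using assms(2)
proof (induction n arbitrary: p)
  case (Suc n)
  show ?case using partial_cong[OF assms(1) Suc.prems, of "(partial i ^^ n) f" "(partial i ^^ n) g"] Suc.IH
    by simp
qed (simp add: assms(3))

lemma partial_power_commute:
  assumes "open S" "p \<in> S" and f: "smooth_on S f"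
  shows "partial i ((partial j ^^ n) f) p = (partial j ^^ n) (partial i f) p"
  using assms(2)
proof (induction n arbitrary: p)
  case (Suc n)
  have "partial i ((partial j ^^ Suc n) f) p = partial j (partial i ((partial j ^^ n) f)) p"
    using partial_commute[OF assms(1) Suc.prems smooth_on_partial_power[OF f]] by simp
  also have "\<dots> = partial j ((partial j ^^ n) (partial i f)) p"
    by (rule partial_cong[OF assms(1) Suc.prems Suc.IH])
  finally show ?case by simp
qed simp

lemma partial_power_const: "(partial a ^^ n) (\<lambda>q. c) = (\<lambda>q. if n = 0 then c else 0)"
proof (induction n)
  case (Suc n)
  show ?case unfolding funpow.simps o_def Suc by (simp add: fun_eq_iff)
qed simp

context
  fixes S :: "(real^3) set" assumes S: "open S" "0 \<in> S"
begin

lemma taylor_cong: "(\<And>q. q \<in> S \<Longrightarrow> f q = g q) \<Longrightarrow> taylor f = taylor g"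
proof -
  assume "\<And>q. q \<in> S \<Longrightarrow> f q = g q"
  then have "(partial 1 ^^ i) ((partial 2 ^^ j) ((partial 3 ^^ k) f)) 0 =
    (partial 1 ^^ i) ((partial 2 ^^ j) ((partial 3 ^^ k) g)) 0" for i j k
    by (intro partial_power_cong[OF S(1)] S(2))
  then show ?thesis by (simp add: taylor_def)
qed

lemma taylor_partial:
  assumes f: "smooth_on S f"
  shows "dx3 (taylor f) = taylor (partial 1 f)" "dy3 (taylor f) = taylor (partial 2 f)"
    "dz3 (taylor f) = taylor (partial 3 f)"
proof -
  have fact: "real (Suc n) * (x / (fact (Suc n) * y)) = x / (fact n * y)" for n x and y :: real
    by (simp add: field_simps del: of_nat_Suc)
  note sm = smooth_on_partial_power[OF f] smooth_on_partial_power[OF smooth_on_partial_power[OF f]]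
  have x: "(partial 1 ^^ Suc i) ((partial 2 ^^ j) ((partial 3 ^^ k) f)) 0 =
     (partial 1 ^^ i) ((partial 2 ^^ j) ((partial 3 ^^ k) (partial 1 f))) 0" for i j k
  proof -
    have "(partial 1 ^^ i) (partial 1 ((partial 2 ^^ j) ((partial 3 ^^ k) f))) 0 =
      (partial 1 ^^ i) ((partial 2 ^^ j) (partial 1 ((partial 3 ^^ k) f))) 0"
      by (rule partial_power_cong[OF S partial_power_commute[OF S(1)]]) (auto intro: sm)
    also have "\<dots> = (partial 1 ^^ i) ((partial 2 ^^ j) ((partial 3 ^^ k) (partial 1 f))) 0"
      by (intro partial_power_cong[OF S(1)] S(2) partial_power_commute[OF S(1) _ f])
    finally show ?thesis by (simp add: funpow_swap1)
  qed
  have y: "(partial 1 ^^ i) ((partial 2 ^^ Suc j) ((partial 3 ^^ k) f)) 0 =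
     (partial 1 ^^ i) ((partial 2 ^^ j) ((partial 3 ^^ k) (partial 2 f))) 0" for i j k
  proof -
    have "(partial 1 ^^ i) ((partial 2 ^^ j) (partial 2 ((partial 3 ^^ k) f))) 0 =
      (partial 1 ^^ i) ((partial 2 ^^ j) ((partial 3 ^^ k) (partial 2 f))) 0"
      by (intro partial_power_cong[OF S(1)] S(2) partial_power_commute[OF S(1) _ f])
    then show ?thesis by (simp add: funpow_swap1)
  qed
  show "dx3 (taylor f) = taylor (partial 1 f)" 
    by (rule fps3_eqI) (simp only: coeff3_dx3 taylor_def coeff3_series3 x fact mult.assoc)
  show "dy3 (taylor f) = taylor (partial 2 f)"
    by (rule fps3_eqI)
      (simp only: coeff3_dy3 taylor_def coeff3_series3 y fact mult.assoc mult.left_commute[of "fact _" "fact (Suc _)"],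
       simp add: mult_ac)
  show "dz3 (taylor f) = taylor (partial 3 f)"
    by (rule fps3_eqI) (simp add: taylor_def funpow_swap1 field_simps del: of_nat_Suc)
qed

lemma taylor_add:
  assumes "smooth_on S f" "smooth_on S g"
  shows "taylor (\<lambda>q. f q + g q) = taylor f + taylor g"
proof -
  have p: "(partial i ^^ n) (\<lambda>q. f q + g q) p = (partial i ^^ n) f p + (partial i ^^ n) g p"
    if "p \<in> S" "smooth_on S f" "smooth_on S g" for i n p f g
    using that(1)
  proof (induction n arbitrary: p)
    case (Suc n)
    then show ?case
      using partial_cong[OF S(1) Suc.prems, of "(partial i ^^ n) (\<lambda>q. f q + g q)"
          "\<lambda>q. (partial i ^^ n) f q + (partial i ^^ n) g q"] that(2,3)
      by (simp add: partial_add[of S] smooth_on_partial_power)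
  qed simp
  have "(partial 1 ^^ i) ((partial 2 ^^ j) ((partial 3 ^^ k) (\<lambda>q. f q + g q))) 0 =
    (partial 1 ^^ i) ((partial 2 ^^ j) ((partial 3 ^^ k) f)) 0 +
    (partial 1 ^^ i) ((partial 2 ^^ j) ((partial 3 ^^ k) g)) 0" for i j k
  proof -
    have "(partial 1 ^^ i) ((partial 2 ^^ j) ((partial 3 ^^ k) (\<lambda>q. f q + g q))) 0 =
      (partial 1 ^^ i) ((partial 2 ^^ j) (\<lambda>q. (partial 3 ^^ k) f q + (partial 3 ^^ k) g q)) 0"
      by (intro partial_power_cong[OF S(1)] S(2) p assms)
    also have "\<dots> = (partial 1 ^^ i) (\<lambda>q. (partial 2 ^^ j) ((partial 3 ^^ k) f) q +
        (partial 2 ^^ j) ((partial 3 ^^ k) g) q) 0"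
      by (intro partial_power_cong[OF S(1)] S(2) p assms smooth_on_partial_power)
    also have "\<dots> = (partial 1 ^^ i) ((partial 2 ^^ j) ((partial 3 ^^ k) f)) 0 +
      (partial 1 ^^ i) ((partial 2 ^^ j) ((partial 3 ^^ k) g)) 0"
      by (intro p S(2) assms smooth_on_partial_power)
    finally show ?thesis .
  qed
  then show ?thesis by (intro fps3_eqI) (simp add: taylor_def add_divide_distrib)
qed

text \<open>
  A coefficient of positive degree is determined by those of the first partial derivatives, so by
  induction on the degree the product formula reduces to the Leibniz rule.
\<close>

lemma taylor_mult:
  assumes "smooth_on S f" "smooth_on S g"
  shows "taylor (\<lambda>q. f q * g q) = taylor f * taylor g"
proof -
  have deriv: "taylor (partial a (\<lambda>q. f q * g q)) =
      taylor (\<lambda>q. f q * partial a g q) + taylor (\<lambda>q. partial a f q * g q)"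
    if "smooth_on S f" "smooth_on S g" for a f g
  proof -
    have "taylor (partial a (\<lambda>q. f q * g q)) = taylor (\<lambda>q. f q * partial a g q + partial a f q * g q)"
      by (rule taylor_cong) (rule partial_mult[OF that])
    also have "\<dots> = taylor (\<lambda>q. f q * partial a g q) + taylor (\<lambda>q. partial a f q * g q)"
      by (intro taylor_add smooth_on_mult S(1) that smooth_on_partial)
    finally show ?thesis .
  qed
  have "coeff3 (taylor (\<lambda>q. f q * g q)) i j k = coeff3 (taylor f * taylor g) i j k" for i j k
    using assms
  proof (induction "i + j + k" arbitrary: i j k f g)
    case 0
    then show ?case by (simp add: taylor_def coeff3_mult)
  next
    case (Suc n)
    note fg = Suc.prems
    note fgm = smooth_on_mult[OF S(1) fg]
    note IH = Suc.hyps(1)[OF _ fg(1) smooth_on_partial[OF fg(2)]]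
      Suc.hyps(1)[OF _ smooth_on_partial[OF fg(1)] fg(2)]
    consider i' where "i = Suc i'" | j' where "j = Suc j'" | k' where "k = Suc k'"
      using Suc.hyps(2) by (cases i; cases j; cases k) auto
    then show ?case
    proof cases
      case 1
      have "coeff3 (dx3 (taylor (\<lambda>q. f q * g q))) i' j k = coeff3 (dx3 (taylor f * taylor g)) i' j k"
        using Suc.hyps(2) 1 IH[of i' j k]
        by (simp add: taylor_partial[OF fgm] deriv[OF fg] dx3_simps(2) taylor_partial[OF fg(1)]
            taylor_partial[OF fg(2)] del: coeff3_dx3)
      then show ?thesis using 1 by (simp del: of_nat_Suc)
    next
      case 2
      have "coeff3 (dy3 (taylor (\<lambda>q. f q * g q))) i j' k = coeff3 (dy3 (taylor f * taylor g)) i j' k"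
        using Suc.hyps(2) 2 IH[of i j' k]
        by (simp add: taylor_partial[OF fgm] deriv[OF fg] dy3_simps(2) taylor_partial[OF fg(1)]
            taylor_partial[OF fg(2)] del: coeff3_dy3)
      then show ?thesis using 2 by (simp del: of_nat_Suc)
    next
      case 3
      have "coeff3 (dz3 (taylor (\<lambda>q. f q * g q))) i j k' = coeff3 (dz3 (taylor f * taylor g)) i j k'"
        using Suc.hyps(2) 3 IH[of i j k']
        by (simp add: taylor_partial[OF fgm] deriv[OF fg] dz3_simps(2) taylor_partial[OF fg(1)]
            taylor_partial[OF fg(2)] del: coeff3_dz3)
      then show ?thesis using 3 by (simp del: of_nat_Suc)
    qed
  qed
  then show ?thesis by (rule fps3_eqI)
qed

lemma taylor_0: "taylor (\<lambda>q. 0) = 0"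
  by (rule fps3_eqI) (simp add: taylor_def partial_power_const)

lemma taylor_diff:
  assumes "smooth_on S f" "smooth_on S g"
  shows "taylor (\<lambda>q. f q - g q) = taylor f - taylor g"
  using taylor_add[OF smooth_on_diff[OF S(1) assms] assms(2)] by simp

lemma taylor_z: "taylor (\<lambda>q. q $ 3) = Z3"
proof (rule fps3_eqI)
  have z: "(partial a ^^ n) (\<lambda>q. q $ 3) = (if n = 0 then (\<lambda>q. q $ 3) else
      (\<lambda>q. if n = 1 \<and> a = 3 then 1 else 0))" for a n
  proof (induction n)
    case (Suc n)
    show ?case unfolding funpow.simps o_def Suc by (auto simp: fun_eq_iff)
  qed simp
  show "coeff3 (taylor (\<lambda>q. q $ 3)) i j k = coeff3 Z3 i j k" for i j k
    unfolding Z3_mon coeff3_mon3 taylor_def coeff3_series3 z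
    by (cases "k = 0"; cases "k = 1"; cases "j = 0") (auto simp: partial_power_const z)
qed

text \<open>
  Taylor expansion at the origin is a ring homomorphism commuting with the partial derivatives; apply it
  to \<open>W \<bullet> curl W = 0\<close>.
\<close>

lemma formal_jacobi_taylor:
  assumes P: "poisson_on S P" shows "formal_jacobi (taylor_bivector P)"
proof -
  have sm: "smooth_on S (\<lambda>q. P q $ m)" for m
    using P by (intro smooth_on_component S(1)) (simp add: poisson_on_def)
  note part = taylor_partial[OF sm]
  note smp = smooth_on_partial[OF sm]
  have "taylor (\<lambda>p. P p $ 1 * (partial 1 (\<lambda>q. P q $ 3) p - partial 2 (\<lambda>q. P q $ 2) p)
     + P p $ 2 * (partial 2 (\<lambda>q. P q $ 1) p - partial 3 (\<lambda>q. P q $ 3) p)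
     + P p $ 3 * (partial 3 (\<lambda>q. P q $ 2) p - partial 1 (\<lambda>q. P q $ 1) p)) = taylor (\<lambda>p. 0)"
    using P unfolding poisson_on_iff_curl_defect[OF S(1)] curl_defect_def by (intro taylor_cong) simp
  then show ?thesis
    by (simp add: taylor_0 formal_jacobi_def taylor_bivector_def part taylor_add taylor_mult taylor_diff
        smooth_on_add[OF S(1)] smooth_on_mult[OF S(1)] smooth_on_diff[OF S(1)] sm smp)
qed

end

section \<open>Families of functions and structures\<close>

lemma smooth_on_slice:
  assumes "open E" "open S" "smooth_on (E \<times> S) (\<lambda>(\<epsilon>, p). F \<epsilon> p)" "\<epsilon> \<in> E"
  shows "smooth_on S (F \<epsilon>)"
  using smooth_on_compose[OF assms(2,3), of "\<lambda>p. (\<epsilon>, p)"] assms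
  by (simp add: smooth_on_Pair smooth_on_const smooth_on_linear bounded_linear_ident)

lemma smooth_on_family_partial:
  fixes F :: "real^'l \<Rightarrow> real^3 \<Rightarrow> real"
  assumes "open E" "open S" and F: "smooth_on (E \<times> S) (\<lambda>(\<epsilon>, p). F \<epsilon> p)"
  shows "smooth_on (E \<times> S) (\<lambda>(\<epsilon>, p). partial i (F \<epsilon>) p)"
proof (rule smooth_on_cong[OF open_Times[OF assms(1,2)] _ smooth_on_frechet_derivative[OF F]])
  fix y assume "y \<in> E \<times> S"
  then obtain \<epsilon> p where y: "y = (\<epsilon>, p)" "\<epsilon> \<in> E" "p \<in> S" by auto
  have "((\<lambda>p. (\<epsilon>, p)) has_derivative (\<lambda>v. (0, v))) (at p)"
    by (intro has_derivative_Pair has_derivative_const has_derivative_ident)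
  from has_derivative_compose[OF this smooth_on_has_derivative[OF F, of "(\<epsilon>, p)"]]
  have "(F \<epsilon> has_derivative (\<lambda>v. frechet_derivative (\<lambda>(\<epsilon>, p). F \<epsilon> p) (at (\<epsilon>, p)) (0, v))) (at p)"
    using y by simp
  from partial_eqI[OF this]
  show "frechet_derivative (\<lambda>(\<epsilon>, p). F \<epsilon> p) (at y) (0, axis i 1) = (case y of (\<epsilon>, p) \<Rightarrow> partial i (F \<epsilon>) p)"
    using y by simp
qed

lemma smooth_on_family_bracket:
  fixes F G :: "real^'l \<Rightarrow> real^3 \<Rightarrow> real"
  assumes "open E" "open S" and "smooth_on (E \<times> S) (\<lambda>(\<epsilon>, p). P \<epsilon> p)"
    and "smooth_on (E \<times> S) (\<lambda>(\<epsilon>, p). F \<epsilon> p)" "smooth_on (E \<times> S) (\<lambda>(\<epsilon>, p). G \<epsilon> p)"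
  shows "smooth_on (E \<times> S) (\<lambda>(\<epsilon>, p). bracket (P \<epsilon>) (F \<epsilon>) (G \<epsilon>) p)"
proof -
  note op = open_Times[OF assms(1,2)]
  have "smooth_on (E \<times> S) (\<lambda>(\<epsilon>, p). P \<epsilon> p $ j)" for j
    using smooth_on_component[OF op assms(3)] by (simp add: split_beta')
  note facts = this[unfolded split_beta'] smooth_on_family_partial[OF assms(1,2,4), unfolded split_beta']
    smooth_on_family_partial[OF assms(1,2,5), unfolded split_beta']
  show ?thesis unfolding bracket_def split_beta'
    by (intro smooth_on_add smooth_on_diff smooth_on_mult op facts)
qed

lemma smooth_coefficients_taylor:
  fixes F :: "real^'l \<Rightarrow> real^3 \<Rightarrow> real"
  assumes "open E" "open S" "0 \<in> S" and F: "smooth_on (E \<times> S) (\<lambda>(\<epsilon>, p). F \<epsilon> p)"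
  shows "smooth_on E (\<lambda>\<epsilon>. coeff3 (taylor (F \<epsilon>)) i j k)"
proof -
  have pow: "smooth_on (E \<times> S) (\<lambda>(\<epsilon>, p). (partial a ^^ n) (G \<epsilon>) p)"
    if "smooth_on (E \<times> S) (\<lambda>(\<epsilon>, p). G \<epsilon> p)" for a n and G :: "real^'l \<Rightarrow> real^3 \<Rightarrow> real"
    by (induction n) (simp_all add: that smooth_on_family_partial[OF assms(1,2)])
  have "smooth_on (E \<times> S) (\<lambda>(\<epsilon>, p). (partial 1 ^^ i) ((partial 2 ^^ j) ((partial 3 ^^ k) (F \<epsilon>))) p)"
    by (intro pow F)
  from smooth_on_compose[OF assms(1) this, of "\<lambda>\<epsilon>. (\<epsilon>, 0)"]
  have "smooth_on E (\<lambda>\<epsilon>. (partial 1 ^^ i) ((partial 2 ^^ j) ((partial 3 ^^ k) (F \<epsilon>))) 0)"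
    using assms by (simp add: smooth_on_Pair smooth_on_const smooth_on_linear bounded_linear_ident)
  then show ?thesis
    unfolding taylor_def coeff3_series3 by (rule smooth_on_divide_const[OF assms(1)])
qed

section \<open>Linear Poisson structures\<close>

unbundle cross3_syntax

lemma exists_orthogonal3: 
  fixes m :: "real^3" obtains a where "a \<noteq> 0" "a \<bullet> m = 0"
proof (cases "m $ 1 = 0 \<and> m $ 2 = 0")
  case True
  then show ?thesis using that[of "axis 1 1"] by (simp add: inner_axis' axis_eq_0_iff)
next
  case False
  let ?a = "vector [- (m $ 2), m $ 1, 0] :: real^3"
  have "?a \<noteq> 0" using False by (auto simp: vec_eq_iff forall_3)
  moreover have "?a \<bullet> m = 0" by (simp add: inner_vec_def sum_3)
  ultimately show ?thesis using that by blast
qed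

lemma cross3_double: "x \<times> (y \<times> z) = (x \<bullet> z) *\<^sub>R y - (x \<bullet> y) *\<^sub>R z" for x y z :: "real^3"
  by (simp add: cross3_simps forall_3)

lemma cross3_dot_cross3: "(x \<times> y) \<bullet> (z \<times> w) = (x \<bullet> z) * (y \<bullet> w) - (x \<bullet> w) * (y \<bullet> z)" for x y z w :: "real^3"
  by (simp add: cross3_simps)

lemma orthogonal_expansion3:
  fixes a b w :: "real^3"
  assumes ab: "a \<bullet> b = 0" and nz: "a \<noteq> 0" "b \<noteq> 0"
  shows "w = ((a \<bullet> w) / (a \<bullet> a)) *\<^sub>R a + ((b \<bullet> w) / (b \<bullet> b)) *\<^sub>R b
     + (((a \<times> b) \<bullet> w) / ((a \<times> b) \<bullet> (a \<times> b))) *\<^sub>R (a \<times> b)"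
proof -
  let ?c = "a \<times> b"
  have cc: "?c \<bullet> ?c = (a \<bullet> a) * (b \<bullet> b)" using ab by (simp add: cross3_dot_cross3 inner_commute)
  then have c: "?c \<noteq> 0" using nz by (metis inner_eq_zero_iff mult_eq_0_iff)
  have orth: "a \<bullet> ?c = 0" "b \<bullet> ?c = 0" "b \<bullet> a = 0" "?c \<bullet> a = 0" "?c \<bullet> b = 0"
    using ab by (simp_all add: dot_cross_self inner_commute)
  define x where "x = w - (((a \<bullet> w) / (a \<bullet> a)) *\<^sub>R a + ((b \<bullet> w) / (b \<bullet> b)) *\<^sub>R b + ((?c \<bullet> w) / (?c \<bullet> ?c)) *\<^sub>R ?c)"
  have x: "a \<bullet> x = 0" "b \<bullet> x = 0" "?c \<bullet> x = 0"
    unfolding x_def using nz c by (simp_all add: inner_diff_right inner_add_right ab orth)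
  have "x \<times> ?c = 0" using x by (simp add: cross3_double inner_commute)
  moreover have "x \<bullet> ?c = 0" using x by (simp add: inner_commute)
  ultimately have "x = 0" using norm_and_cross_eq_0[of x ?c] c by auto
  then show ?thesis by (simp add: x_def)
qed

lemma exists_cross3_factors:
  fixes c :: "real^3" assumes "c \<noteq> 0"
  obtains a b where "a \<noteq> 0" "b \<noteq> 0" "a \<bullet> b = 0" "a \<times> b = c"
proof -
  obtain a where a: "a \<noteq> 0" "a \<bullet> c = 0" using exists_orthogonal3 by blast
  define b where "b = (1 / (a \<bullet> a)) *\<^sub>R (c \<times> a)"
  have ab: "a \<times> b = c" using a by (simp add: b_def cross_mult_right cross3_double)
  moreover have "a \<bullet> b = 0" by (simp add: b_def dot_cross_self)
  moreover have "b \<noteq> 0" using ab assms by auto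
  ultimately show ?thesis using that a by blast
qed

text \<open>
  The vector \<open>W\<close> of the value of a bivector field; the stored order \<open>({x,y}, {y,z}, {z,x})\<close> is rotated.
\<close>

definition coefficient_field :: "real^3 \<Rightarrow> real^3" where
  "coefficient_field w = vector [w $ 2, w $ 3, w $ 1]"

lemma coefficient_field_inner: "coefficient_field w \<bullet> c = w $ 1 * c $ 3 + w $ 2 * c $ 1 + w $ 3 * c $ 2"
  by (simp add: coefficient_field_def inner_vec_def sum_3)

lemma bracket_inner: "bracket P (\<lambda>q. a \<bullet> q) (\<lambda>q. b \<bullet> q) p = coefficient_field (P p) \<bullet> (a \<times> b)"
  by (simp add: bracket_def coefficient_field_inner cross3_def algebra_simps)

text \<open>
  For \<open>W p = m \<times> p\<close> the bracket of linear functions is \<open>{u, v} = (u \<times> v) \<times> m\<close>. With \<open>a \<bullet> m = 0\<close>,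
  \<open>b = m \<times> a\<close> and \<open>c = -m / (m \<bullet> m)\<close> this gives \<open>{a,b} = 0\<close>, \<open>{b,c} = b\<close>, \<open>{c,a} = -a\<close>.
\<close>

lemma linear_isomorphic_exceptional:
  assumes m: "m \<noteq> 0" and P: "\<And>p. coefficient_field (P p) = m \<times> p"
  shows "linear_isomorphic P exceptional_structure"
proof -
  obtain a where a: "a \<noteq> 0" "a \<bullet> m = 0" using exists_orthogonal3 by blast
  define b where "b = m \<times> a"
  define c where "c = (- 1 / (m \<bullet> m)) *\<^sub>R m"
  have mm: "m \<bullet> m \<noteq> 0" using m by simp
  have orth: "b \<bullet> m = 0" "a \<bullet> b = 0" by (simp_all add: b_def dot_cross_self)
  have ab: "a \<times> b = (a \<bullet> a) *\<^sub>R m" using a(2) by (simp add: b_def cross3_double)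
  have b0: "b \<noteq> 0"
  proof
    assume "b = 0"
    then show False using ab a(1) m by simp
  qed
  define A where "A p = (vector [a \<bullet> p, b \<bullet> p, c \<bullet> p] :: real^3)" for p
  have lin: "linear A"
    by (rule linearI) (simp_all add: A_def vec_eq_iff forall_3 inner_add_right)
  have "p = 0" if "A p = 0" for p
  proof -
    have 0: "a \<bullet> p = 0" "b \<bullet> p = 0" "c \<bullet> p = 0" using that by (auto simp: A_def vec_eq_iff forall_3)
    then have "m \<bullet> p = 0" using mm by (simp add: c_def)
    then show ?thesis using orthogonal_expansion3[OF orth(2) a(1) b0, of p] 0 by (simp add: ab)
  qed
  then have "inj A" using lin linear_injective_0 by blast
  then have "bij A" using linear_injective_imp_surjective[OF lin] by (simp add: bij_def)
  moreover have "exceptional_structure (A p) = pushforward_at A P p" for p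
  proof -
    have 1: "(m \<times> p) \<bullet> (a \<times> b) = 0" by (simp add: ab dot_cross_self)
    have 2: "(m \<times> p) \<bullet> (b \<times> c) = b \<bullet> p"
      using mm orth by (simp add: cross3_dot_cross3 c_def inner_commute)
    have 3: "(m \<times> p) \<bullet> (c \<times> a) = - (a \<bullet> p)"
      using mm a(2) by (simp add: cross3_dot_cross3 c_def inner_commute)
    show ?thesis
      by (simp add: pushforward_at_def A_def bracket_inner P exceptional_structure_def 1 2 3)
  qed
  ultimately show ?thesis using lin unfolding linear_isomorphic_def by blast
qed

text \<open>
  A matrix with vanishing quadratic form is antisymmetric, and antisymmetric matrices in three
  dimensions are cross products; \<open>m\<close> is read off from the images of the standard basis.
\<close>

lemma antisymmetric_coefficient_field:
  fixes D :: "real^3 \<Rightarrow> real^3"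
  assumes lin: "linear D" and anti: "\<And>c. coefficient_field (D c) \<bullet> c = 0"
  obtains m where "\<And>p. coefficient_field (D p) = m \<times> p"
proof -
  have 2: "coefficient_field (D c) \<bullet> d + coefficient_field (D d) \<bullet> c = 0" for c d
    using anti[of "c + d"] anti[of c] anti[of d]
    by (simp add: linear_add[OF lin] coefficient_field_inner algebra_simps)
  define e where "e i = (axis i 1 :: real^3)" for i
  have e: "e i $ j = (if i = j then 1 else 0)" for i j by (auto simp: e_def axis_def)
  define m where "m = (vector [D (e 2) $ 1, D (e 3) $ 2, D (e 1) $ 3] :: real^3)"
  have Dp: "D p = p $ 1 *\<^sub>R D (e 1) + p $ 2 *\<^sub>R D (e 2) + p $ 3 *\<^sub>R D (e 3)" for p
  proof -
    have "p = p $ 1 *\<^sub>R e 1 + p $ 2 *\<^sub>R e 2 + p $ 3 *\<^sub>R e 3"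
      by (simp add: vec_eq_iff forall_3 e)
    then have "D p = D (p $ 1 *\<^sub>R e 1 + p $ 2 *\<^sub>R e 2 + p $ 3 *\<^sub>R e 3)" by (rule arg_cong)
    then show ?thesis by (simp only: linear_add[OF lin] linear_cmul[OF lin])
  qed
  have rel: "D (e 1) $ 2 = 0" "D (e 2) $ 3 = 0" "D (e 3) $ 1 = 0"
    "D (e 1) $ 1 = - D (e 3) $ 2" "D (e 2) $ 2 = - D (e 1) $ 3" "D (e 3) $ 3 = - D (e 2) $ 1"
    using anti[of "e 1"] anti[of "e 2"] anti[of "e 3"] 2[of "e 1" "e 3"] 2[of "e 1" "e 2"] 2[of "e 2" "e 3"]
    by (simp_all add: coefficient_field_inner e)
  have "coefficient_field (D p) = m \<times> p" for p
    by (simp add: vec_eq_iff forall_3 coefficient_field_def cross3_def m_def Dp[of p] rel)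
  then show ?thesis using that by blast
qed

unbundle no cross3_syntax

section \<open>Straightening one bracket\<close>

text \<open>
  The inverse function theorem gives a differentiable local inverse \<open>g\<close>. Its smoothness is a bootstrap:
  the parameter and two of the three space directions are inverted explicitly, and solving
  \<open>D\<theta>(g y) w = v\<close> for the remaining component in direction \<open>a \<times> b\<close> is a division by the transverse
  derivative of \<open>F\<close>. Thus the derivative of \<open>g\<close> is a \<open>C^k\<close> expression in \<open>g\<close> whenever \<open>g\<close> is \<open>C^k\<close>.
\<close>

lemma smooth_inverse_straightening:
  fixes F :: "(real^'l) \<times> (real^3) \<Rightarrow> real" and a b :: "real^3"
  defines "\<theta> \<equiv> \<lambda>(\<epsilon>, p). (\<epsilon>, vector [a \<bullet> p, b \<bullet> p, F (\<epsilon>, p)] :: real^3)"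
  assumes U: "open U" "x0 \<in> U" and F: "smooth_on U F"
    and ab: "a \<noteq> 0" "b \<noteq> 0" "a \<bullet> b = 0"
    and transverse: "frechet_derivative F (at x0) (0, cross3 a b) \<noteq> 0"
  obtains U' V g where "open U'" "U' \<subseteq> U" "x0 \<in> U'" "open V" "\<theta> x0 \<in> V"
    "homeomorphism U' V \<theta> g" "smooth_on V g" "smooth_on U \<theta>"
proof -
  let ?F = "\<lambda>x. frechet_derivative F (at x)" and ?c = "cross3 a b"
  have F': "(F has_derivative ?F x) (at x)" if "x \<in> U" for x
    using smooth_on_has_derivative[OF F that] .
  have \<theta>_eq: "\<theta> = (\<lambda>x. (fst x, vector [a \<bullet> snd x, b \<bullet> snd x, F x]))"
    by (simp add: \<theta>_def split_beta')
  have sm\<theta>: "smooth_on U \<theta>"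
    unfolding \<theta>_eq
  proof (rule smooth_on_Pair[OF U(1) smooth_on_linear[OF U(1) bounded_linear_fst] smooth_on_vec[OF U(1)]])
    have "smooth_on U (\<lambda>x. d \<bullet> snd x)" for d :: "real^3"
      by (rule smooth_on_linear[OF U(1)]) 
        (rule bounded_linear_compose[OF bounded_linear_inner_right bounded_linear_snd])
    then show "smooth_on U (\<lambda>x. vector [a \<bullet> snd x, b \<bullet> snd x, F x] $ i)" for i :: 3
      using exhaust_3[of i] F by auto
  qed
  define \<theta>' where "\<theta>' x v = (fst v, vector [a \<bullet> snd v, b \<bullet> snd v, ?F x v] :: real^3)" for x v
  have d\<theta>: "(\<theta> has_derivative \<theta>' x) (at x)" if "x \<in> U" for x
  proof -
    have "((\<lambda>x. vector [a \<bullet> snd x, b \<bullet> snd x, F x] :: real^3) has_derivative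
        (\<lambda>v. vector [a \<bullet> snd v, b \<bullet> snd v, ?F x v])) (at x)"
    proof (subst has_derivative_componentwise_within, intro ballI)
      fix i :: "real^3" assume "i \<in> Basis"
      then obtain j where j: "i = axis j 1" by (auto simp: Basis_vec_def)
      have inner: "((\<lambda>x. d \<bullet> snd x) has_derivative (\<lambda>v. d \<bullet> snd v)) (at x)" for d :: "real^3"
        by (rule bounded_linear_imp_has_derivative)
          (rule bounded_linear_compose[OF bounded_linear_inner_right bounded_linear_snd])
      show "((\<lambda>x. vector [a \<bullet> snd x, b \<bullet> snd x, F x] \<bullet> i) has_derivative
          (\<lambda>v. vector [a \<bullet> snd v, b \<bullet> snd v, ?F x v] \<bullet> i)) (at x)"
        using exhaust_3[of j] inner F'[OF that] by (auto simp: j inner_axis)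
    qed
    then show ?thesis unfolding \<theta>_eq \<theta>'_def[abs_def]
      by (intro has_derivative_Pair has_derivative_fst has_derivative_ident)
  qed
  define B where "B x = Blinfun (\<theta>' x)" for x
  have B: "blinfun_apply (B x) = \<theta>' x" if "x \<in> U" for x
    unfolding B_def using has_derivative_bounded_linear[OF d\<theta>[OF that]] by (rule bounded_linear_Blinfun_apply)
  have contB: "continuous_on U B"
  proof (rule continuous_on_blinfun_componentwise)
    fix v :: "(real^'l) \<times> (real^3)"
    have "smooth_on U (\<lambda>x. frechet_derivative \<theta> (at x) v)" by (rule smooth_on_frechet_derivative[OF sm\<theta>])
    then have "continuous_on U (\<lambda>x. frechet_derivative \<theta> (at x) v)" by (metis Ck_on.simps(1) smooth_on_def)
    then show "continuous_on U (\<lambda>x. blinfun_apply (B x) v)"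
      by (rule continuous_on_cong[THEN iffD1, OF refl, rotated])
        (use B frechet_derivative_at[OF d\<theta>] in metis)
  qed
  have lin\<theta>: "linear (\<theta>' x)" if "x \<in> U" for x using has_derivative_linear[OF d\<theta>[OF that]] .
  have "inj (\<theta>' x0)"
    unfolding linear_injective_0[OF lin\<theta>[OF U(2)]]
  proof (intro allI impI)
    fix v assume v: "\<theta>' x0 v = 0"
    then have 0: "fst v = 0" "a \<bullet> snd v = 0" "b \<bullet> snd v = 0" "?F x0 v = 0"
      by (simp_all add: \<theta>'_def zero_prod_def vec_eq_iff forall_3)
    define t where "t = (?c \<bullet> snd v) / (?c \<bullet> ?c)"
    have s: "snd v = t *\<^sub>R ?c" using orthogonal_expansion3[OF ab(3,1,2), of "snd v"] 0 by (simp add: t_def)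
    then have v': "v = t *\<^sub>R (0, ?c)" using 0(1) by (simp add: prod_eq_iff)
    have "?F x0 v = t * ?F x0 (0, ?c)"
      unfolding v' using linear_cmul[OF has_derivative_linear[OF F'[OF U(2)]], of t "(0, ?c)"] by simp
    then have "t = 0" using 0(4) transverse by simp
    then show "v = 0" using v' by (simp add: zero_prod_def)
  qed
  from linear_injective_left_inverse[OF lin\<theta>[OF U(2)] this]
  obtain h where h: "linear h" "h \<circ> \<theta>' x0 = id" by blast
  have invf: "Blinfun h o\<^sub>L B x0 = id_blinfun"
    using fun_cong[OF h(2)] by (intro blinfun_eqI)
      (simp add: bounded_linear_Blinfun_apply linear_conv_bounded_linear[THEN iffD1, OF h(1)] B[OF U(2)] 
        del: split_paired_All)
  have dB: "(\<theta> has_derivative blinfun_apply (B x)) (at x)" if "x \<in> U" for x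
    using d\<theta>[OF that] B[OF that] by simp
  obtain U' V g g' where inv: "open U'" "U' \<subseteq> U" "x0 \<in> U'" "open V" "\<theta> x0 \<in> V" "homeomorphism U' V \<theta> g"
    "\<And>y. y \<in> V \<Longrightarrow> (g has_derivative (g' y)) (at y)"
    "\<And>y. y \<in> V \<Longrightarrow> g' y = inv (blinfun_apply (B (g y)))"
    "\<And>y. y \<in> V \<Longrightarrow> bij (blinfun_apply (B (g y)))"
    using inverse_function_theorem[OF U(1) dB contB U(2) invf] by metis
  have gU: "g y \<in> U" if "y \<in> V" for y
    using inv(2) homeomorphism_image2[OF inv(6)] that by blast
  define L where "L r = ((r $ 1) / (a \<bullet> a)) *\<^sub>R a + ((r $ 2) / (b \<bullet> b)) *\<^sub>R b" for r :: "real^3"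
  define G where "G y v = (fst v, L (snd v) + ((snd v $ 3 - ?F (g y) (fst v, L (snd v))) *
       inverse (?F (g y) (0, ?c))) *\<^sub>R ?c)" for y v
  \<comment> \<open>Otherwise the derivative of \<open>\<theta>\<close>, invertible on the image of \<open>g\<close>, would kill \<open>(0, a \<times> b)\<close>.\<close>
  have nonzero: "?F (g y) (0, ?c) \<noteq> 0" if y: "y \<in> V" for y
  proof
    assume "?F (g y) (0, ?c) = 0"
    then have "\<theta>' (g y) (0, ?c) = \<theta>' (g y) 0"
      using linear_0[OF has_derivative_linear[OF F'[OF gU[OF y]]]]
      by (simp add: \<theta>'_def dot_cross_self zero_prod_def vec_eq_iff forall_3)
    moreover have "inj (\<theta>' (g y))" using inv(9)[OF y] B[OF gU[OF y]] by (simp add: bij_def)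
    ultimately have "((0, ?c) :: (real^'l) \<times> (real^3)) = 0" by (rule injD[rotated])
    then have "?c = 0" by (simp add: zero_prod_def)
    then have "(a \<bullet> a) * (b \<bullet> b) = 0" using cross3_dot_cross3[of a b a b] ab by (simp add: inner_commute)
    then show False using ab by simp
  qed
  have g'_eq: "g' y v = G y v" if y: "y \<in> V" for y v
  proof -
    define w where "w = g' y v"
    have "\<theta>' (g y) w = v"
      using inv(8)[OF y] inv(9)[OF y] B[OF gU[OF y]] by (simp add: w_def bij_is_surj surj_f_inv_f)
    then have w: "fst w = fst v" "a \<bullet> snd w = snd v $ 1" "b \<bullet> snd w = snd v $ 2" "?F (g y) w = snd v $ 3"
      by (auto simp: \<theta>'_def)
    \<comment> \<open>The only component of \<open>w\<close> not determined by \<open>v\<close> alone; it is found from the \<open>F\<close>-component.\<close>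
    define t where "t = (?c \<bullet> snd w) / (?c \<bullet> ?c)"
    have s: "snd w = L (snd v) + t *\<^sub>R ?c"
      using orthogonal_expansion3[OF ab(3,1,2), of "snd w"] w by (simp add: t_def L_def)
    have w_eq: "w = (fst v, L (snd v)) + t *\<^sub>R (0, ?c)" using s w(1) by (simp add: prod_eq_iff)
    have "?F (g y) w = ?F (g y) (fst v, L (snd v)) + t * ?F (g y) (0, ?c)"
      unfolding w_eq using has_derivative_linear[OF F'[OF gU[OF y]]] by (simp only: linear_add linear_cmul real_scaleR_def)
    then have "t = (snd v $ 3 - ?F (g y) (fst v, L (snd v))) * inverse (?F (g y) (0, ?c))"
      using w(4) nonzero[OF y] by (simp add: field_simps)
    then show ?thesis using w_eq by (simp add: w_def G_def prod_eq_iff)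
  qed
  have "Ck_on k V g" for k
  proof (induction k)
    case 0
    show ?case using homeomorphism_cont2[OF inv(6)] by simp
  next
    case (Suc k)
    have sF: "Ck_on k V (\<lambda>y. ?F (g y) v)" for v
      by (rule Ck_on_compose[OF inv(4) _ Suc gU])
        (use smooth_on_frechet_derivative[OF F] in \<open>simp_all add: smooth_on_def\<close>)
    show ?case
    proof (rule Ck_on_SucI[OF inv(4) inv(7)])
      fix v
      have "Ck_on k V (\<lambda>y. G y v)" unfolding G_def
        by (intro Ck_on_Pair Ck_on_const Ck_on_add Ck_on_diff inv(4) sF nonzero Ck_on_inverse
            Ck_on_bilinear[OF inv(4) bounded_bilinear_scaleR] Ck_on_bilinear[OF inv(4) bounded_bilinear_mult])
      then show "Ck_on k V (\<lambda>y. g' y v)"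
        by (rule Ck_on_cong[OF inv(4), rotated]) (simp add: g'_eq)
    qed
  qed
  then have "smooth_on V g" by (simp add: smooth_on_def)
  then show ?thesis using that[of U' V g] inv(1-6) sm\<theta> by blast
qed

section \<open>Normal forms of Poisson families\<close>

text \<open>
  If the quadratic form of the linear part vanished identically, that part would be \<open>p \<mapsto> m \<times> p\<close>, so
  zero or isomorphic to the exceptional structure.
\<close>

lemma transverse_direction:
  assumes P0: "P 0 = 0" and P: "smooth_on S P" "0 \<in> S"
    and nz: "jet1 P \<noteq> (\<lambda>p. 0)" and nonexc: "\<not> linear_isomorphic (jet1 P) exceptional_structure"
  obtains c where "c \<noteq> 0" "coefficient_field (frechet_derivative P (at 0) c) \<bullet> c \<noteq> 0"
proof -
  let ?D = "frechet_derivative P (at 0)"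
  have jet: "jet1 P = ?D" by (simp add: jet1_def P0)
  have lin: "linear ?D" using has_derivative_linear[OF smooth_on_has_derivative[OF P]] .
  have "\<exists>c. coefficient_field (?D c) \<bullet> c \<noteq> 0"
  proof (rule ccontr)
    assume "\<not> ?thesis"
    then obtain m where m: "\<And>p. coefficient_field (?D p) = cross3 m p"
      using antisymmetric_coefficient_field[OF lin] by metis
    show False
    proof (cases "m = 0")
      case True
      have "?D p = 0" for p
        using m[of p] True by (simp add: vec_eq_iff forall_3 coefficient_field_def)
      then show False using nz by (auto simp: jet)
    next
      case False
      then show False using linear_isomorphic_exceptional[OF False, of ?D] m nonexc by (simp add: jet)
    qed
  qed
  then obtain c where c: "coefficient_field (?D c) \<bullet> c \<noteq> 0" by blast
  then have "c \<noteq> 0" by auto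
  then show ?thesis using c that by blast
qed

text \<open>
  The pulled-back functions are smooth only near \<open>p\<close>, so the Jacobi identity of \<open>P\<close> enters through its
  pointwise form.
\<close>

lemma jacobi_pushforward:
  assumes S: "open S" "p \<in> S" and P: "smooth_on S P" "\<And>q. q \<in> S \<Longrightarrow> curl_defect P q = 0"
    and \<phi>: "smooth_on S \<phi>" and T: "open T" "smooth_on T Q" "\<And>q. q \<in> S \<Longrightarrow> \<phi> q \<in> T"
    and Q: "\<And>q. q \<in> S \<Longrightarrow> Q (\<phi> q) = pushforward_at \<phi> P q"
    and fgh: "smooth_on T f" "smooth_on T g" "smooth_on T h"
  shows "bracket Q f (bracket Q g h) (\<phi> p) + bracket Q g (bracket Q h f) (\<phi> p)
     + bracket Q h (bracket Q f g) (\<phi> p) = 0"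
proof -
  have pull: "smooth_on S (\<lambda>q. k (\<phi> q))" if "smooth_on T k" for k :: "real^3 \<Rightarrow> real"
    by (rule smooth_on_compose[OF S(1) that \<phi> T(3)])
  have double: "bracket Q u (bracket Q v w) (\<phi> p) =
      bracket P (\<lambda>q. u (\<phi> q)) (bracket P (\<lambda>q. v (\<phi> q)) (\<lambda>q. w (\<phi> q))) p"
    if "smooth_on T u" "smooth_on T v" "smooth_on T w" for u v w
  proof -
    have "bracket Q u (bracket Q v w) (\<phi> p) = bracket P (\<lambda>q. u (\<phi> q)) (\<lambda>q. bracket Q v w (\<phi> q)) p"
      by (rule bracket_pushforward[where Q = Q and \<phi> = \<phi>, OF S \<phi> T(3)[OF S(2)] that(1) _ Q[OF S(2)]])
        (intro smooth_on_bracket T that)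
    also have "\<dots> = bracket P (\<lambda>q. u (\<phi> q)) (bracket P (\<lambda>q. v (\<phi> q)) (\<lambda>q. w (\<phi> q))) p"
      by (rule bracket_cong[OF S]) (use bracket_pushforward[where Q = Q and \<phi> = \<phi>, OF S(1) _ \<phi> T(3) that(2,3) Q] in auto)
    finally show ?thesis .
  qed
  show ?thesis
    using jacobi_from_curl_defect[OF S P(1) pull pull pull P(2)[OF S(2)], OF fgh] by (simp add: double fgh)
qed

text \<open>
  The new coordinates are \<open>X = a \<bullet> p\<close>, \<open>Y = b \<bullet> p\<close> and \<open>Z = {X,Y}\<close>, where \<open>a \<times> b\<close> is a transverse
  direction. The target family is defined through the inverse map \<open>\<psi>\<close>, and is meaningful on the image
  \<open>T\<close> of a product neighbourhood; as \<open>T\<close> is open, it contains a product \<open>E2 \<times> S2\<close> on which all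
  requirements hold uniformly in \<open>\<epsilon>\<close>.
\<close>

theorem straightening:
  fixes P :: "real^'l \<Rightarrow> bivector_field"
  assumes "local_poisson_family P" and P0: "P 0 0 = 0" and nz: "jet1 (P 0) \<noteq> (\<lambda>p. 0)"
    and nonexc: "\<not> linear_isomorphic (jet1 (P 0)) exceptional_structure"
  obtains U V where "local_poisson_family (\<lambda>\<epsilon> p. vector [p $ 3, U \<epsilon> p, V \<epsilon> p])"
    "equivalent_families P (\<lambda>\<epsilon> p. vector [p $ 3, U \<epsilon> p, V \<epsilon> p])"
proof -
  obtain E S where E: "open E" "0 \<in> E" and S: "open S" "0 \<in> S"
    and smP: "smooth_on (E \<times> S) (\<lambda>(\<epsilon>, p). P \<epsilon> p)" and poisson: "\<And>\<epsilon>. \<epsilon> \<in> E \<Longrightarrow> poisson_on S (P \<epsilon>)"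
    using assms(1) unfolding local_poisson_family_def by blast
  note ES = open_Times[OF E(1) S(1)]
  have x0: "(0, 0) \<in> E \<times> S" using E S by simp
  have smP0: "smooth_on S (P 0)" by (rule smooth_on_slice[OF E(1) S(1) smP E(2)])
  obtain c where c: "c \<noteq> 0" "coefficient_field (frechet_derivative (P 0) (at 0) c) \<bullet> c \<noteq> 0"
    using transverse_direction[OF P0 smP0 S(2) nz nonexc] by blast
  obtain a b where ab: "a \<noteq> 0" "b \<noteq> 0" "a \<bullet> b = 0" "cross3 a b = c"
    using exists_cross3_factors[OF c(1)] by blast
  define X where "X = (\<lambda>q::real^3. a \<bullet> q)"
  define Y where "Y = (\<lambda>q::real^3. b \<bullet> q)"
  define Z where "Z \<epsilon> = bracket (P \<epsilon>) X Y" for \<epsilon>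
  have Z: "Z \<epsilon> p = coefficient_field (P \<epsilon> p) \<bullet> c" for \<epsilon> p
    by (simp add: Z_def X_def Y_def bracket_inner ab)
  define F where "F = (\<lambda>(\<epsilon>, p). Z \<epsilon> p)"
  have sm_lin: "smooth_on (E' \<times> S') (\<lambda>(\<epsilon>, q). d \<bullet> q)" if "open E'" "open S'"
    for d and E' :: "(real^'l) set" and S' :: "(real^3) set"
    unfolding split_beta'
    by (intro smooth_on_linear open_Times that bounded_linear_compose[OF bounded_linear_inner_right bounded_linear_snd])
  have smXY: "smooth_on (E \<times> S) (\<lambda>(\<epsilon>, q). X q)" "smooth_on (E \<times> S) (\<lambda>(\<epsilon>, q). Y q)"
    using sm_lin[OF E(1) S(1)] by (simp_all add: X_def Y_def)
  have smF: "smooth_on (E \<times> S) F"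
    unfolding F_def Z_def by (rule smooth_on_family_bracket[OF E(1) S(1) smP smXY])
  have "frechet_derivative F (at (0, 0)) (0, c) = coefficient_field (frechet_derivative (P 0) (at 0) c) \<bullet> c"
  proof -
    have 1: "((\<lambda>p. coefficient_field (P 0 p) \<bullet> c) has_derivative
        (\<lambda>v. coefficient_field (frechet_derivative (P 0) (at 0) v) \<bullet> c)) (at 0)"
      unfolding coefficient_field_inner
      by (intro has_derivative_add has_derivative_mult_left
          bounded_linear.has_derivative[OF bounded_linear_vec_nth] smooth_on_has_derivative[OF smP0 S(2)])
    have "((\<lambda>p. (0, p)) has_derivative (\<lambda>v. (0, v))) (at 0)"
      by (intro has_derivative_Pair has_derivative_const has_derivative_ident)
    from has_derivative_compose[OF this smooth_on_has_derivative[OF smF x0]]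
    have 2: "((\<lambda>p. coefficient_field (P 0 p) \<bullet> c) has_derivative
        (\<lambda>v. frechet_derivative F (at (0, 0)) (0, v))) (at 0)"
      by (simp add: F_def Z)
    show ?thesis using has_derivative_unique[OF 1 2] by metis
  qed
  then have trans: "frechet_derivative F (at (0, 0)) (0, cross3 a b) \<noteq> 0" using c ab by simp
  define \<theta> where "\<theta> = (\<lambda>(\<epsilon>, p). (\<epsilon>, vector [a \<bullet> p, b \<bullet> p, F (\<epsilon>, p)] :: real^3))"
  obtain U' V g where UV: "open U'" "U' \<subseteq> E \<times> S" "(0, 0) \<in> U'" "open V" "\<theta> (0, 0) \<in> V"
    and hom: "homeomorphism U' V \<theta> g" and smg: "smooth_on V g" and sm\<theta>: "smooth_on (E \<times> S) \<theta>"
    unfolding \<theta>_def by (rule smooth_inverse_straightening[OF ES x0 smF ab(1-3) trans])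
  obtain E1 S1 where E1: "open E1" "0 \<in> E1" and S1: "open S1" "0 \<in> S1" and ES1: "E1 \<times> S1 \<subseteq> U'"
    using open_prod_elim[OF UV(1,3)] by (metis mem_Sigma_iff)
  have sub: "E1 \<subseteq> E" "S1 \<subseteq> S" using ES1 UV(2) E1(2) S1(2) by blast+
  note ES1o = open_Times[OF E1(1) S1(1)]
  define \<phi> where "\<phi> \<epsilon> p = snd (\<theta> (\<epsilon>, p))" for \<epsilon> p
  have \<theta>: "\<theta> (\<epsilon>, p) = (\<epsilon>, \<phi> \<epsilon> p)" for \<epsilon> p by (simp add: \<phi>_def \<theta>_def)
  have \<phi>_comp: "\<phi> \<epsilon> q $ 1 = X q" "\<phi> \<epsilon> q $ 2 = Y q" "\<phi> \<epsilon> q $ 3 = Z \<epsilon> q" for \<epsilon> q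
    by (simp_all add: \<phi>_def \<theta>_def X_def Y_def F_def)
  have \<phi>0: "\<phi> 0 0 = 0"
    by (simp add: vec_eq_iff forall_3 \<phi>_comp X_def Y_def Z P0 coefficient_field_inner)
  define T where "T = \<theta> ` (E1 \<times> S1)"
  have T: "T = V \<inter> g -` (E1 \<times> S1)"
    using hom ES1 by (auto simp: T_def homeomorphism_def)
  have openT: "open T" unfolding T
    by (rule continuous_open_preimage[OF homeomorphism_cont2[OF hom] UV(4) ES1o])
  have T0: "(0, 0) \<in> T" unfolding T_def by (rule image_eqI[of _ _ "(0, 0)"]) (use E1 S1 in \<open>simp_all add: \<theta> \<phi>0\<close>)
  have TV: "T \<subseteq> V" using T by blast
  obtain E2 S2 where E2: "open E2" "0 \<in> E2" and S2: "open S2" "0 \<in> S2" and ES2: "E2 \<times> S2 \<subseteq> T"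
    using open_prod_elim[OF openT T0] by (metis mem_Sigma_iff)
  define \<psi> where "\<psi> \<epsilon> q = snd (g (\<epsilon>, q))" for \<epsilon> q
  have g\<theta>: "g (\<theta> x) = x" if "x \<in> E1 \<times> S1" for x
    using homeomorphism_apply1[OF hom] ES1 that by blast
  have \<psi>\<phi>: "\<psi> \<epsilon> (\<phi> \<epsilon> p) = p" if "\<epsilon> \<in> E1" "p \<in> S1" for \<epsilon> p
    using g\<theta>[of "(\<epsilon>, p)"] that by (simp add: \<psi>_def \<theta>)
  have inT: "\<exists>p\<in>S1. q = \<phi> \<epsilon> p \<and> \<epsilon> \<in> E1" if "(\<epsilon>, q) \<in> T" for \<epsilon> q
    using that by (auto simp: T_def \<theta>)
  define yz where "yz \<epsilon> q = bracket (P \<epsilon>) Y (Z \<epsilon>) (\<psi> \<epsilon> q)" for \<epsilon> q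
  define zx where "zx \<epsilon> q = bracket (P \<epsilon>) (Z \<epsilon>) X (\<psi> \<epsilon> q)" for \<epsilon> q
  define Q where "Q = (\<lambda>\<epsilon> p. vector [p $ 3, yz \<epsilon> p, zx \<epsilon> p] :: real^3)"
  have push: "Q \<epsilon> (\<phi> \<epsilon> p) = pushforward_at (\<phi> \<epsilon>) (P \<epsilon>) p" if "\<epsilon> \<in> E1" "p \<in> S1" for \<epsilon> p
    by (simp add: Q_def pushforward_at_def \<phi>_comp yz_def zx_def \<psi>\<phi>[OF that] Z_def)
  have pull_back: "smooth_on (E' \<times> S') (\<lambda>(\<epsilon>, q). k (\<epsilon>, \<psi> \<epsilon> q) :: real)"
    if k: "smooth_on (E1 \<times> S1) k" and "open E'" "open S'" and sub': "E' \<times> S' \<subseteq> T" for k E' S'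
  proof (rule smooth_on_cong[OF open_Times[OF that(2,3)]])
    show "smooth_on (E' \<times> S') (\<lambda>x. k (g x))"
      by (rule smooth_on_compose[OF open_Times[OF that(2,3)] k smooth_on_subset[OF smg]])
        (use sub' T in blast)+
    show "k (g x) = (case x of (\<epsilon>, q) \<Rightarrow> k (\<epsilon>, \<psi> \<epsilon> q))" if x: "x \<in> E' \<times> S'" for x
    proof -
      obtain \<epsilon> q where xe: "x = (\<epsilon>, q)" by (cases x)
      then obtain p where "p \<in> S1" "q = \<phi> \<epsilon> p" "\<epsilon> \<in> E1" using inT sub' x by blast
      then show ?thesis using g\<theta>[of "(\<epsilon>, p)"] by (simp add: xe \<theta> \<psi>_def)
    qed
  qed
  have smP1: "smooth_on (E1 \<times> S1) (\<lambda>(\<epsilon>, p). P \<epsilon> p)" by (rule smooth_on_subset[OF smP]) (use sub in auto)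
  have smXY1: "smooth_on (E1 \<times> S1) (\<lambda>(\<epsilon>, q). X q)" "smooth_on (E1 \<times> S1) (\<lambda>(\<epsilon>, q). Y q)"
    using sm_lin[OF E1(1) S1(1)] by (simp_all add: X_def Y_def)
  have smZ1: "smooth_on (E1 \<times> S1) (\<lambda>(\<epsilon>, q). Z \<epsilon> q)"
    using smooth_on_subset[OF smF, of "E1 \<times> S1"] sub by (auto simp: F_def)
  have smQ: "smooth_on (E2 \<times> S2) (\<lambda>(\<epsilon>, q). Q \<epsilon> q)"
  proof (rule smooth_on_vec[OF open_Times[OF E2(1) S2(1)]])
    fix i :: 3
    have 1: "smooth_on (E2 \<times> S2) (\<lambda>(\<epsilon>, q). q $ 3)"
      unfolding split_beta' by (intro smooth_on_linear open_Times E2(1) S2(1)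
          bounded_linear_compose[OF bounded_linear_vec_nth bounded_linear_snd])
    have 2: "smooth_on (E2 \<times> S2) (\<lambda>(\<epsilon>, q). yz \<epsilon> q)"
      using pull_back[OF smooth_on_family_bracket[OF E1(1) S1(1) smP1 smXY1(2) smZ1] E2(1) S2(1) ES2]
      by (simp add: yz_def)
    have 3: "smooth_on (E2 \<times> S2) (\<lambda>(\<epsilon>, q). zx \<epsilon> q)"
      using pull_back[OF smooth_on_family_bracket[OF E1(1) S1(1) smP1 smZ1 smXY1(1)] E2(1) S2(1) ES2]
      by (simp add: zx_def)
    show "smooth_on (E2 \<times> S2) (\<lambda>x. (case x of (\<epsilon>, q) \<Rightarrow> Q \<epsilon> q) $ i)"
      using exhaust_3[of i] 1 2 3 by (auto simp: Q_def split_beta')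
  qed
  have sm\<phi>: "smooth_on (E1 \<times> S1) (\<lambda>(\<epsilon>, p). \<phi> \<epsilon> p)"
    using smooth_on_linear_image[OF ES1o bounded_linear_snd smooth_on_subset[OF sm\<theta>]] sub
    by (simp add: \<phi>_def split_beta' Sigma_mono)
  have poissonQ: "poisson_on S2 (Q \<epsilon>)" if \<epsilon>: "\<epsilon> \<in> E2" for \<epsilon>
    unfolding poisson_on_def
  proof (intro conjI allI impI ballI)
    show smQ\<epsilon>: "smooth_on S2 (Q \<epsilon>)" by (rule smooth_on_slice[OF E2(1) S2(1) smQ \<epsilon>])
    fix f h k :: "real^3 \<Rightarrow> real" and q assume fhk: "smooth_on S2 f \<and> smooth_on S2 h \<and> smooth_on S2 k" and q: "q \<in> S2"
    obtain p where p: "p \<in> S1" "q = \<phi> \<epsilon> p" "\<epsilon> \<in> E1" using inT[of \<epsilon> q] ES2 \<epsilon> q by blast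
    have sm\<phi>\<epsilon>: "smooth_on S1 (\<phi> \<epsilon>)" by (rule smooth_on_slice[OF E1(1) S1(1) sm\<phi> p(3)])
    \<comment> \<open>The test functions live on \<open>S2\<close> only; pull them back to the part of \<open>S1\<close> that is mapped there.\<close>
    define S3 where "S3 = S1 \<inter> \<phi> \<epsilon> -` S2"
    have "continuous_on S1 (\<phi> \<epsilon>)" using sm\<phi>\<epsilon> by (metis Ck_on.simps(1) smooth_on_def)
    then have S3: "open S3" unfolding S3_def by (rule continuous_open_preimage) (use S1 S2 in auto)
    have "\<epsilon> \<in> E" using p sub by blast
    then have cd: "smooth_on S (P \<epsilon>)" "\<And>p. p \<in> S \<Longrightarrow> curl_defect (P \<epsilon>) p = 0"
      using poisson poisson_on_iff_curl_defect[OF S(1)] by blast+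
    show "bracket (Q \<epsilon>) f (bracket (Q \<epsilon>) h k) q + bracket (Q \<epsilon>) h (bracket (Q \<epsilon>) k f) q
       + bracket (Q \<epsilon>) k (bracket (Q \<epsilon>) f h) q = 0"
      unfolding p(2)
    proof (rule jacobi_pushforward[where S = S3 and T = S2 and P = "P \<epsilon>" and \<phi> = "\<phi> \<epsilon>" and p = p])
      show "p \<in> S3" using p q by (simp add: S3_def)
      show "smooth_on S3 (P \<epsilon>)" by (rule smooth_on_subset[OF cd(1)]) (use sub in \<open>auto simp: S3_def\<close>)
      show "smooth_on S3 (\<phi> \<epsilon>)" using smooth_on_subset[OF sm\<phi>\<epsilon>] by (auto simp: S3_def)
      show "curl_defect (P \<epsilon>) q = 0" if "q \<in> S3" for q :: "real^3" using cd(2) that sub by (auto simp: S3_def)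
      show "Q \<epsilon> (\<phi> \<epsilon> q) = pushforward_at (\<phi> \<epsilon>) (P \<epsilon>) q" if "q \<in> S3" for q
        using push p(3) that by (simp add: S3_def)
    qed (use S3 S2 smQ\<epsilon> fhk in \<open>auto simp: S3_def\<close>)
  qed
  have "local_poisson_family Q"
    unfolding local_poisson_family_def using E2 S2 smQ poissonQ by blast
  moreover have "equivalent_families P Q"
    unfolding equivalent_families_def
  proof (rule exI[of _ E1], rule exI[of _ S1], rule exI[of _ \<phi>], intro conjI ballI)
    fix \<epsilon> assume \<epsilon>: "\<epsilon> \<in> E1"
    show "Q \<epsilon> (\<phi> \<epsilon> p) = pushforward_at (\<phi> \<epsilon>) (P \<epsilon>) p" if "p \<in> S1" for p using push \<epsilon> that by blast
    \<comment> \<open>The image at a fixed parameter is a slice of the open set \<open>T\<close>.\<close>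
    have img: "\<phi> \<epsilon> ` S1 = (\<lambda>q. (\<epsilon>, q)) -` T"
      using \<epsilon> by (auto simp: T_def \<theta> image_iff Bex_def) blast
    have op: "open (\<phi> \<epsilon> ` S1)"
      unfolding img by (rule continuous_open_vimage[OF openT]) (intro continuous_intros)
    have "smooth_on (\<phi> \<epsilon> ` S1) (\<lambda>q. snd (g (\<epsilon>, q)))"
    proof (rule smooth_on_linear_image[OF op bounded_linear_snd], rule smooth_on_compose[OF op smg])
      show "smooth_on (\<phi> \<epsilon> ` S1) (\<lambda>q. (\<epsilon>, q))"
        by (intro smooth_on_Pair op smooth_on_const smooth_on_linear[OF op bounded_linear_ident])
      show "(\<epsilon>, q) \<in> V" if "q \<in> \<phi> \<epsilon> ` S1" for q using that TV unfolding img by blast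
    qed
    then have "smooth_on (\<phi> \<epsilon> ` S1) (\<psi> \<epsilon>)" by (simp add: \<psi>_def[abs_def])
    then show "diffeo_onto_image S1 (\<phi> \<epsilon>)"
      unfolding diffeo_onto_image_def
      using smooth_on_slice[OF E1(1) S1(1) sm\<phi> \<epsilon>] op \<psi>\<phi>[OF \<epsilon>] by blast
  qed (use E1 S1 sm\<phi> \<phi>0 in auto)
  ultimately show ?thesis using that[of yz zx] by (simp add: Q_def)
qed

theorem theorem1p1:
  fixes P :: "real^'l \<Rightarrow> bivector_field"
  assumes "local_poisson_family P"
    and "P 0 0 = 0"
    and "jet1 (P 0) \<noteq> (\<lambda>p. 0)"
    and "\<not> linear_isomorphic (jet1 (P 0)) exceptional_structure"
  shows "\<exists>(U :: real^'l \<Rightarrow> real^3 \<Rightarrow> real) (V :: real^'l \<Rightarrow> real^3 \<Rightarrow> real)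
            (Q :: real^'l \<Rightarrow> bivector_field).
      Q = (\<lambda>\<epsilon> p. vector [p $ 3, U \<epsilon> p, V \<epsilon> p]) \<and>
      local_poisson_family Q \<and>
      equivalent_families P Q \<and>
      (\<exists>E \<Phi> f g. open E \<and> 0 \<in> E \<and>
         smooth_coeffs3 E \<Phi> \<and> smooth_coeffs2 E f \<and> smooth_coeffs2 E g \<and>
         (\<forall>\<epsilon>\<in>E.
            formal_change (\<Phi> \<epsilon>) \<and>
            formal_reduces (\<Phi> \<epsilon>) (taylor_bivector (Q \<epsilon>)) (formal_normal_form (f \<epsilon>) (g \<epsilon>)) \<and>
            coeff2 (f \<epsilon>) 0 0 = 0 \<and> coeff2 (g \<epsilon>) 0 0 = 0 \<and>
            dx2 (f \<epsilon>) * dy2 (g \<epsilon>) - dy2 (f \<epsilon>) * dx2 (g \<epsilon>) = 0))"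
proof -
  obtain U V where loc: "local_poisson_family (\<lambda>\<epsilon> p. vector [p $ 3, U \<epsilon> p, V \<epsilon> p])"
    and eqv: "equivalent_families P (\<lambda>\<epsilon> p. vector [p $ 3, U \<epsilon> p, V \<epsilon> p])"
    by (rule straightening[OF assms])
  define Q where "Q = (\<lambda>\<epsilon> p. vector [p $ 3, U \<epsilon> p, V \<epsilon> p] :: real^3)"
  obtain E S where E: "open E" "0 \<in> E" and S: "open S" "0 \<in> S"
    and smQ: "smooth_on (E \<times> S) (\<lambda>(\<epsilon>, p). Q \<epsilon> p)" and poisson: "\<And>\<epsilon>. \<epsilon> \<in> E \<Longrightarrow> poisson_on S (Q \<epsilon>)"
    using loc unfolding local_poisson_family_def Q_def by blast
  define B where "B \<epsilon> = taylor_bivector (Q \<epsilon>)" for \<epsilon>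
  have B1: "B \<epsilon> $ 1 = Z3" for \<epsilon>
    using taylor_z[OF S] by (simp add: B_def taylor_bivector_def Q_def)
  have J: "formal_jacobi (B \<epsilon>)" if "\<epsilon> \<in> E" for \<epsilon>
    unfolding B_def by (rule formal_jacobi_taylor[OF S poisson[OF that]])
  have smB: "smooth3 E (\<lambda>\<epsilon>. B \<epsilon> $ m)" for m
    using smooth_coefficients_taylor[OF E(1) S, of "\<lambda>\<epsilon> p. Q \<epsilon> p $ m"]
      smooth_on_component[OF open_Times[OF E(1) S(1)] smQ, of m]
    by (simp add: smooth3_def B_def taylor_bivector_def split_beta')
  define \<Phi> where "\<Phi> \<epsilon> = chart (B \<epsilon>) (limit_X (B \<epsilon>))" for \<epsilon>
  define f where "f \<epsilon> = restrict32 (limit_F (B \<epsilon>))" for \<epsilon>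
  define g where "g \<epsilon> = restrict32 (limit_G (B \<epsilon>))" for \<epsilon>
  have "smooth_coeffs3 E \<Phi>"
    using smooth3_chart(2)[OF E(1) smB smooth3_limit(1)[OF E(1) smB]]
    by (simp add: smooth_coeffs3_def smooth3_def \<Phi>_def)
  moreover have "smooth_coeffs2 E f" "smooth_coeffs2 E g"
    using smooth3_limit(2,3)[OF E(1) smB] by (simp_all add: smooth_coeffs2_def smooth3_def f_def g_def)
  moreover note nf = formal_normal_form[OF B1 J, folded \<Phi>_def f_def g_def]
  ultimately show ?thesis
    using E loc eqv unfolding Q_def[symmetric]
    by (intro exI[of _ U] exI[of _ V] exI[of _ Q] exI[of _ E] exI[of _ \<Phi>] exI[of _ f] exI[of _ g] conjI ballI)
      (simp_all add: nf B_def[symmetric] Q_def[symmetric])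
qed

end
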